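(* Let $s>7/4$ and let $\varphi=\{\varphi_\Lambda\}_{\Lambda\Subset\Gamma}$ be a family of real-valued functions with $\varphi_\Lambda\in C^{2s}(\mathbb{S}^2_\Lambda)$ such that $$\|\varphi\|_{0,s}:=\sum_{m\ge0}(C_\Delta^sK_s)^m\sup_{x\in\Gamma}\sum_{\substack{|\Lambda|=m+1\\ x\in\Lambda}}\|\varphi_\Lambda\|_{C^{2s}(\mathbb{S}^2_\Lambda)}<+\infty,$$ where $\|\cdot\|_{C^{2s}(\mathbb{S}^2_\Lambda)}$ is the $C^{2s}$-norm on $C^{2s}((\mathbb{S}^2)^{|\Lambda|})$, while $K_s>1$ and $C_\Delta\ge1$ are defined by $$K_s:=\sum_{\ell\in\mathbb{Z}_+}\frac{(2\ell+1)^{5/2}}{[1+\ell(\ell+1)]^s},\qquad C_\Delta:=\|1-\Delta_{\mathbb{S}^2}\|_{C^2(\mathbb{S}^2)\to C^0(\mathbb{S}^2)},$$ the latter being the operator norm of $1-\Delta_{\mathbb{S}^2}\colon C^2(\mathbb{S}^2)\to C^0(\mathbb{S}^2)$. Then there exists a unique $(\beta,\delta_\infty^\Gamma)$-KMS classical state on $B_\infty^\Gamma$ for all $\beta\in[0,\beta_{0,s})$, where $$\beta_{0,s}:=\frac{\log2}{2C_\Delta^sK_s\|\varphi\|_{0,s}}.$$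
   Context: Notation: $\Gamma:=\mathbb{Z}^d$ with $d\ge1$; $\Lambda\Subset\Gamma$ means $\Lambda$ is a finite subset; $\mathbb{Z}_+=\{0,1,2,\dots\}$; $\Delta_{\mathbb{S}^2}$ is the Laplace-Beltrami operator of the unit sphere (eigenvalues $-\ell(\ell+1)$). If $\|\varphi\|_{0,s}=0$, $\beta_{0,s}$ is read as $+\infty$. Classical algebras: $\mathbb{S}^2_\Lambda:=(\mathbb{S}^2)^\Lambda$, $B_\infty^\Lambda:=C(\mathbb{S}^2_\Lambda)$, $\dot{B}_\infty^\Lambda:=C^\infty(\mathbb{S}^2_\Lambda)$, $B_\infty^\Gamma:=C((\mathbb{S}^2)^\Gamma)$ (product topology). Functions on $\mathbb{S}^2_{\Lambda_0}$ are identified with functions on $\mathbb{S}^2_{\Lambda_1}$, $\Lambda_0\subset\Lambda_1$, and on $(\mathbb{S}^2)^\Gamma$, not depending on the additional variables. $\dot{B}_\infty^\Gamma:=\bigcup_{\Lambda\Subset\Gamma}\dot{B}_\infty^\Lambda$. $C^r$-norms: for $x\in\Lambda$ let $L_{x,1},L_{x,2},L_{x,3}$ be the vector fields on $\mathbb{S}^2_\Lambda$ generating the rotations of the variable $\sigma_x$ around the three coordinate axes (so $\Delta_{\mathbb{S}^2}=L_1^2+L_2^2+L_3^2$ on one sphere). For an integer $k\ge0$, $\|f\|_{C^k(\mathbb{S}^2_\Lambda)}:=\max_w\sup|wf|$, the maximum being over all compositions $w$ of at most $k$ of the vector fields $L_{x,i}$, $x\in\Lambda$, $i=1,2,3$ (including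 the empty composition). For non-integer $r>0$, $C^r$ is the Hölder space of order $r$, with norm the sum of the $C^{\lfloor r\rfloor}$-norm and the maximum, over compositions $w$ of at most $\lfloor r\rfloor$ of these fields, of the Hölder seminorms of exponent $r-\lfloor r\rfloor$ of $wf$. Poisson structure: on $\mathbb{S}^2\subset\mathbb{R}^3$ put $\{f,g\}(\sigma):=2\,\sigma\cdot(\nabla f(\sigma)\times\nabla g(\sigma))$ (defined for $C^1$ functions); on $\mathbb{S}^2_\Lambda$ use the product bracket (sum over sites $x\in\Lambda$ of the brackets in $\sigma_x$), denoted $\{\,,\,\}_{B_\infty^\Lambda}$, and set $\{a_{\Lambda_1},a_{\Lambda_2}\}_{B_\infty^\Gamma}:=\{a_{\Lambda_1},a_{\Lambda_2}\}_{B_\infty^{\Lambda_1\cup\Lambda_2}}$. Derivation and KMS condition: $\delta_\infty^\Gamma\colon\dot{B}_\infty^\Gamma\to B_\infty^\Gamma$ is $\delta_\infty^\Gamma(a_\Lambda):=\sum_{X\Subset\Gamma,\,X\cap\Lambda\ne\varnothing}\{a_\Lambda,\varphi_X\}_{B_\infty^\Gamma}$ for $a_\Lambda\in\dot{B}_\infty^\Lambda$. A state $\omega$ (positive normalized linear functional) on $B_\infty^\Gamma$ is a $(\beta,\delta_\infty^\Gamma)$-KMS classical state if $\omega(\{a,b\}_{B_\infty^\Gamma})=\beta\,\omega(b\,\delta_\infty^\Gamma(a))$ for all $a,b\in\dot{B}_\infty^\Gamma$. *)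

theory Defs
  imports "HOL-Analysis.Analysis"
begin

section \<open>The unit sphere and configuration spaces\<close>

typedef s2 = "sphere (0::real^3) 1"
  morphisms vec_of_s2 Abs_s2
  by (rule exI[of _ "axis 1 1"]) simp

instantiation s2 :: metric_space
begin

definition dist_s2 :: "s2 \<Rightarrow> s2 \<Rightarrow> real"
  where "dist_s2 p q = dist (vec_of_s2 p) (vec_of_s2 q)"

definition uniformity_s2 :: "(s2 \<times> s2) filter"
  where "uniformity_s2 = (INF e\<in>{0 <..}. principal {(x, y). dist x y < e})"

definition open_s2 :: "s2 set \<Rightarrow> bool"
  where "open_s2 U = (\<forall>x\<in>U. \<forall>\<^sub>F (x', y) in uniformity. x' = x \<longrightarrow> y \<in> U)"

instance
proof
  fix x y z :: s2
  show "(dist x y = 0) = (x = y)"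
    by (simp add: dist_s2_def vec_of_s2_inject)
  show "dist x y \<le> dist x z + dist y z"
    unfolding dist_s2_def by (rule dist_triangle2)
qed (simp_all add: uniformity_s2_def open_s2_def)

end

text \<open>A configuration over the site set \<open>'g\<close> is a function \<open>'g \<Rightarrow> s2\<close>; the topology on this type
  is the product topology. A function on the configurations over a set of sites \<open>\<Lambda>\<close> is
  identified, throughout, with the function on all configurations that does not depend on the
  sites outside \<open>\<Lambda>\<close>.\<close>

type_synonym 'g config = "'g \<Rightarrow> s2"

definition depends_only_on :: "'g set \<Rightarrow> ('g config \<Rightarrow> 'b) \<Rightarrow> bool"
  where "depends_only_on \<Lambda> f \<longleftrightarrow> (\<forall>\<sigma> \<tau>. (\<forall>x\<in>\<Lambda>. \<sigma> x = \<tau> x) \<longrightarrow> f \<sigma> = f \<tau>)"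


section \<open>Rotation fields, \<open>C\<^sup>k\<close>- and Hoelder spaces\<close>

text \<open>Rotation by the angle \<open>t\<close> around the \<open>i\<close>-th coordinate axis (Rodrigues' formula).\<close>

definition rotate_vec :: "3 \<Rightarrow> real \<Rightarrow> real^3 \<Rightarrow> real^3"
  where "rotate_vec i t v =
    cos t *\<^sub>R v + sin t *\<^sub>R cross3 (axis i 1) v + ((1 - cos t) * v $ i) *\<^sub>R axis i 1"

lemma norm_rotate_vec: "norm (rotate_vec i t v) = norm v"
proof -
  have "(sin t)\<^sup>2 + (cos t)\<^sup>2 = 1" by simp
  then have "(c * a - d * b)\<^sup>2 + (c * b + d * a)\<^sup>2 = a\<^sup>2 + b\<^sup>2" if "c = cos t" "d = sin t" for a b c d
    using that by algebra
  note rot = this[OF refl refl]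
  have "rotate_vec i t v \<bullet> rotate_vec i t v = v \<bullet> v"
    using exhaust_3[of i] rot[of "v$1" "v$2"] rot[of "v$2" "v$3"] rot[of "v$3" "v$1"]
    by (auto simp: rotate_vec_def cross3_def inner_vec_def sum_3 axis_def vector_def
        power2_eq_square algebra_simps)
  then show ?thesis by (simp add: norm_eq_sqrt_inner)
qed

definition rotate :: "3 \<Rightarrow> real \<Rightarrow> s2 \<Rightarrow> s2"
  where "rotate i t p = Abs_s2 (rotate_vec i t (vec_of_s2 p))"

lemma vec_of_s2_rotate: "vec_of_s2 (rotate i t p) = rotate_vec i t (vec_of_s2 p)"
  using vec_of_s2[of p] by (simp add: rotate_def Abs_s2_inverse norm_rotate_vec)

definition rotation_curve :: "'g \<Rightarrow> 3 \<Rightarrow> 'g config \<Rightarrow> real \<Rightarrow> 'g config"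
  where "rotation_curve x i \<sigma> t = \<sigma>(x := rotate i t (\<sigma> x))"

definition rot_field :: "'g \<Rightarrow> 3 \<Rightarrow> ('g config \<Rightarrow> 'b::real_normed_vector) \<Rightarrow> 'g config \<Rightarrow> 'b"
  where "rot_field x i f \<sigma> = vector_derivative (\<lambda>t. f (rotation_curve x i \<sigma> t)) (at 0)"

definition field_words :: "nat \<Rightarrow> 'g set \<Rightarrow> ('g \<times> 3) list set"
  where "field_words k \<Lambda> = {w. set w \<subseteq> \<Lambda> \<times> UNIV \<and> length w \<le> k}"

fun apply_word :: "('g \<times> 3) list \<Rightarrow> ('g config \<Rightarrow> 'b::real_normed_vector) \<Rightarrow> 'g config \<Rightarrow> 'b" where
  "apply_word [] f = f"
| "apply_word ((x, i) # w) f = rot_field x i (apply_word w f)"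

text \<open>The rotation fields span every tangent space, so a function is of class \<open>C\<^sup>k\<close> iff all its
  iterated derivatives of order at most \<open>k\<close> along these fields exist and are continuous.
  Existence has to be demanded separately, as \<^const>\<open>vector_derivative\<close> is total.\<close>

definition Ck :: "nat \<Rightarrow> 'g set \<Rightarrow> ('g config \<Rightarrow> 'b::real_normed_vector) \<Rightarrow> bool"
  where "Ck k \<Lambda> f \<longleftrightarrow> depends_only_on \<Lambda> f \<and>
    (\<forall>w\<in>field_words k \<Lambda>. continuous_on UNIV (apply_word w f)) \<and>
    (\<forall>w x i. (x, i) # w \<in> field_words k \<Lambda> \<longrightarrow>
      (\<forall>\<sigma>. (\<lambda>t. apply_word w f (rotation_curve x i \<sigma> t)) differentiable (at 0)))"

definition Csmooth :: "'g set \<Rightarrow> ('g config \<Rightarrow> 'b::real_normed_vector) \<Rightarrow> bool"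
  where "Csmooth \<Lambda> f \<longleftrightarrow> (\<forall>k. Ck k \<Lambda> f)"

definition sup_norm :: "('g config \<Rightarrow> 'b::real_normed_vector) \<Rightarrow> ennreal"
  where "sup_norm f = (SUP \<sigma>. ennreal (norm (f \<sigma>)))"

definition Ck_norm :: "nat \<Rightarrow> 'g set \<Rightarrow> ('g config \<Rightarrow> 'b::real_normed_vector) \<Rightarrow> ennreal"
  where "Ck_norm k \<Lambda> f = (SUP w\<in>field_words k \<Lambda>. sup_norm (apply_word w f))"

text \<open>Geodesic distance of the product Riemannian metric on the configurations over \<open>\<Lambda>\<close>.\<close>

definition geodesic_dist :: "'g set \<Rightarrow> 'g config \<Rightarrow> 'g config \<Rightarrow> real"
  where "geodesic_dist \<Lambda> \<sigma> \<tau> =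
    sqrt (\<Sum>x\<in>\<Lambda>. (arccos (vec_of_s2 (\<sigma> x) \<bullet> vec_of_s2 (\<tau> x)))\<^sup>2)"

definition holder_seminorm ::
    "real \<Rightarrow> 'g set \<Rightarrow> ('g config \<Rightarrow> 'b::real_normed_vector) \<Rightarrow> ennreal"
  where "holder_seminorm \<alpha> \<Lambda> f =
    (SUP (\<sigma>, \<tau>)\<in>{(\<sigma>, \<tau>). \<exists>x\<in>\<Lambda>. \<sigma> x \<noteq> \<tau> x}.
      ennreal (norm (f \<sigma> - f \<tau>) / geodesic_dist \<Lambda> \<sigma> \<tau> powr \<alpha>))"

definition Cr :: "real \<Rightarrow> 'g set \<Rightarrow> ('g config \<Rightarrow> 'b::real_normed_vector) \<Rightarrow> bool"
  where "Cr r \<Lambda> f \<longleftrightarrow> Ck (nat \<lfloor>r\<rfloor>) \<Lambda> f \<and>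
    (r \<notin> \<int> \<longrightarrow> (\<forall>w\<in>field_words (nat \<lfloor>r\<rfloor>) \<Lambda>. holder_seminorm (frac r) \<Lambda> (apply_word w f) < \<infinity>))"

definition Cr_norm :: "real \<Rightarrow> 'g set \<Rightarrow> ('g config \<Rightarrow> 'b::real_normed_vector) \<Rightarrow> ennreal"
  where "Cr_norm r \<Lambda> f = Ck_norm (nat \<lfloor>r\<rfloor>) \<Lambda> f +
    (if r \<in> \<int> then 0
     else (SUP w\<in>field_words (nat \<lfloor>r\<rfloor>) \<Lambda>. holder_seminorm (frac r) \<Lambda> (apply_word w f)))"


section \<open>Poisson brackets\<close>

text \<open>The gradient in the variable \<open>\<sigma>\<^sub>x\<close>: the gradient on \<open>\<real>\<^sup>3\<close> of the extension of the function that is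
  constant along rays from the origin (\<^term>\<open>sgn y\<close> is \<^term>\<open>y /\<^sub>R norm y\<close>), i.e. the tangential
  gradient; any other extension would yield the same bracket.\<close>

definition site_gradient :: "'g \<Rightarrow> ('g config \<Rightarrow> complex) \<Rightarrow> 'g config \<Rightarrow> complex^3"
  where "site_gradient x f \<sigma> =
    (\<chi> j. frechet_derivative (\<lambda>y. f (\<sigma>(x := Abs_s2 (sgn y)))) (at (vec_of_s2 (\<sigma> x))) (axis j 1))"

text \<open>\<^const>\<open>cross3\<close> is only available for real vectors.\<close>

definition complex_cross3 :: "complex^3 \<Rightarrow> complex^3 \<Rightarrow> complex^3"
  where "complex_cross3 a b =
    vector [a$2 * b$3 - a$3 * b$2, a$3 * b$1 - a$1 * b$3, a$1 * b$2 - a$2 * b$1]"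

definition poisson ::
    "'g set \<Rightarrow> ('g config \<Rightarrow> complex) \<Rightarrow> ('g config \<Rightarrow> complex) \<Rightarrow> 'g config \<Rightarrow> complex"
  where "poisson \<Lambda> f g \<sigma> =
    (\<Sum>x\<in>\<Lambda>. 2 * (\<Sum>j\<in>UNIV. complex_of_real (vec_of_s2 (\<sigma> x) $ j) *
      complex_cross3 (site_gradient x f \<sigma>) (site_gradient x g \<sigma>) $ j))"


section \<open>KMS states\<close>

text \<open>As the configuration space is compact, \<open>'g config \<Rightarrow>\<^sub>C complex\<close> is the algebra of all
  continuous functions on it. The family \<open>\<phi>\<close> is only used at finite sets of sites. The series
  below is taken in the sup norm.\<close>

definition derivation ::
    "('g set \<Rightarrow> 'g config \<Rightarrow> real) \<Rightarrow> 'g set \<Rightarrow> ('g config \<Rightarrow> complex) \<Rightarrow> ('g config \<Rightarrow>\<^sub>C complex)"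
  where "derivation \<phi> \<Lambda> a =
    (\<Sum>\<^sub>\<infinity>X\<in>{X. finite X \<and> X \<inter> \<Lambda> \<noteq> {}}.
      Bcontfun (poisson (\<Lambda> \<union> X) a (\<lambda>\<sigma>. complex_of_real (\<phi> X \<sigma>))))"

definition is_state :: "(('g config \<Rightarrow>\<^sub>C complex) \<Rightarrow> complex) \<Rightarrow> bool"
  where "is_state \<omega> \<longleftrightarrow>
    (\<forall>f g. \<omega> (f + g) = \<omega> f + \<omega> g) \<and>
    (\<forall>c f. \<omega> (Bcontfun (\<lambda>\<sigma>. c * apply_bcontfun f \<sigma>)) = c * \<omega> f) \<and>
    (\<forall>f. (\<forall>\<sigma>. apply_bcontfun f \<sigma> \<in> \<real> \<and> 0 \<le> Re (apply_bcontfun f \<sigma>)) \<longrightarrow> \<omega> f \<in> \<real> \<and> 0 \<le> Re (\<omega> f)) \<and>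
    \<omega> (const_bcontfun 1) = 1"

definition classical_KMS ::
    "real \<Rightarrow> ('g set \<Rightarrow> 'g config \<Rightarrow> real) \<Rightarrow> (('g config \<Rightarrow>\<^sub>C complex) \<Rightarrow> complex) \<Rightarrow> bool"
  where "classical_KMS \<beta> \<phi> \<omega> \<longleftrightarrow> is_state \<omega> \<and>
    (\<forall>\<Lambda>1 \<Lambda>2 a b. finite \<Lambda>1 \<longrightarrow> finite \<Lambda>2 \<longrightarrow> Csmooth \<Lambda>1 a \<longrightarrow> Csmooth \<Lambda>2 b \<longrightarrow>
      \<omega> (Bcontfun (poisson (\<Lambda>1 \<union> \<Lambda>2) a b)) =
      of_real \<beta> * \<omega> (Bcontfun (\<lambda>\<sigma>. b \<sigma> * apply_bcontfun (derivation \<phi> \<Lambda>1 a) \<sigma>)))"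


section \<open>Constants\<close>

definition K_const :: "real \<Rightarrow> real"
  where "K_const s = (\<Sum>l::nat. (2 * real l + 1) powr (5/2) / (1 + real l * (real l + 1)) powr s)"

text \<open>A single sphere is the space of configurations over a one-point set of sites.\<close>

definition laplacian :: "(unit config \<Rightarrow> complex) \<Rightarrow> unit config \<Rightarrow> complex"
  where "laplacian f \<sigma> = (\<Sum>i\<in>UNIV. rot_field () i (rot_field () i f) \<sigma>)"

definition C_Delta :: real
  where "C_Delta = enn2real
    (SUP f\<in>{f :: unit config \<Rightarrow> complex. Ck 2 UNIV f \<and> Ck_norm 2 UNIV f \<le> 1}.
      Ck_norm 0 UNIV (\<lambda>\<sigma>. f \<sigma> - laplacian f \<sigma>))"

definition potential_norm :: "real \<Rightarrow> ('g set \<Rightarrow> 'g config \<Rightarrow> real) \<Rightarrow> ennreal"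
  where "potential_norm s \<phi> =
    (\<Sum>m. ennreal ((C_Delta powr s * K_const s) ^ m) *
      (SUP x. \<Sum>\<^sub>\<infinity>\<Lambda>\<in>{\<Lambda>. finite \<Lambda> \<and> card \<Lambda> = m + 1 \<and> x \<in> \<Lambda>}. Cr_norm (2 * s) \<Lambda> (\<phi> \<Lambda>)))"

text \<open>In \<^typ>\<open>ennreal\<close> the quotient of a positive number by \<open>0\<close> is \<open>\<infinity>\<close>.\<close>

definition beta_crit :: "real \<Rightarrow> ('g set \<Rightarrow> 'g config \<Rightarrow> real) \<Rightarrow> ennreal"
  where "beta_crit s \<phi> =
    ennreal (ln 2) / (2 * ennreal (C_Delta powr s * K_const s) * potential_norm s \<phi>)"

end

theory Submission
  imports Defs "HOL-Probability.Probability_Measure"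
begin

text \<open>
  Taking \<open>a\<close> to be a coordinate function of the spin \<open>\<sigma>\<^sub>x\<close>, the KMS condition becomes
  \<open>\<omega>(L b) = \<beta> \<omega>(b L H\<^sub>x)\<close> for the rotation fields \<open>L\<close> at \<open>x\<close>, where \<open>H\<^sub>x\<close> is the
  energy of all interactions containing \<open>x\<close>. Hence \<open>\<omega>(\<cdot> exp (\<beta> H\<^sub>x))\<close> is rotation invariant at \<open>x\<close>,
  and since on a sphere every polynomial is a constant plus derivatives along rotation fields, it
  integrates \<open>\<sigma>\<^sub>x\<close> out uniformly: \<open>\<omega>\<close> is a Gibbs state in the sense of Dobrushin, Lanford and Ruelle.
  The coordinate functions show that \<open>C\<^sub>\<Delta> \<ge> 3\<close>, so that below the critical inverse temperature
  \<open>\<beta> \<Sum>\<^bsub>X \<ni> x\<^esub> |X| \<parallel>\<phi>\<^sub>X\<parallel> \<le> (log 2) / 6\<close>, which puts the system into Dobrushin's uniqueness regime.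

  For existence, a Hamiltonian vector field on a sphere is divergence free; integrating by parts,
  Gibbs states in finite volumes satisfy the KMS condition for the energy of the volume, and by
  compactness they have a cluster point as the volume increases.
\<close>

section \<open>Configurations and polynomial functions\<close>

text \<open>The KMS condition speaks of smooth functions of finitely many spins, whereas the energy
  of a site is only known to be C^1 and involves all sites; its exponential is therefore no
  admissible test function. Polynomial functions of the spin coordinates (\<open>poly_fun\<close>)
  bridge the gap: they are admissible, stable under rotations and rotation fields, and uniformly
  dense. The identity obtained for them is integrated along a rotation flow, after which only
  values, and no derivatives, have to be approximated. A second gap lies between the bracket,
  defined by Frechet derivatives of a radial extension, and regularity, defined by rotation fields;
  a chart made of two rotations closes it. On the numbers: a perturbation of the energy by at most
  \<eta> moves a single-site Gibbs expectation by at most 4 \<eta> times the oscillation, and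
  changing one spin moves each interaction by at most twice its norm. Dobrushin's coefficient is
  thus at most 8 times the quantity bounded by (log 2) / 6, and log 2 \<le> 25/36 gives
  25/27.\<close>

lemma continuous_on_vec_of_s2: "continuous_on UNIV vec_of_s2"
  unfolding continuous_on_iff by (auto simp: dist_s2_def)

lemma continuous_on_into_s2:
  "continuous_on S (\<lambda>x. vec_of_s2 (f x)) \<Longrightarrow> continuous_on S f"
  unfolding continuous_on_def tendsto_iff by (simp add: dist_s2_def)

lemma norm_vec_of_s2 [simp]: "norm (vec_of_s2 p) = 1"
  using vec_of_s2[of p] by simp

lemma compact_UNIV_s2: "compact (UNIV :: s2 set)"
proof -
  have "continuous_on (sphere 0 1) Abs_s2"
    by (rule continuous_on_into_s2, rule continuous_on_cong[THEN iffD2, OF refl _ continuous_on_id])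
      (simp add: Abs_s2_inverse)
  then have "compact (Abs_s2 ` sphere 0 1)"
    by (rule compact_continuous_image) simp
  moreover have "Abs_s2 ` sphere 0 1 = UNIV"
    by (auto intro: Abs_s2_cases)
  ultimately show ?thesis by simp
qed

lemma compact_UNIV_config: "compact (UNIV :: 'g config set)"
proof -
  have "compact_space (product_topology (\<lambda>_::'g. euclidean :: s2 topology) UNIV)"
    unfolding compact_space_product_topology by (simp add: compact_space_def compact_UNIV_s2)
  then show ?thesis
    by (simp add: euclidean_product_topology compact_space_def)
qed

lemma continuous_on_site: "continuous_on S (\<lambda>\<sigma>. \<sigma> x)"
  by (rule continuous_on_product_then_coordinatewise[OF continuous_on_id])

lemma continuous_on_into_config:
  "(\<And>y. continuous_on S (\<lambda>z. f z y)) \<Longrightarrow> continuous_on S (f :: 'z::topological_space \<Rightarrow> 'g config)"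
  by (rule continuous_on_coordinatewise_then_product)

lemma continuous_on_update:
  assumes "continuous_on S f" "continuous_on S g"
  shows "continuous_on S (\<lambda>z. (f z)(x := g z) :: 'g config)"
proof (rule continuous_on_into_config)
  fix y
  have "continuous_on S (\<lambda>z. f z y)"
    using assms(1) by (rule continuous_on_product_then_coordinatewise)
  then show "continuous_on S (\<lambda>z. ((f z)(x := g z)) y)"
    using assms(2) by (cases "y = x") auto
qed

text \<open>Indices of type \<open>3\<close> add modulo 3, so i, i + 1, i + 2 runs through the axes
  cyclically and preserves orientation. Facts stated for a generic i treat all three axes at once;
  these equations return to the representatives 1, 2, 3 used by \<open>exhaust_3\<close>.\<close>

lemma numeral_mod_3: "(4::3) = 1" "(5::3) = 2" "(0::3) = 3"
  by simp_all

lemma rotate_vec_nth: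
  "rotate_vec i t v $ i = v $ i"
  "rotate_vec i t v $ (i + 1) = cos t * v $ (i + 1) - sin t * v $ (i + 2)"
  "rotate_vec i t v $ (i + 2) = cos t * v $ (i + 2) + sin t * v $ (i + 1)"
  using exhaust_3[of i]
  by (auto simp: rotate_vec_def cross3_def axis_def vector_def algebra_simps numeral_mod_3)

lemma vec3_eqI: "v $ i = w $ i \<Longrightarrow> v $ (i + 1) = w $ (i + 1) \<Longrightarrow> v $ (i + 2) = w $ (i + 2) \<Longrightarrow> v = w"
  for v w :: "'a^3"
  using exhaust_3[of i] by (auto simp: vec_eq_iff forall_3 numeral_mod_3)

lemma rotate_vec_add: "rotate_vec i s (rotate_vec i t v) = rotate_vec i (s + t) v"
  by (rule vec3_eqI[of _ i])
    (simp_all only: rotate_vec_nth cos_add sin_add, simp_all add: algebra_simps)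

lemma rotate_vec_0 [simp]: "rotate_vec i 0 v = v"
  by (simp add: rotate_vec_def)

lemma linear_rotate_vec: "linear (rotate_vec i t)"
  by (rule linearI; rule vec3_eqI[of _ i])
    (simp_all only: rotate_vec_nth vector_add_component vector_scaleR_component, simp_all add: algebra_simps)

lemma rotate_add: "rotate i s (rotate i t p) = rotate i (s + t) p"
  by (rule vec_of_s2_inject[THEN iffD1]) (simp add: vec_of_s2_rotate rotate_vec_add)

lemma rotate_0 [simp]: "rotate i 0 p = p"
  by (rule vec_of_s2_inject[THEN iffD1]) (simp add: vec_of_s2_rotate)

lemma bounded_linear_cross3: "bounded_linear (cross3 u)"
  by (simp add: linear_conv_bounded_linear[symmetric] linear_iff cross_add_right cross_mult_right)

lemma continuous_on_rotate:
  assumes "continuous_on S f" "continuous_on S g"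
  shows "continuous_on S (\<lambda>z. rotate i (f z) (g z))"
proof (rule continuous_on_into_s2)
  have "continuous_on S (\<lambda>z. vec_of_s2 (g z))"
    using continuous_on_compose2[OF continuous_on_vec_of_s2 assms(2)] by simp
  then show "continuous_on S (\<lambda>z. vec_of_s2 (rotate i (f z) (g z)))"
    unfolding vec_of_s2_rotate rotate_vec_def
    by (intro continuous_intros continuous_on_component assms
        continuous_on_compose2[OF continuous_on_cos[OF continuous_on_id] assms(1) subset_UNIV]
        continuous_on_compose2[OF continuous_on_sin[OF continuous_on_id] assms(1) subset_UNIV]
        continuous_on_compose2[OF linear_continuous_on[OF bounded_linear_cross3] _ subset_UNIV])
qed

lemma rotation_curve_add: "rotation_curve x i (rotation_curve x i \<sigma> s) t = rotation_curve x i \<sigma> (s + t)"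
  by (simp add: rotation_curve_def rotate_add add.commute)

lemma rotation_curve_0 [simp]: "rotation_curve x i \<sigma> 0 = \<sigma>"
  by (simp add: rotation_curve_def)

lemma continuous_on_rotation_curve:
  assumes "continuous_on S f" "continuous_on S g"
  shows "continuous_on S (\<lambda>z. rotation_curve x i (f z) (g z))"
  unfolding rotation_curve_def
  by (intro continuous_on_update continuous_on_rotate assms
      continuous_on_product_then_coordinatewise[OF assms(1)])

lemmas continuous_on_rotation_curve' =
  continuous_on_compose2[OF _ continuous_on_rotation_curve subset_UNIV]

section \<open>Polynomial functions of the spins: a dense algebra\<close>

definition coord :: "'g \<Rightarrow> 3 \<Rightarrow> 'g config \<Rightarrow> real"
  where "coord x i \<sigma> = vec_of_s2 (\<sigma> x) $ i"

lemma continuous_on_coord [continuous_intros]: "continuous_on S (coord x i)"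
  unfolding coord_def
  using continuous_on_component[OF continuous_on_compose2[OF continuous_on_vec_of_s2 continuous_on_site subset_UNIV]] .

lemma sum_coord_squared: "(\<Sum>i\<in>UNIV. (coord x i \<sigma>)\<^sup>2) = 1"
  using norm_vec_of_s2[of "\<sigma> x"] by (simp add: coord_def norm_vec_def L2_set_def)

text \<open>The common core of all density arguments: each member depends on finitely many spins and
  is smooth, the algebra is mapped to itself by rotations and by rotation fields, and it separates
  configurations.\<close>

inductive poly_fun :: "('g config \<Rightarrow> real) \<Rightarrow> bool" where
  const: "poly_fun (\<lambda>_. c)"
| coord: "poly_fun (coord x i)"
| add: "poly_fun f \<Longrightarrow> poly_fun g \<Longrightarrow> poly_fun (\<lambda>\<sigma>. f \<sigma> + g \<sigma>)"
| mult: "poly_fun f \<Longrightarrow> poly_fun g \<Longrightarrow> poly_fun (\<lambda>\<sigma>. f \<sigma> * g \<sigma>)"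

lemma poly_fun_continuous: "poly_fun f \<Longrightarrow> continuous_on S f"
  by (induction rule: poly_fun.induct) (auto intro!: continuous_intros)

lemma poly_fun_dense:
  assumes "continuous_on UNIV (f :: 'g::countable config \<Rightarrow> real)" "e > 0"
  obtains p where "poly_fun p" "\<And>\<sigma>. \<bar>f \<sigma> - p \<sigma>\<bar> < e"
proof -
  interpret function_ring_on "Collect poly_fun" "UNIV :: 'g config set"
  proof
    fix \<sigma> \<tau> :: "'g config" assume "\<sigma> \<noteq> \<tau>"
    then obtain x where "vec_of_s2 (\<sigma> x) \<noteq> vec_of_s2 (\<tau> x)"
      by (auto simp: fun_eq_iff vec_of_s2_inject)
    then obtain i where "coord x i \<sigma> \<noteq> coord x i \<tau>"
      by (auto simp: vec_eq_iff coord_def)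
    then show "\<exists>f\<in>Collect poly_fun. f \<sigma> \<noteq> f \<tau>"
      by (intro bexI[of _ "coord x i"]) (simp_all add: poly_fun.coord)
  qed (auto simp: compact_UNIV_config intro: poly_fun.intros poly_fun_continuous)
  show ?thesis
    using Stone_Weierstrass_basic[OF assms] that by auto
qed

lemma bounded_continuous_config:
  fixes f :: "'g config \<Rightarrow> 'b::real_normed_vector"
  assumes "continuous_on UNIV f"
  obtains B where "B > 0" "\<And>\<sigma>. norm (f \<sigma>) \<le> B"
  using compact_imp_bounded[OF compact_continuous_image[OF assms compact_UNIV_config]]
  by (auto simp: bounded_pos)

lemma bcontfun_config:
  fixes f :: "'g config \<Rightarrow> 'b::real_normed_vector"
  assumes "continuous_on UNIV f"
  shows "f \<in> bcontfun"
  using assms compact_imp_bounded[OF compact_continuous_image[OF assms compact_UNIV_config]]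
  by (simp add: bcontfun_def)

lemma apply_Bcontfun_config [simp]:
  fixes f :: "'g config \<Rightarrow> 'b::real_normed_vector"
  shows "continuous_on UNIV f \<Longrightarrow> apply_bcontfun (Bcontfun f) = f"
  by (simp add: Bcontfun_inverse bcontfun_config)

text \<open>By the tube lemma, compactness of the configuration space makes continuity in the angle
  at 0 uniform in the configuration.\<close>

lemma rotation_uniformly_continuous:
  fixes f :: "'g config \<Rightarrow> 'b::real_normed_vector"
  assumes "continuous_on UNIV f" "e > 0"
  obtains d where "d > 0" "\<And>t \<sigma>. \<bar>t\<bar> \<le> d \<Longrightarrow> norm (f (rotation_curve x i \<sigma> t) - f \<sigma>) \<le> e"
proof -
  have "continuous_on (UNIV \<times> UNIV) (\<lambda>(t, \<sigma>). f (rotation_curve x i \<sigma> t))"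
    unfolding split_def
    by (intro continuous_on_rotation_curve'[OF assms(1)] continuous_on_fst continuous_on_snd continuous_on_id)
  from continuous_on_prod_compactE[OF this compact_UNIV_config UNIV_I[of "0::real"] assms(2)]
  obtain X0 where X0: "0 \<in> X0" "open X0"
    "\<forall>t\<in>X0. \<forall>\<sigma>. dist (f (rotation_curve x i \<sigma> t)) (f \<sigma>) \<le> e"
    by auto
  from X0(1,2) obtain d where d: "d > 0" "cball 0 d \<subseteq> X0"
    by (meson open_contains_cball)
  show ?thesis
  proof (rule that[OF d(1)])
    fix t :: real and \<sigma> :: "'g config" assume "\<bar>t\<bar> \<le> d"
    then have "t \<in> X0" using d by auto
    then show "norm (f (rotation_curve x i \<sigma> t) - f \<sigma>) \<le> e"
      using X0(3) by (simp add: dist_norm)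
  qed
qed

section \<open>Derivatives along the rotation fields\<close>

abbreviation cplx :: "('a \<Rightarrow> real) \<Rightarrow> 'a \<Rightarrow> complex"
  where "cplx f \<equiv> (\<lambda>\<sigma>. complex_of_real (f \<sigma>))"

text \<open>A relation rather than the total operator \<open>rot_field\<close>, so that it carries
  the existence of the derivative. Asking for it at time 0 from every configuration suffices,
  because rotations about one axis form a flow.\<close>

definition has_rot_deriv ::
    "'g \<Rightarrow> 3 \<Rightarrow> ('g config \<Rightarrow> 'b::real_normed_vector) \<Rightarrow> ('g config \<Rightarrow> 'b) \<Rightarrow> bool"
  where "has_rot_deriv x i f f' \<longleftrightarrow>
    (\<forall>\<sigma>. ((\<lambda>t. f (rotation_curve x i \<sigma> t)) has_vector_derivative f' \<sigma>) (at 0))"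

text \<open>The flow property: the derivative at time t is the derivative at time 0 from the
  configuration already rotated by t.\<close>

lemma has_rot_derivD:
  assumes "has_rot_deriv x i f f'"
  shows "((\<lambda>t. f (rotation_curve x i \<sigma> t)) has_vector_derivative f' (rotation_curve x i \<sigma> t)) (at t within S)"
proof -
  have "((\<lambda>u. f (rotation_curve x i (rotation_curve x i \<sigma> t) u)) has_vector_derivative
      f' (rotation_curve x i \<sigma> t)) (at (t - t))"
    using assms by (simp add: has_rot_deriv_def)
  moreover have "((\<lambda>u. u - t) has_vector_derivative 1) (at t)"
    by (auto intro!: derivative_eq_intros)
  ultimately have "((\<lambda>u. f (rotation_curve x i (rotation_curve x i \<sigma> t) (u - t))) has_vector_derivative
      f' (rotation_curve x i \<sigma> t)) (at t)"
    using vector_diff_chain_at[of "\<lambda>u. u - t" 1 t] by (fastforce simp: o_def)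
  then show ?thesis
    by (simp add: rotation_curve_add has_vector_derivative_at_within)
qed

text \<open>The mean value inequality turns the uniform continuity of \<open>f'\<close> along the
  flow into a first-order Taylor remainder that is uniform over all configurations. Functionals
  bounded in the sup norm can therefore be differentiated along rotations.\<close>

lemma has_rot_deriv_uniform:
  fixes f f' :: "'g config \<Rightarrow> 'b::real_normed_vector"
  assumes "has_rot_deriv x i f f'" "continuous_on UNIV f'" "e > 0"
  obtains d where "d > 0"
    "\<And>h \<sigma>. \<bar>h\<bar> \<le> d \<Longrightarrow> norm (f (rotation_curve x i \<sigma> h) - f \<sigma> - h *\<^sub>R f' \<sigma>) \<le> \<bar>h\<bar> * e"
proof -
  obtain d where d: "d > 0" "\<And>t \<sigma>. \<bar>t\<bar> \<le> d \<Longrightarrow> norm (f' (rotation_curve x i \<sigma> t) - f' \<sigma>) \<le> e"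
    using rotation_uniformly_continuous[OF assms(2,3)] by metis
  show ?thesis
  proof (rule that[OF d(1)])
    fix h :: real and \<sigma> :: "'g config" assume h: "\<bar>h\<bar> \<le> d"
    have "norm (f (rotation_curve x i \<sigma> h) - f (rotation_curve x i \<sigma> 0) -
        (h - 0) *\<^sub>R f' (rotation_curve x i \<sigma> 0)) \<le> norm (h - 0) * e"
    proof (rule vector_differentiable_bound_linearization)
      show "((\<lambda>t. f (rotation_curve x i \<sigma> t)) has_vector_derivative f' (rotation_curve x i \<sigma> t))
          (at t within closed_segment 0 h)" for t
        by (rule has_rot_derivD[OF assms(1)])
      show "norm (f' (rotation_curve x i \<sigma> t) - f' (rotation_curve x i \<sigma> 0)) \<le> e"
        if "t \<in> closed_segment 0 h" for t
        using that h d(2) by (auto simp: closed_segment_eq_real_ivl split: if_splits)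
    qed auto
    then show "norm (f (rotation_curve x i \<sigma> h) - f \<sigma> - h *\<^sub>R f' \<sigma>) \<le> \<bar>h\<bar> * e" by simp
  qed
qed

lemma rot_field_eq: "has_rot_deriv x i f f' \<Longrightarrow> rot_field x i f = f'"
  by (auto simp: has_rot_deriv_def rot_field_def fun_eq_iff vector_derivative_at)

lemma has_rot_deriv_const: "has_rot_deriv x i (\<lambda>_. c) (\<lambda>_. 0)"
  by (simp add: has_rot_deriv_def)

lemma has_rot_deriv_add:
  "has_rot_deriv x i f f' \<Longrightarrow> has_rot_deriv x i g g' \<Longrightarrow>
    has_rot_deriv x i (\<lambda>\<sigma>. f \<sigma> + g \<sigma>) (\<lambda>\<sigma>. f' \<sigma> + g' \<sigma>)"
  by (auto simp: has_rot_deriv_def intro: has_vector_derivative_add)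

lemma has_rot_deriv_sum:
  "(\<And>k. k \<in> I \<Longrightarrow> has_rot_deriv x i (f k) (f' k)) \<Longrightarrow>
    has_rot_deriv x i (\<lambda>\<sigma>. \<Sum>k\<in>I. f k \<sigma>) (\<lambda>\<sigma>. \<Sum>k\<in>I. f' k \<sigma>)"
  by (auto simp: has_rot_deriv_def intro: has_vector_derivative_sum)

lemma has_rot_deriv_mult:
  fixes f g :: "'g config \<Rightarrow> 'b::real_normed_algebra"
  shows "has_rot_deriv x i f f' \<Longrightarrow> has_rot_deriv x i g g' \<Longrightarrow>
    has_rot_deriv x i (\<lambda>\<sigma>. f \<sigma> * g \<sigma>) (\<lambda>\<sigma>. f \<sigma> * g' \<sigma> + f' \<sigma> * g \<sigma>)"
  unfolding has_rot_deriv_def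
proof
  fix \<sigma>
  assume "\<forall>\<sigma>. ((\<lambda>t. f (rotation_curve x i \<sigma> t)) has_vector_derivative f' \<sigma>) (at 0)"
    "\<forall>\<sigma>. ((\<lambda>t. g (rotation_curve x i \<sigma> t)) has_vector_derivative g' \<sigma>) (at 0)"
  from has_vector_derivative_mult[OF this[THEN spec[of _ \<sigma>]]]
  show "((\<lambda>t. f (rotation_curve x i \<sigma> t) * g (rotation_curve x i \<sigma> t)) has_vector_derivative
      f \<sigma> * g' \<sigma> + f' \<sigma> * g \<sigma>) (at 0)" by simp
qed

lemma has_rot_deriv_linear:
  "bounded_linear T \<Longrightarrow> has_rot_deriv x i f f' \<Longrightarrow> has_rot_deriv x i (\<lambda>\<sigma>. T (f \<sigma>)) (\<lambda>\<sigma>. T (f' \<sigma>))"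
  by (auto simp: has_rot_deriv_def intro: bounded_linear.has_vector_derivative)

lemma has_rot_deriv_chain:
  fixes f :: "'g config \<Rightarrow> real"
  assumes "has_rot_deriv x i f f'" "\<And>\<sigma>. (g has_real_derivative g' (f \<sigma>)) (at (f \<sigma>))"
  shows "has_rot_deriv x i (\<lambda>\<sigma>. g (f \<sigma>)) (\<lambda>\<sigma>. g' (f \<sigma>) * f' \<sigma>)"
  unfolding has_rot_deriv_def
proof
  fix \<sigma>
  have "((\<lambda>t. f (rotation_curve x i \<sigma> t)) has_real_derivative f' \<sigma>) (at 0)"
    using assms(1) by (simp add: has_rot_deriv_def has_real_derivative_iff_has_vector_derivative)
  moreover have "(g has_real_derivative g' (f \<sigma>)) (at (f (rotation_curve x i \<sigma> 0)))"
    using assms(2)[of \<sigma>] by simp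
  ultimately show "((\<lambda>t. g (f (rotation_curve x i \<sigma> t))) has_vector_derivative g' (f \<sigma>) * f' \<sigma>) (at 0)"
    unfolding has_real_derivative_iff_has_vector_derivative[symmetric] by (metis DERIV_chain2)
qed

lemma has_rot_deriv_indep:
  assumes "\<And>\<sigma> p. f (\<sigma>(x := p)) = f \<sigma>"
  shows "has_rot_deriv x i f (\<lambda>_. 0)"
  by (simp add: has_rot_deriv_def rotation_curve_def assms)

lemma rotate_vec_derivative:
  "((\<lambda>t. rotate_vec i t v) has_vector_derivative cross3 (axis i 1) v) (at 0)"
  unfolding rotate_vec_def
  by (auto intro!: derivative_eq_intros simp: has_real_derivative_iff_has_vector_derivative[symmetric])

lemma coord_rotation_curve:
  "coord y j (rotation_curve x i \<sigma> t) =
    (if y = x then rotate_vec i t (vec_of_s2 (\<sigma> x)) $ j else coord y j \<sigma>)"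
  by (simp add: coord_def rotation_curve_def vec_of_s2_rotate)

lemma has_rot_deriv_coord:
  "has_rot_deriv x i (coord y j) (\<lambda>\<sigma>. if y = x then cross3 (axis i 1) (vec_of_s2 (\<sigma> x)) $ j else 0)"
  unfolding has_rot_deriv_def coord_rotation_curve
  using bounded_linear.has_vector_derivative[OF bounded_linear_vec_nth rotate_vec_derivative]
  by auto

lemma cross3_axis:
  "cross3 (axis i 1) v $ i = 0"
  "cross3 (axis i 1) v $ (i + 1) = - v $ (i + 2)"
  "cross3 (axis i 1) v $ (i + 2) = v $ (i + 1)"
  using exhaust_3[of i] by (auto simp: cross3_def axis_def vector_def numeral_mod_3)

lemma has_rot_deriv_coords:
  "has_rot_deriv x i (coord x i) (\<lambda>_. 0)"
  "has_rot_deriv x i (coord x (i + 1)) (\<lambda>\<sigma>. - coord x (i + 2) \<sigma>)"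
  "has_rot_deriv x i (coord x (i + 2)) (coord x (i + 1))"
  using has_rot_deriv_coord[of x i x i] has_rot_deriv_coord[of x i x "i + 1"]
    has_rot_deriv_coord[of x i x "i + 2"]
  by (simp_all add: cross3_axis coord_def[abs_def])

lemma poly_fun_minus: "poly_fun f \<Longrightarrow> poly_fun (\<lambda>\<sigma>. - f \<sigma>)"
  using poly_fun.mult[OF poly_fun.const[of "-1"], of f] by simp

lemma index_cases3: "j = i \<or> j = i + 1 \<or> j = i + 2" for i j :: 3
  using exhaust_3[of i] exhaust_3[of j] by (auto simp: numeral_mod_3)

lemma poly_fun_has_rot_deriv: "poly_fun f \<Longrightarrow> \<exists>f'. poly_fun f' \<and> has_rot_deriv x i f f'"
proof (induction rule: poly_fun.induct)
  case (const c) then show ?case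
    by (intro exI[of _ "\<lambda>_. 0"] conjI has_rot_deriv_const poly_fun.const)
next
  case (coord y j)
  show ?case
  proof (cases "y = x")
    case True
    consider "j = i" | "j = i + 1" | "j = i + 2" using index_cases3 by blast
    then show ?thesis
    proof cases
      case 1
      then show ?thesis using True has_rot_deriv_coords(1)[of x i]
        by (intro exI[of _ "\<lambda>_. 0"]) (simp add: poly_fun.const)
    next
      case 2
      then show ?thesis using True has_rot_deriv_coords(2)[of x i]
        by (intro exI[of _ "\<lambda>\<sigma>. - coord x (i + 2) \<sigma>"]) (simp add: poly_fun_minus poly_fun.coord)
    next
      case 3
      then show ?thesis using True has_rot_deriv_coords(3)[of x i]
        by (intro exI[of _ "coord x (i + 1)"]) (simp add: poly_fun.coord)
    qed
  next
    case False
    then show ?thesis using has_rot_deriv_coord[of x i y j]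
      by (intro exI[of _ "\<lambda>_. 0"]) (simp add: poly_fun.const)
  qed
next
  case (add f g)
  then obtain f' g' where "poly_fun f'" "has_rot_deriv x i f f'" "poly_fun g'" "has_rot_deriv x i g g'"
    by blast
  then show ?case
    by (intro exI[of _ "\<lambda>\<sigma>. f' \<sigma> + g' \<sigma>"] conjI has_rot_deriv_add poly_fun.intros)
next
  case (mult f g)
  then obtain f' g' where "poly_fun f'" "has_rot_deriv x i f f'" "poly_fun g'" "has_rot_deriv x i g g'"
    by blast
  then show ?case
    by (intro exI[of _ "\<lambda>\<sigma>. f \<sigma> * g' \<sigma> + f' \<sigma> * g \<sigma>"] conjI has_rot_deriv_mult poly_fun.intros mult.hyps)
qed

text \<open>Needed to apply an identity known for polynomial functions at every time of a rotation
  flow.\<close>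

lemma poly_fun_rotation: "poly_fun f \<Longrightarrow> poly_fun (\<lambda>\<sigma>. f (rotation_curve x i \<sigma> t))"
proof (induction rule: poly_fun.induct)
  case (coord y j)
  show ?case
  proof (cases "y = x")
    case True
    have *: "poly_fun (\<lambda>\<sigma>. c * coord x a \<sigma> + d * coord x b \<sigma>)" for a b c d
      by (intro poly_fun.intros)
    consider "j = i" | "j = i + 1" | "j = i + 2" using index_cases3 by blast
    then show ?thesis
    proof cases
      case 1
      then show ?thesis using True by (simp add: coord_rotation_curve rotate_vec_nth poly_fun.coord[unfolded coord_def[abs_def]])
    next
      case 2
      then show ?thesis using True *[of "cos t" "i + 1" "- sin t" "i + 2"]
        by (simp add: coord_rotation_curve rotate_vec_nth coord_def[symmetric])
    next
      case 3
      then show ?thesis using True *[of "cos t" "i + 2" "sin t" "i + 1"]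
        by (simp add: coord_rotation_curve rotate_vec_nth coord_def[symmetric])
    qed
  next
    case False
    then show ?thesis by (simp add: coord_rotation_curve poly_fun.coord)
  qed
qed (simp_all add: poly_fun.intros)

text \<open>C^1 regularity in the single variable \<sigma>_x, but with continuity in all variables
  jointly. This is all that a bracket at the site x requires.\<close>

definition c1_at :: "'g \<Rightarrow> ('g config \<Rightarrow> 'b::real_normed_vector) \<Rightarrow> bool"
  where "c1_at x f \<longleftrightarrow> continuous_on UNIV f \<and>
    (\<forall>i. continuous_on UNIV (rot_field x i f) \<and> has_rot_deriv x i f (rot_field x i f))"

lemma c1_atI:
  assumes "continuous_on UNIV f" "\<And>i. continuous_on UNIV (f' i)" "\<And>i. has_rot_deriv x i f (f' i)"
  shows "c1_at x f"
  using assms rot_field_eq[OF assms(3)] by (simp add: c1_at_def)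

section \<open>The Poisson bracket in terms of rotation fields\<close>

text \<open>The vectors (a, b) and (c, d) have equal length and form an acute angle. The argument of
  arcsin is the sine of the oriented angle between them; acuteness makes the cosine positive, so
  that arcsin picks the right branch.\<close>

lemma planar_rotation_angle:
  fixes a b c d :: real
  assumes "a\<^sup>2 + b\<^sup>2 = c\<^sup>2 + d\<^sup>2" "a * c + b * d > 0"
  defines "s \<equiv> arcsin ((a * d - b * c) / (a\<^sup>2 + b\<^sup>2))"
  shows "c = cos s * a - sin s * b" "d = cos s * b + sin s * a"
proof -
  define r where "r = a\<^sup>2 + b\<^sup>2"
  define u where "u = (a * d - b * c) / r"
  define w where "w = (a * c + b * d) / r"
  have "a \<noteq> 0 \<or> b \<noteq> 0" using assms(2) by auto
  then have r: "r > 0" unfolding r_def by (simp add: sum_power2_gt_zero_iff)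
  have "(a * d - b * c)\<^sup>2 + (a * c + b * d)\<^sup>2 = (a\<^sup>2 + b\<^sup>2) * (c\<^sup>2 + d\<^sup>2)"
    by (simp add: power2_eq_square algebra_simps)
  also have "\<dots> = r\<^sup>2" using assms(1) by (simp add: r_def power2_eq_square)
  finally have uw: "u\<^sup>2 + w\<^sup>2 = 1"
    using r by (simp add: u_def w_def power_divide add_divide_distrib[symmetric])
  have w: "w > 0" using assms(2) r by (simp add: w_def)
  have u: "\<bar>u\<bar> \<le> 1" using uw by (metis abs_square_le_1 le_add_same_cancel1 zero_le_power2)
  have s: "s = arcsin u" by (simp add: s_def u_def r_def)
  have u': "- 1 \<le> u" "u \<le> 1" using u by auto
  have sin: "sin s = u" unfolding s using u' by (rule sin_arcsin)
  have "cos s = sqrt (1 - u\<^sup>2)" unfolding s using u' by (rule cos_arcsin)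
  also have "\<dots> = w" using uw w by (metis add_diff_cancel_left' abs_of_pos real_sqrt_abs)
  finally have cos: "cos s = w" .
  have "r * (w * a - u * b) = r * c" "r * (w * b + u * a) = r * d"
    using r by (simp_all add: u_def w_def right_diff_distrib distrib_left,
      simp_all add: r_def power2_eq_square algebra_simps)
  then show "c = cos s * a - sin s * b" "d = cos s * b + sin s * a"
    using r by (simp_all add: sin cos)
qed

lemma real_differentiable_compose:
  fixes f :: "'a::real_normed_vector \<Rightarrow> real"
  assumes "f differentiable (at x)" "(g has_real_derivative D) (at (f x))"
  shows "(\<lambda>y. g (f y)) differentiable (at x)"
  using differentiable_chain_at[OF assms(1), of g] assms(2)
  by (auto simp: o_def has_field_derivative_def differentiable_def)

text \<open>The two angles can be solved for one after the other, because the second rotation does not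
  change the coordinate along its axis.\<close>

lemma rotation_chart:
  fixes v :: "real^3"
  assumes "norm v = 1" "v $ k \<noteq> 0"
  obtains s t :: "real^3 \<Rightarrow> real" where
    "s differentiable (at v)" "t differentiable (at v)" "s v = 0" "t v = 0"
    "eventually (\<lambda>y. rotate_vec (k + 2) (t y) (rotate_vec (k + 1) (s y) v) = sgn y) (at v)"
proof -
  define i where "i = k + 1"
  define j where "j = k + 2"
  have idx: "i + 1 = j" "i + 2 = k" "j + 1 = k" "j + 2 = i"
    using exhaust_3[of k] by (auto simp: i_def j_def numeral_mod_3)
  have norm2: "(w $ i)\<^sup>2 + (w $ j)\<^sup>2 + (w $ k)\<^sup>2 = (norm w)\<^sup>2" for w :: "real^3"
    using exhaust_3[of k] unfolding i_def j_def
    by (auto simp: norm_vec_def L2_set_def sum_3 numeral_mod_3 sum_nonneg)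
  have v2: "(v $ i)\<^sup>2 + (v $ j)\<^sup>2 + (v $ k)\<^sup>2 = 1" using norm2[of v] assms(1) by simp
  have vnz: "v \<noteq> 0" and sgnv: "sgn v = v" using assms(1) by (auto simp: sgn_div_norm)
  define q where "q a y = sgn y $ a" for a and y :: "real^3"
  \<comment> \<open>The rotation about axis i fixes coordinate i and has to bring coordinate j to
    its final value \<open>q j y\<close>, since the rotation about j will not touch it any more. The
    unit length then forces the square of coordinate k of the intermediate vector to be
    \<open>D y\<close>; \<open>m y\<close> is the root with the sign of
    \<open>v $ k\<close>.\<close>
  define D where "D y = 1 - (v $ i)\<^sup>2 - (q j y)\<^sup>2" for y
  define m where "m y = sgn (v $ k) * sqrt (D y)" for y
  \<comment> \<open>\<open>A1\<close> and \<open>A2\<close> are the planar inner products whose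
    positivity is the acuteness required by \<open>planar_rotation_angle\<close> for the first and
    the second rotation.\<close>
  define A1 where "A1 y = v $ j * q j y + v $ k * m y" for y
  define A2 where "A2 y = m y * q k y + v $ i * q i y" for y
  define s where "s y = arcsin ((v $ j * m y - v $ k * q j y) / ((v $ j)\<^sup>2 + (v $ k)\<^sup>2))" for y
  define t where "t y = arcsin ((m y * q i y - v $ i * q k y) / ((m y)\<^sup>2 + (v $ i)\<^sup>2))" for y
  have qv: "q a v = v $ a" for a by (simp add: q_def sgnv)
  have Dv: "D v = (v $ k)\<^sup>2" using v2 by (simp add: D_def qv)
  have mv: "m v = v $ k" by (simp add: m_def Dv sgn_mult_abs)
  have sv: "s v = 0" by (simp add: s_def mv qv)
  have tv: "t v = 0" by (simp add: t_def mv qv)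
  have r1: "(v $ j)\<^sup>2 + (v $ k)\<^sup>2 > 0" "(v $ k)\<^sup>2 + (v $ i)\<^sup>2 > 0"
    using assms(2) by (simp_all add: sum_power2_gt_zero_iff)
  have sgn_diff: "(\<lambda>y::real^3. sgn y) differentiable (at v)"
    unfolding sgn_div_norm
    by (intro derivative_intros differentiable_inverse differentiable_norm_at vnz) (use vnz in auto)
  have q_diff: "q a differentiable (at v)" for a
    using differentiable_chain_at[OF sgn_diff, of "\<lambda>y. y $ a"] bounded_linear_imp_differentiable[OF bounded_linear_vec_nth]
    unfolding q_def o_def by blast
  have D_diff: "D differentiable (at v)"
    unfolding D_def by (intro derivative_intros q_diff)
  have "(\<lambda>y. sqrt (D y)) differentiable (at v)"
    by (rule real_differentiable_compose[OF D_diff DERIV_real_sqrt]) (use assms(2) in \<open>simp add: Dv\<close>)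
  then have m_diff: "m differentiable (at v)"
    unfolding m_def by (intro derivative_intros)
  have arcsin0: "(arcsin has_real_derivative 1) (at 0)"
    using DERIV_arcsin[of 0] by simp
  have s_diff: "s differentiable (at v)"
    unfolding s_def
    by (rule real_differentiable_compose[where D=1])
      (use r1 in \<open>auto intro!: derivative_intros m_diff q_diff simp: mv qv arcsin0\<close>)
  have t_diff: "t differentiable (at v)"
    unfolding t_def
    by (rule real_differentiable_compose[where D=1])
      (use r1 in \<open>auto intro!: derivative_intros m_diff q_diff simp: mv qv arcsin0\<close>)
  have pos: "eventually (\<lambda>y. f y > 0) (at v)" if "f differentiable (at v)" "f v > 0" for f :: "real^3 \<Rightarrow> real"
    using differentiable_imp_continuous_within[OF that(1)] that(2)
    by (auto simp: continuous_within intro: order_tendstoD)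
  have "eventually (\<lambda>y. D y > 0) (at v)"
    by (rule pos[OF D_diff]) (use assms(2) in \<open>simp add: Dv\<close>)
  moreover have "eventually (\<lambda>y. A1 y > 0) (at v)"
    unfolding A1_def by (intro pos derivative_intros m_diff q_diff)
      (use r1 in \<open>simp add: mv qv power2_eq_square\<close>)
  moreover have "eventually (\<lambda>y. A2 y > 0) (at v)"
    unfolding A2_def by (intro pos derivative_intros m_diff q_diff)
      (use r1 in \<open>simp add: mv qv power2_eq_square\<close>)
  moreover have "eventually (\<lambda>y. y \<noteq> 0) (at v)"
    using vnz eventually_neq_at_within by blast
  ultimately have "eventually (\<lambda>y. rotate_vec j (t y) (rotate_vec i (s y) v) = sgn y) (at v)"
  proof eventually_elim
    case (elim y)
    have q2: "(q i y)\<^sup>2 + (q j y)\<^sup>2 + (q k y)\<^sup>2 = 1"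
      using norm2[of "sgn y"] elim(4) by (simp add: q_def norm_sgn)
    have m2: "(m y)\<^sup>2 = D y"
      using elim(1) assms(2) by (simp add: m_def power_mult_distrib sgn_if)
    have e1: "(v $ j)\<^sup>2 + (v $ k)\<^sup>2 = (q j y)\<^sup>2 + (m y)\<^sup>2"
      using v2 by (simp add: m2 D_def)
    have e2: "(m y)\<^sup>2 + (v $ i)\<^sup>2 = (q k y)\<^sup>2 + (q i y)\<^sup>2"
      using q2 by (simp add: m2 D_def)
    let ?w = "rotate_vec i (s y) v"
    have w: "?w $ i = v $ i" "?w $ j = q j y" "?w $ k = m y"
      using planar_rotation_angle[OF e1] elim(2) rotate_vec_nth[of i "s y" v]
      by (simp_all add: idx s_def A1_def)
    show ?case
    proof (rule vec3_eqI[of _ j])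
      show "rotate_vec j (t y) ?w $ j = sgn y $ j"
        using rotate_vec_nth(1)[of j "t y" ?w] w by (simp add: q_def)
      show "rotate_vec j (t y) ?w $ (j + 1) = sgn y $ (j + 1)"
        using planar_rotation_angle(1)[OF e2] elim(3) rotate_vec_nth(2)[of j "t y" ?w] w
        by (simp add: idx t_def A2_def q_def)
      show "rotate_vec j (t y) ?w $ (j + 2) = sgn y $ (j + 2)"
        using planar_rotation_angle(2)[OF e2] elim(3) rotate_vec_nth(3)[of j "t y" ?w] w
        by (simp add: idx t_def A2_def q_def)
    qed
  qed
  then show ?thesis
    using that[OF s_diff t_diff sv tv] by (simp add: i_def j_def)
qed

text \<open>In the two angles of \<open>rotation_chart\<close> the radially extended function
  becomes F (s y) (t y), where F rotates the spin at x by two successive angles. The partial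
  derivatives of F are values of rotation fields, so the chain rule applies.\<close>

lemma c1_at_differentiable:
  fixes f :: "'g config \<Rightarrow> 'b::real_normed_vector"
  assumes "c1_at x f"
  shows "(\<lambda>y. f (\<sigma>(x := Abs_s2 (sgn y)))) differentiable (at (vec_of_s2 (\<sigma> x)))"
proof -
  let ?v = "vec_of_s2 (\<sigma> x)"
  have "?v \<noteq> 0" using norm_vec_of_s2[of "\<sigma> x"] by force
  then obtain k where k: "?v $ k \<noteq> 0" by (auto simp: vec_eq_iff)
  obtain s t where st: "s differentiable (at ?v)" "t differentiable (at ?v)" "s ?v = 0" "t ?v = 0"
    "eventually (\<lambda>y. rotate_vec (k + 2) (t y) (rotate_vec (k + 1) (s y) ?v) = sgn y) (at ?v)"
    using rotation_chart[OF norm_vec_of_s2 k] by blast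
  define F where "F a b = f (rotation_curve x (k + 2) (rotation_curve x (k + 1) \<sigma> a) b)" for a b
  let ?g = "\<lambda>a b. rot_field x (k + 2) f (rotation_curve x (k + 2) (rotation_curve x (k + 1) \<sigma> a) b)"
  have D: "has_rot_deriv x i f (rot_field x i f)" and C: "continuous_on UNIV (rot_field x i f)" for i
    using assms by (auto simp: c1_at_def)
  \<comment> \<open>The outer rotation has the angle b, hence the partial derivative in b is a
    rotation field at the rotated configuration and is jointly continuous. The one in a is available
    along b = 0 only, which suffices for total differentiability at the origin.\<close>
  have "((\<lambda>(a, b). F a b) has_derivative
      (\<lambda>(u, w). u *\<^sub>R rot_field x (k + 1) f \<sigma> + blinfun_apply (blinfun_scaleR_left (?g 0 0)) w))
      (at (0, 0) within UNIV \<times> UNIV)"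
  proof (rule has_derivative_partialsI[where x = 0 and y = 0
        and fy = "\<lambda>a b. blinfun_scaleR_left (?g a b)"])
    show "((\<lambda>a. F a 0) has_derivative (\<lambda>u. u *\<^sub>R rot_field x (k + 1) f \<sigma>)) (at 0)"
      using D[of "k + 1"] by (simp add: F_def has_rot_deriv_def has_vector_derivative_def)
    show "(F a has_derivative blinfun_apply (blinfun_scaleR_left (?g a b))) (at b)" for a b
      using has_rot_derivD[OF D[of "k + 2"], of "rotation_curve x (k + 1) \<sigma> a" b UNIV]
      by (simp add: F_def[abs_def] has_vector_derivative_def)
    have "continuous_on UNIV (\<lambda>(a, b). ?g a b)"
      unfolding split_def
      by (intro continuous_on_rotation_curve'[OF C] continuous_on_rotation_curve
          continuous_on_fst continuous_on_snd continuous_on_id continuous_on_const)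
    then show "continuous (at (0, 0) within UNIV \<times> UNIV) (\<lambda>(a, b). blinfun_scaleR_left (?g a b))"
      unfolding split_def
      by (intro bounded_linear.continuous[OF bounded_linear_blinfun_scaleR_left])
        (simp add: continuous_on_eq_continuous_within)
  qed auto
  then have F: "(\<lambda>(a, b). F a b) differentiable (at (s ?v, t ?v))"
    by (auto simp: st differentiable_def)
  have "(\<lambda>y. (s y, t y)) differentiable (at ?v)"
    using st(1,2) unfolding differentiable_def by (blast intro: has_derivative_Pair)
  from differentiable_chain_at[OF this F]
  obtain D' where D': "((\<lambda>y. F (s y) (t y)) has_derivative D') (at ?v)"
    by (auto simp: o_def differentiable_def)
  have "F (s y) (t y) = f (\<sigma>(x := Abs_s2 (sgn y)))"
    if "rotate_vec (k + 2) (t y) (rotate_vec (k + 1) (s y) ?v) = sgn y" for y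
  proof -
    have "rotate (k + 2) (t y) (rotate (k + 1) (s y) (\<sigma> x)) = Abs_s2 (sgn y)"
      using that by (metis vec_of_s2_rotate vec_of_s2_inverse)
    then show ?thesis by (simp add: F_def rotation_curve_def)
  qed
  then have "eventually (\<lambda>y. F (s y) (t y) = f (\<sigma>(x := Abs_s2 (sgn y)))) (at ?v)"
    using st(5) by (auto elim: eventually_mono)
  moreover have "F (s ?v) (t ?v) = f (\<sigma>(x := Abs_s2 (sgn ?v)))"
    by (simp add: st F_def sgn_div_norm vec_of_s2_inverse)
  ultimately have "((\<lambda>y. f (\<sigma>(x := Abs_s2 (sgn y)))) has_derivative D') (at ?v)"
    by (intro has_derivative_transform_eventually[OF D']) auto
  then show ?thesis by (auto simp: differentiable_def)
qed

text \<open>The orbit of \<sigma>_x has velocity e_i \<times> \<sigma>_x, so the three rotation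
  derivatives together form the vector \<sigma>_x \<times> \<nabla>f.\<close>

lemma rot_field_site_gradient:
  assumes "c1_at x f"
  shows "rot_field x i f \<sigma> =
    (\<Sum>j\<in>UNIV. of_real (cross3 (axis i 1) (vec_of_s2 (\<sigma> x)) $ j) * site_gradient x f \<sigma> $ j)"
proof -
  let ?v = "vec_of_s2 (\<sigma> x)"
  let ?h = "\<lambda>y. f (\<sigma>(x := Abs_s2 (sgn y)))"
  let ?D = "frechet_derivative ?h (at ?v)"
  have D: "(?h has_derivative ?D) (at ?v)"
    using c1_at_differentiable[OF assms] frechet_derivative_works by blast
  have "rotate_vec i t ?v = sgn (rotate_vec i t ?v)" for t
    by (simp add: sgn_div_norm norm_rotate_vec)
  then have curve: "?h (rotate_vec i t ?v) = f (rotation_curve x i \<sigma> t)" for t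
    by (metis rotation_curve_def rotate_def)
  have "((?h \<circ> (\<lambda>t. rotate_vec i t ?v)) has_derivative
      ?D \<circ> (\<lambda>t. t *\<^sub>R cross3 (axis i 1) ?v)) (at 0)"
    using diff_chain_at[OF rotate_vec_derivative[unfolded has_vector_derivative_def], where g = ?h and g' = ?D] D by simp
  then have "((\<lambda>t. f (rotation_curve x i \<sigma> t)) has_vector_derivative ?D (cross3 (axis i 1) ?v)) (at 0)"
    using linear_scale[OF has_derivative_linear[OF D]]
    by (simp add: o_def curve has_vector_derivative_def)
  then have "rot_field x i f \<sigma> = ?D (cross3 (axis i 1) ?v)"
    by (simp add: rot_field_def vector_derivative_at)
  also have "cross3 (axis i 1) ?v = (\<Sum>j\<in>UNIV. (cross3 (axis i 1) ?v $ j) *\<^sub>R axis j 1)"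
    by (simp add: vec_eq_iff axis_def if_distrib cong: if_cong)
  also have "?D \<dots> = (\<Sum>j\<in>UNIV. (cross3 (axis i 1) ?v $ j) *\<^sub>R ?D (axis j 1))"
    unfolding linear_sum[OF has_derivative_linear[OF D]] linear_scale[OF has_derivative_linear[OF D]] ..
  finally show ?thesis
    by (simp add: site_gradient_def scaleR_conv_of_real)
qed

text \<open>The bracket at one site with the gradients replaced by the vectors \<sigma>_x \<times>
  \<nabla>f and \<sigma>_x \<times> \<nabla>g of rotation derivatives.\<close>

definition site_poisson :: "'g \<Rightarrow> ('g config \<Rightarrow> complex) \<Rightarrow> ('g config \<Rightarrow> complex) \<Rightarrow> 'g config \<Rightarrow> complex"
  where "site_poisson x f g \<sigma> = 2 * (\<Sum>j\<in>UNIV. of_real (coord x j \<sigma>) *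
    complex_cross3 (\<chi> i. rot_field x i f \<sigma>) (\<chi> i. rot_field x i g \<sigma>) $ j)"

text \<open>In vector notation: |v|^2 v \<cdot> (a \<times> b) = v \<cdot> ((v \<times> a) \<times>
  (v \<times> b)). With |v| = 1 it identifies the two forms of the bracket; the ring is general
  because the gradients are complex.\<close>

lemma triple_product_rotated:
  fixes v1 v2 v3 :: "'a::comm_ring_1"
  shows "(v1\<^sup>2 + v2\<^sup>2 + v3\<^sup>2) *
      (v1 * (a2 * b3 - a3 * b2) + v2 * (a3 * b1 - a1 * b3) + v3 * (a1 * b2 - a2 * b1)) =
     v1 * ((v3 * a1 - v1 * a3) * (v1 * b2 - v2 * b1) - (v1 * a2 - v2 * a1) * (v3 * b1 - v1 * b3)) +
     v2 * ((v1 * a2 - v2 * a1) * (v2 * b3 - v3 * b2) - (v2 * a3 - v3 * a2) * (v1 * b2 - v2 * b1)) +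
     v3 * ((v2 * a3 - v3 * a2) * (v3 * b1 - v1 * b3) - (v3 * a1 - v1 * a3) * (v2 * b3 - v3 * b2))"
  by (simp add: power2_eq_square algebra_simps)

lemma poisson_eq_sum:
  assumes "\<And>x. x \<in> \<Lambda> \<Longrightarrow> c1_at x f" "\<And>x. x \<in> \<Lambda> \<Longrightarrow> c1_at x g"
  shows "poisson \<Lambda> f g \<sigma> = (\<Sum>x\<in>\<Lambda>. site_poisson x f g \<sigma>)"
  unfolding poisson_def
proof (rule sum.cong[OF refl])
  fix x assume x: "x \<in> \<Lambda>"
  let ?v = "vec_of_s2 (\<sigma> x)"
  define v1 v2 v3 where "v1 = complex_of_real (?v $ 1)" "v2 = complex_of_real (?v $ 2)" "v3 = complex_of_real (?v $ 3)"
  have "(norm ?v)\<^sup>2 = 1" by simp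
  then have "(?v $ 1)\<^sup>2 + (?v $ 2)\<^sup>2 + (?v $ 3)\<^sup>2 = 1"
    by (simp add: norm_vec_def L2_set_def sum_3 sum_nonneg)
  then have "complex_of_real ((?v $ 1)\<^sup>2 + (?v $ 2)\<^sup>2 + (?v $ 3)\<^sup>2) = 1" by simp
  then have v: "v1\<^sup>2 + v2\<^sup>2 + v3\<^sup>2 = 1" by (simp add: v1_v2_v3_def)
  have rf: "rot_field x 1 h \<sigma> = v2 * site_gradient x h \<sigma> $ 3 - v3 * site_gradient x h \<sigma> $ 2"
    "rot_field x 2 h \<sigma> = v3 * site_gradient x h \<sigma> $ 1 - v1 * site_gradient x h \<sigma> $ 3"
    "rot_field x 3 h \<sigma> = v1 * site_gradient x h \<sigma> $ 2 - v2 * site_gradient x h \<sigma> $ 1"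
    if "c1_at x h" for h
    unfolding rot_field_site_gradient[OF that] v1_v2_v3_def
    by (simp_all add: sum_3 cross3_def axis_def vector_def)
  have id: "v1 * (a2 * b3 - a3 * b2) + v2 * (a3 * b1 - a1 * b3) + v3 * (a1 * b2 - a2 * b1) =
     v1 * ((v3 * a1 - v1 * a3) * (v1 * b2 - v2 * b1) - (v1 * a2 - v2 * a1) * (v3 * b1 - v1 * b3)) +
     v2 * ((v1 * a2 - v2 * a1) * (v2 * b3 - v3 * b2) - (v2 * a3 - v3 * a2) * (v1 * b2 - v2 * b1)) +
     v3 * ((v2 * a3 - v3 * a2) * (v3 * b1 - v1 * b3) - (v3 * a1 - v1 * a3) * (v2 * b3 - v3 * b2))"
    for a1 a2 a3 b1 b2 b3
    using triple_product_rotated[of v1 v2 v3 a2 b3 a3 b2 b1 a1] unfolding v mult_1_left .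
  show "2 * (\<Sum>j\<in>UNIV. complex_of_real (?v $ j) *
      complex_cross3 (site_gradient x f \<sigma>) (site_gradient x g \<sigma>) $ j) = site_poisson x f g \<sigma>"
    unfolding site_poisson_def coord_def sum_3 complex_cross3_def vector_3 vec_lambda_beta
      v1_v2_v3_def[symmetric] rf[OF assms(1)[OF x]] rf[OF assms(2)[OF x]]
    by (rule arg_cong[OF id])
qed

section \<open>Averages over spheres\<close>

text \<open>The normalized surface measure, obtained by projecting the uniform measure of the
  punctured ball radially. Its rotation invariance is thereby reduced to that of Lebesgue
  measure.\<close>

definition sphere_measure :: "s2 measure"
  where "sphere_measure = distr (uniform_measure lborel (ball 0 1 - {0})) borel (\<lambda>y. Abs_s2 (sgn y))"

lemma sets_sphere_measure [simp, measurable_cong]: "sets sphere_measure = sets borel"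
  and space_sphere_measure [simp]: "space sphere_measure = UNIV"
  by (simp_all add: sphere_measure_def)

lemma vec_of_s2_Abs_sgn: "y \<noteq> 0 \<Longrightarrow> vec_of_s2 (Abs_s2 (sgn y)) = sgn y"
  by (simp add: Abs_s2_inverse norm_sgn)

lemma measurable_Abs_s2_sgn [measurable]: "(\<lambda>y. Abs_s2 (sgn y)) \<in> borel_measurable borel"
proof (rule borel_measurable_continuous_countable_exceptions[of "{0}"])
  have "continuous_on (- {0}) (\<lambda>y::real^3. sgn y)"
    unfolding sgn_div_norm by (intro continuous_intros) auto
  then show "continuous_on (- {0}) (\<lambda>y. Abs_s2 (sgn y))"
    by (intro continuous_on_into_s2) (subst continuous_on_cong[OF refl vec_of_s2_Abs_sgn], auto)
qed simp

lemma punctured_ball: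
  "emeasure lborel (ball (0::real^3) 1 - {0}) \<noteq> 0" "emeasure lborel (ball (0::real^3) 1 - {0}) \<noteq> \<infinity>"
proof -
  have vol: "0 < unit_ball_vol (3::real)" by (rule unit_ball_vol_pos) simp
  have "emeasure lborel (ball (0::real^3) 1 - {0}) = emeasure lborel (ball (0::real^3) 1)"
    by (rule emeasure_Diff_null_set) auto
  also have "\<dots> = ennreal (unit_ball_vol 3)"
    by (subst emeasure_ball) auto
  finally show "emeasure lborel (ball (0::real^3) 1 - {0}) \<noteq> 0" "emeasure lborel (ball (0::real^3) 1 - {0}) \<noteq> \<infinity>"
    by (simp_all add: not_le less_imp_neq[OF vol, symmetric])
qed

lemma prob_space_sphere_measure: "prob_space sphere_measure"
proof -
  interpret prob_space "uniform_measure lborel (ball (0::real^3) 1 - {0})"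
    by (rule prob_space_uniform_measure[OF punctured_ball])
  show ?thesis
    unfolding sphere_measure_def by (rule prob_space_distr) simp
qed

interpretation sphere: prob_space sphere_measure
  by (rule prob_space_sphere_measure)

lemma Abs_s2_rotate_vec:
  assumes "y \<noteq> 0"
  shows "Abs_s2 (sgn (rotate_vec i t y)) = rotate i t (Abs_s2 (sgn y))"
proof -
  have "sgn (rotate_vec i t y) = rotate_vec i t (sgn y)"
    by (simp add: sgn_div_norm norm_rotate_vec linear_scale[OF linear_rotate_vec])
  then show ?thesis using assms by (simp add: rotate_def vec_of_s2_Abs_sgn)
qed

lemma distr_sphere_measure_rotate: "distr sphere_measure borel (rotate i t) = sphere_measure"
proof (rule measure_eqI)
  fix A assume "A \<in> sets (distr sphere_measure borel (rotate i t))"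
  then have A [measurable]: "A \<in> sets borel" by simp
  have [measurable]: "rotate i t \<in> borel_measurable borel"
    by (intro borel_measurable_continuous_onI continuous_on_rotate continuous_on_const continuous_on_id)
  \<comment> \<open>\<open>S B\<close> is the part of the cone over B inside the punctured ball.
    Rotating B rotates this set, and orthogonal maps preserve its volume.\<close>
  define S where "S B = {y \<in> ball 0 1 - {0}. Abs_s2 (sgn y) \<in> B}" for B
  have S_meas: "S B \<in> sets borel" if [measurable]: "B \<in> sets borel" for B
    unfolding S_def by measurable
  have lm: "S B \<in> lmeasurable" if "B \<in> sets borel" for B
  proof (rule bounded_set_imp_lmeasurable)
    show "bounded (S B)" by (rule bounded_subset[OF bounded_ball[of 0 1]]) (auto simp: S_def)
    show "S B \<in> sets lebesgue" using S_meas[OF that] by auto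
  qed
  have em: "emeasure sphere_measure B = emeasure lborel (S B) / emeasure lborel (ball (0::real^3) 1 - {0})"
    if B: "B \<in> sets borel" for B
  proof -
    have "(\<lambda>y::real^3. Abs_s2 (sgn y)) -` B \<in> sets borel"
      using measurable_sets[OF measurable_Abs_s2_sgn B] by simp
    moreover have "(ball 0 1 - {0}) \<inter> (\<lambda>y. Abs_s2 (sgn y)) -` B = S B" by (auto simp: S_def)
    ultimately show ?thesis
      using B by (simp add: sphere_measure_def emeasure_distr)
  qed
  let ?B = "rotate i t -` A"
  have B: "?B \<in> sets borel"
    using measurable_sets[OF \<open>rotate i t \<in> _\<close> A] by simp
  have nz: "rotate_vec i u y = 0 \<longleftrightarrow> y = 0" for u y
    by (metis norm_rotate_vec norm_eq_zero)
  have "S A = rotate_vec i t ` S ?B"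
  proof (intro set_eqI iffI)
    fix y assume y: "y \<in> S A"
    then have "rotate_vec i (- t) y \<in> S ?B"
      by (simp add: S_def norm_rotate_vec nz Abs_s2_rotate_vec rotate_add)
    then show "y \<in> rotate_vec i t ` S ?B"
      by (rule rev_image_eqI) (simp add: rotate_vec_add)
  qed (auto simp: S_def norm_rotate_vec nz Abs_s2_rotate_vec)
  moreover have "orthogonal_transformation (rotate_vec i t)"
    by (simp add: orthogonal_transformation linear_rotate_vec norm_rotate_vec)
  ultimately have "measure lebesgue (S A) = measure lebesgue (S ?B)"
    using measure_orthogonal_image[OF _ lm[OF B]] by metis
  moreover have "emeasure lborel (S B) = ennreal (measure lebesgue (S B))" if "B \<in> sets borel" for B
    using emeasure_eq_measure2[OF lm[OF that]] S_meas[OF that] by simp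
  ultimately have "emeasure lborel (S A) = emeasure lborel (S ?B)"
    using A B by simp
  then show "emeasure (distr sphere_measure borel (rotate i t)) A = emeasure sphere_measure A"
    by (simp add: emeasure_distr em[OF A] em[OF B])
qed simp

lemma sphere_integrable:
  fixes f :: "s2 \<Rightarrow> 'b::{banach, second_countable_topology}"
  assumes "continuous_on UNIV f"
  shows "integrable sphere_measure f"
proof -
  obtain B where "\<And>p. norm (f p) \<le> B"
    using compact_imp_bounded[OF compact_continuous_image[OF assms compact_UNIV_s2]]
    by (auto simp: bounded_iff)
  then show ?thesis
    by (intro sphere.integrable_const_bound[of _ B])
      (use borel_measurable_continuous_onI[OF assms] in \<open>auto simp: measurable_cong_sets[OF sets_sphere_measure refl]\<close>)
qed

section \<open>Averages over one spin and over finitely many spins\<close>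

definition av :: "'g \<Rightarrow> ('g config \<Rightarrow> 'b) \<Rightarrow> 'g config \<Rightarrow> 'b::{banach, second_countable_topology}"
  where "av x f \<sigma> = (\<integral>p. f (\<sigma>(x := p)) \<partial>sphere_measure)"

lemma continuous_on_site_update:
  fixes f :: "'g config \<Rightarrow> 'b::topological_space"
  assumes "continuous_on UNIV f"
  shows "continuous_on S (\<lambda>p. f (\<sigma>(x := p)))"
  by (rule continuous_on_compose2[OF assms _ subset_UNIV],
      rule continuous_on_update[OF continuous_on_const continuous_on_id])

lemma av_integrable:
  fixes f :: "'g config \<Rightarrow> 'b::{banach, second_countable_topology}"
  shows "continuous_on UNIV f \<Longrightarrow> integrable sphere_measure (\<lambda>p. f (\<sigma>(x := p)))"
  by (intro sphere_integrable continuous_on_site_update)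

lemma av_add:
  "continuous_on UNIV f \<Longrightarrow> continuous_on UNIV g \<Longrightarrow> av x (\<lambda>\<sigma>. f \<sigma> + g \<sigma>) \<sigma> = av x f \<sigma> + av x g \<sigma>"
  by (simp add: av_def av_integrable)

lemma av_mult_indep:
  fixes f g :: "'g config \<Rightarrow> 'b::{real_normed_field, banach, second_countable_topology}"
  assumes "\<And>\<sigma> p. g (\<sigma>(x := p)) = g \<sigma>"
  shows "av x (\<lambda>\<sigma>. g \<sigma> * f \<sigma>) \<sigma> = g \<sigma> * av x f \<sigma>"
  by (simp add: av_def assms)

lemma av_indep: "(\<And>\<sigma> p. g (\<sigma>(x := p)) = g \<sigma>) \<Longrightarrow> av x g \<sigma> = g \<sigma>"
  using sphere.prob_space by (simp add: av_def)

lemma av_update [simp]: "av x f (\<sigma>(x := p)) = av x f \<sigma>"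
  by (simp add: av_def)

lemma av_mono:
  fixes f g :: "'g config \<Rightarrow> real"
  assumes "continuous_on UNIV f" "continuous_on UNIV g" "\<And>p. f (\<sigma>(x := p)) \<le> g (\<sigma>(x := p))"
  shows "av x f \<sigma> \<le> av x g \<sigma>"
  unfolding av_def by (intro integral_mono av_integrable assms)

lemma av_of_real: "av x (cplx f) \<sigma> = of_real (av x f \<sigma>)"
  by (simp add: av_def)

lemma norm_av_le:
  fixes f :: "'g config \<Rightarrow> 'b::{banach, second_countable_topology}"
  assumes "continuous_on UNIV f" "\<And>\<sigma>. norm (f \<sigma>) \<le> B"
  shows "norm (av x f \<sigma>) \<le> B"
proof -
  have "norm (av x f \<sigma>) \<le> (\<integral>p. norm (f (\<sigma>(x := p))) \<partial>sphere_measure)"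
    unfolding av_def by (rule integral_norm_bound)
  also have "\<dots> \<le> (\<integral>p. B \<partial>sphere_measure)"
    by (intro integral_mono integrable_norm av_integrable assms) auto
  finally show ?thesis using sphere.prob_space by simp
qed

lemma av_continuous:
  fixes f :: "'g config \<Rightarrow> 'b::{banach, second_countable_topology}"
  assumes "continuous_on UNIV f"
  shows "continuous_on UNIV (av x f)"
  unfolding continuous_on_def
proof (intro ballI tendstoI, simp)
  fix \<sigma> :: "'g config" and e :: real assume e: "0 < e"
  have "continuous_on (UNIV \<times> UNIV) (\<lambda>(\<sigma>, p). f (\<sigma>(x := p)))"
    unfolding split_def
    by (rule continuous_on_compose2[OF assms continuous_on_update[OF
            continuous_on_fst[OF continuous_on_id] continuous_on_snd[OF continuous_on_id]] subset_UNIV])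
  then obtain X0 where X0: "\<sigma> \<in> X0" "open X0"
    "\<forall>\<tau>\<in>X0 \<inter> UNIV. \<forall>p\<in>UNIV. dist ((\<lambda>(\<sigma>, p). f (\<sigma>(x := p))) (\<tau>, p))
      ((\<lambda>(\<sigma>, p). f (\<sigma>(x := p))) (\<sigma>, p)) \<le> e / 2"
    by (rule continuous_on_prod_compactE[OF _ compact_UNIV_s2 UNIV_I half_gt_zero[OF e]])
  have "dist (av x f \<tau>) (av x f \<sigma>) < e" if "\<tau> \<in> X0" for \<tau>
  proof -
    have "av x f \<tau> - av x f \<sigma> = (\<integral>p. f (\<tau>(x := p)) - f (\<sigma>(x := p)) \<partial>sphere_measure)"
      unfolding av_def by (subst Bochner_Integration.integral_diff) (auto intro: av_integrable assms)
    also have "norm \<dots> \<le> (\<integral>p. norm (f (\<tau>(x := p)) - f (\<sigma>(x := p))) \<partial>sphere_measure)"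
      by (rule integral_norm_bound)
    also have "\<dots> \<le> (\<integral>p. e / 2 \<partial>sphere_measure)"
      using X0(3) that by (intro integral_mono integrable_norm Bochner_Integration.integrable_diff av_integrable assms)
        (auto simp: dist_norm)
    finally show ?thesis using e sphere.prob_space by (simp add: dist_norm)
  qed
  then show "\<forall>\<^sub>F \<tau> in at \<sigma>. dist (av x f \<tau>) (av x f \<sigma>) < e"
    using X0(1,2) eventually_at_topological by blast
qed

lemma av_rotation:
  assumes "continuous_on UNIV f"
  shows "av x (\<lambda>\<sigma>. f (rotation_curve x i \<sigma> t)) \<sigma> = av x f \<sigma>"
proof -
  have "av x f \<sigma> = (\<integral>p. f (\<sigma>(x := p)) \<partial>distr sphere_measure borel (rotate i t))"
    by (simp add: distr_sphere_measure_rotate av_def)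
  also have "\<dots> = (\<integral>p. f (\<sigma>(x := rotate i t p)) \<partial>sphere_measure)"
    by (rule integral_distr)
      (simp_all add: measurable_cong_sets[OF sets_sphere_measure refl] borel_measurable_continuous_onI
        continuous_on_rotate[OF continuous_on_const continuous_on_id] continuous_on_site_update[OF assms])
  finally show ?thesis by (simp add: av_def rotation_curve_def)
qed

lemma av_rotation_other:
  "y \<noteq> x \<Longrightarrow> av x (\<lambda>\<sigma>. f (rotation_curve y i \<sigma> t)) \<sigma> = av x f (rotation_curve y i \<sigma> t)"
  by (simp add: av_def rotation_curve_def fun_upd_twist)

text \<open>Integration over finitely many spins is encoded as an iterated average, so that its
  properties follow from those of \<open>av\<close> by induction over the list of sites.\<close>

fun avs :: "'g list \<Rightarrow> ('g config \<Rightarrow> 'b) \<Rightarrow> 'g config \<Rightarrow> 'b::{banach, second_countable_topology}" where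
  "avs [] f = f"
| "avs (x # xs) f = av x (avs xs f)"

lemma avs_continuous: "continuous_on UNIV f \<Longrightarrow> continuous_on UNIV (avs xs f)"
  by (induction xs) (simp_all add: av_continuous)

lemma avs_add:
  "continuous_on UNIV f \<Longrightarrow> continuous_on UNIV g \<Longrightarrow>
    avs xs (\<lambda>\<sigma>. f \<sigma> + g \<sigma>) = (\<lambda>\<sigma>. avs xs f \<sigma> + avs xs g \<sigma>)"
  by (induction xs) (simp, simp, intro ext av_add avs_continuous)

lemma avs_scale:
  fixes f :: "'g config \<Rightarrow> 'b::{real_normed_field, banach, second_countable_topology}"
  shows "avs xs (\<lambda>\<sigma>. c * f \<sigma>) = (\<lambda>\<sigma>. c * avs xs f \<sigma>)"
  by (induction xs) (simp, simp, intro ext av_mult_indep refl)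

lemma norm_avs_le:
  assumes "continuous_on UNIV f" "\<And>\<sigma>. norm (f \<sigma>) \<le> B"
  shows "norm (avs xs f \<sigma>) \<le> B"
  using assms by (induction xs arbitrary: \<sigma>) (simp_all add: norm_av_le avs_continuous)

lemma avs_rotation_other:
  "x \<notin> set xs \<Longrightarrow> avs xs (\<lambda>\<sigma>. f (rotation_curve x i \<sigma> t)) = (\<lambda>\<sigma>. avs xs f (rotation_curve x i \<sigma> t))"
  by (induction xs) (simp, simp, intro ext av_rotation_other, simp)

text \<open>A rotation at x passes through averages at other sites and is absorbed by an average at
  x.\<close>

lemma avs_rotation:
  assumes "continuous_on UNIV f" "x \<in> set xs"
  shows "avs xs (\<lambda>\<sigma>. f (rotation_curve x i \<sigma> t)) = avs xs f"
  using assms(2)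
proof (induction xs)
  case (Cons y xs)
  show ?case
  proof (cases "x \<in> set xs")
    case True
    then show ?thesis using Cons.IH by simp
  next
    case False
    then show ?thesis
      using Cons.prems av_rotation[OF avs_continuous[OF assms(1)]]
      by (simp add: avs_rotation_other fun_eq_iff)
  qed
qed simp

text \<open>Differentiates the rotation invariance of the average: f and its rotated copy have equal
  averages, so d times the average of \<open>f'\<close> is bounded by the Taylor remainder d e,
  uniformly in the configuration.\<close>

lemma avs_rot_deriv:
  fixes f f' :: "'g config \<Rightarrow> 'b::{real_normed_field, banach, second_countable_topology}"
  assumes "continuous_on UNIV f" "continuous_on UNIV f'" "has_rot_deriv x i f f'" "x \<in> set xs"
  shows "avs xs f' \<sigma> = 0"
proof -
  have "norm (avs xs f' \<sigma>) \<le> 0 + e" if "e > 0" for e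
  proof -
    obtain d where d: "d > 0"
      "\<And>h \<sigma>. \<bar>h\<bar> \<le> d \<Longrightarrow> norm (f (rotation_curve x i \<sigma> h) - f \<sigma> - h *\<^sub>R f' \<sigma>) \<le> \<bar>h\<bar> * e"
      using has_rot_deriv_uniform[OF assms(3,2) \<open>e > 0\<close>] by metis
    define g where "g \<sigma> = f (rotation_curve x i \<sigma> d) + (- 1 * f \<sigma> + (- of_real d) * f' \<sigma>)" for \<sigma>
    have c: "continuous_on UNIV (\<lambda>\<sigma>. f (rotation_curve x i \<sigma> d))"
      by (rule continuous_on_rotation_curve'[OF assms(1) continuous_on_id continuous_on_const])
    have c2: "continuous_on UNIV (\<lambda>\<sigma>. - 1 * f \<sigma>)" "continuous_on UNIV (\<lambda>\<sigma>. (- of_real d) * f' \<sigma>)"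
      by (intro continuous_on_mult continuous_on_const assms)+
    have "continuous_on UNIV g"
      unfolding g_def by (intro continuous_on_add c c2)
    then have "norm (avs xs g \<sigma>) \<le> d * e"
      by (rule norm_avs_le) (use d(1) d(2)[of d] in \<open>simp add: g_def scaleR_conv_of_real algebra_simps\<close>)
    moreover have "avs xs g \<sigma> = (- of_real d) * avs xs f' \<sigma>"
      unfolding g_def avs_add[OF c continuous_on_add[OF c2]] avs_add[OF c2] avs_scale
        avs_rotation[OF assms(1,4)] by simp
    ultimately have "d * norm (avs xs f' \<sigma>) \<le> d * e"
      using d(1) by (simp add: norm_mult)
    then show ?thesis using d(1) by simp
  qed
  then have "norm (avs xs f' \<sigma>) \<le> 0" by (rule field_le_epsilon)
  then show ?thesis by simp
qed

section \<open>Functionals vanishing on rotation derivatives\<close>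

lemma has_rot_deriv_power:
  fixes f :: "'g config \<Rightarrow> real"
  assumes "has_rot_deriv x i f f'"
  shows "has_rot_deriv x i (\<lambda>\<sigma>. f \<sigma> ^ n) (\<lambda>\<sigma>. (real n * f \<sigma> ^ (n - 1)) * f' \<sigma>)"
  using has_rot_deriv_chain[OF assms, of "\<lambda>u. u ^ n" "\<lambda>u. real n * u ^ (n - 1)"] DERIV_pow by auto

lemma poly_fun_power: "poly_fun f \<Longrightarrow> poly_fun (\<lambda>\<sigma>. f \<sigma> ^ n)"
  by (induction n) (simp_all add: poly_fun.intros)

text \<open>The moments of a functional vanishing on all derivatives along the rotation fields of one
  sphere satisfy these recursions, which express each of them through the one of order zero.\<close>

lemma moments_vanish:
  fixes m :: "nat \<Rightarrow> nat \<Rightarrow> nat \<Rightarrow> real"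
  assumes r3: "\<And>a b c. (real b + 1) * m (a + 2) b c = (real a + 1) * m a (b + 2) c"
    and r3': "\<And>b c. m 1 b c = 0"
    and r1: "\<And>b c. (real c + 1) * m 0 (b + 2) c = (real b + 1) * m 0 b (c + 2)"
    and r1': "\<And>c. m 0 1 c = 0"
    and r2: "\<And>c. m 0 0 (c + 2) = (real c + 1) * m 2 0 c"
    and r2': "m 0 0 1 = 0"
    and sphere: "\<And>c. m 2 0 c + m 0 2 c + m 0 0 (c + 2) = m 0 0 c"
    and zero: "m 0 0 0 = 0"
  shows "m a b c = 0"
proof -
  have z: "m 0 0 c = 0" for c
  proof (induction c rule: less_induct)
    case (less c)
    consider "c = 0" | "c = 1" | k where "c = k + 2"
      by (metis One_nat_def add_2_eq_Suc' not0_implies_Suc)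
    then show ?case
    proof cases
      case 3
      \<comment> \<open>By this symmetry and \<open>r2\<close>, the three terms of the relation of
        the sphere are 1, 1 and k + 1 times m 2 0 k. Their sum is m 0 0 k, which vanishes by
        induction.\<close>
      have "m 2 0 k = m 0 2 k" using r3[of 0 0 k] by (simp add: eval_nat_numeral)
      then have "2 * m 2 0 k + (real k + 1) * m 2 0 k = 0"
        using sphere[of k] r2[of k] less[of k] 3 by simp
      then have "(real k + 3) * m 2 0 k = 0" by (simp add: algebra_simps)
      then have "m 2 0 k = 0" by simp
      then show ?thesis using r2[of k] 3 by simp
    qed (use zero r2' in simp_all)
  qed
  have y: "m 0 b c = 0" for b c
  proof (induction b arbitrary: c rule: less_induct)
    case (less b)
    consider "b = 0" | "b = 1" | k where "b = k + 2"
      by (metis One_nat_def add_2_eq_Suc' not0_implies_Suc)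
    then show ?case
    proof cases
      case 3
      then have "(real c + 1) * m 0 b c = 0" using r1[of c k] less[of k] by simp
      then show ?thesis by simp
    qed (use z r1' in simp_all)
  qed
  show ?thesis
  proof (induction a arbitrary: b rule: less_induct)
    case (less a)
    consider "a = 0" | "a = 1" | k where "a = k + 2"
      by (metis One_nat_def add_2_eq_Suc' not0_implies_Suc)
    then show ?case
    proof cases
      case 3
      then have "(real b + 1) * m a b c = 0" using r3[of b k c] less[of k] by simp
      then show ?thesis by simp
    qed (use y r3' in simp_all)
  qed
qed

section \<open>Polynomial functions expanded in the variable of one site\<close>

definition site_mono :: "'g \<Rightarrow> ('g config \<Rightarrow> real) \<Rightarrow> nat \<Rightarrow> nat \<Rightarrow> nat \<Rightarrow> 'g config \<Rightarrow> real"
  where "site_mono x q a b c \<sigma> = q \<sigma> * (coord x 1 \<sigma> ^ a * coord x 2 \<sigma> ^ b * coord x 3 \<sigma> ^ c)"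

text \<open>The normal form with respect to \<sigma>_x: sums of monomials in its three coordinates
  whose coefficients are polynomials in the other spins. Rotations at x act on the monomials and
  leave the coefficients alone.\<close>

inductive site_poly :: "'g \<Rightarrow> ('g config \<Rightarrow> real) \<Rightarrow> bool" for x where
  mono: "poly_fun q \<Longrightarrow> (\<And>\<sigma> p. q (\<sigma>(x := p)) = q \<sigma>) \<Longrightarrow> site_poly x (site_mono x q a b c)"
| add: "site_poly x f \<Longrightarrow> site_poly x g \<Longrightarrow> site_poly x (\<lambda>\<sigma>. f \<sigma> + g \<sigma>)"

lemma poly_fun_site_mono: "poly_fun q \<Longrightarrow> poly_fun (site_mono x q a b c)"
  unfolding site_mono_def[abs_def] by (intro poly_fun.mult poly_fun_power poly_fun.coord)

lemma site_poly_mult_coord: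
  assumes "site_poly x h"
  shows "site_poly x (\<lambda>\<sigma>. coord y j \<sigma> * h \<sigma>)"
  using assms
proof induction
  case (mono q a b c)
  consider "y \<noteq> x" | "y = x" "j = 1" | "y = x" "j = 2" | "y = x" "j = 3"
    using exhaust_3[of j] by blast
  then show ?case
  proof cases
    case 1
    have "(\<lambda>\<sigma>. coord y j \<sigma> * site_mono x q a b c \<sigma>) = site_mono x (\<lambda>\<sigma>. coord y j \<sigma> * q \<sigma>) a b c"
      by (simp add: site_mono_def fun_eq_iff)
    moreover have "site_poly x (site_mono x (\<lambda>\<sigma>. coord y j \<sigma> * q \<sigma>) a b c)"
      by (rule site_poly.mono) (use mono 1 in \<open>simp_all add: poly_fun.intros, simp add: coord_def\<close>)
    ultimately show ?thesis by simp
  next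
    case 2
    then have "(\<lambda>\<sigma>. coord y j \<sigma> * site_mono x q a b c \<sigma>) = site_mono x q (a + 1) b c"
      by (simp add: site_mono_def fun_eq_iff)
    then show ?thesis using site_poly.mono[OF mono] by metis
  next
    case 3
    then have "(\<lambda>\<sigma>. coord y j \<sigma> * site_mono x q a b c \<sigma>) = site_mono x q a (b + 1) c"
      by (simp add: site_mono_def fun_eq_iff)
    then show ?thesis using site_poly.mono[OF mono] by metis
  next
    case 4
    then have "(\<lambda>\<sigma>. coord y j \<sigma> * site_mono x q a b c \<sigma>) = site_mono x q a b (c + 1)"
      by (simp add: site_mono_def fun_eq_iff)
    then show ?thesis using site_poly.mono[OF mono] by metis
  qed
next
  case (add f g)
  then show ?case using site_poly.add[OF add.IH] by (simp add: distrib_left)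
qed

lemma site_poly_scale: "site_poly x h \<Longrightarrow> site_poly x (\<lambda>\<sigma>. r * h \<sigma>)"
proof (induction rule: site_poly.induct)
  case (mono q a b c)
  have "(\<lambda>\<sigma>. r * site_mono x q a b c \<sigma>) = site_mono x (\<lambda>\<sigma>. r * q \<sigma>) a b c"
    by (simp add: site_mono_def fun_eq_iff)
  moreover have "site_poly x (site_mono x (\<lambda>\<sigma>. r * q \<sigma>) a b c)"
    by (rule site_poly.mono) (use mono in \<open>simp_all add: poly_fun.intros\<close>)
  ultimately show ?case by simp
next
  case (add f g)
  then show ?case using site_poly.add[OF add.IH] by (simp add: distrib_left)
qed

text \<open>The induction proves that multiplication by p preserves the normal form. A product of
  polynomial functions is then a succession of multiplications, and only the factor
  \<open>coord\<close> needs a computation.\<close>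

lemma poly_fun_site_poly:
  assumes "poly_fun p"
  shows "site_poly x p"
proof -
  have "site_poly x (\<lambda>\<sigma>. p \<sigma> * h \<sigma>)" if "site_poly x h" for h
    using assms that
  proof (induction arbitrary: h rule: poly_fun.induct)
    case (add f g)
    then show ?case using site_poly.add[OF add.IH] by (simp add: distrib_right)
  next
    case (mult f g)
    then show ?case by (simp add: mult.assoc)
  qed (simp_all add: site_poly_mult_coord site_poly_scale)
  from this[of "site_mono x (\<lambda>_. 1) 0 0 0"] show ?thesis
    by (simp add: site_mono_def site_poly.mono poly_fun.const)
qed

text \<open>For a fixed coefficient q the values of \<kappa> on the monomials of \<sigma>_x obey the
  recursions of \<open>moments_vanish\<close>: \<open>deriv\<close> yields the recursions,
  \<open>indep\<close> the initial value m 0 0 0 = 0.\<close>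

lemma vanish_on_poly_fun:
  fixes \<kappa> :: "('g config \<Rightarrow> real) \<Rightarrow> real"
  assumes add: "\<And>p q. poly_fun p \<Longrightarrow> poly_fun q \<Longrightarrow> \<kappa> (\<lambda>\<sigma>. p \<sigma> + q \<sigma>) = \<kappa> p + \<kappa> q"
    and scale: "\<And>p c. poly_fun p \<Longrightarrow> \<kappa> (\<lambda>\<sigma>. c * p \<sigma>) = c * \<kappa> p"
    and deriv: "\<And>p p' i. poly_fun p \<Longrightarrow> poly_fun p' \<Longrightarrow> has_rot_deriv x i p p' \<Longrightarrow> \<kappa> p' = 0"
    and indep: "\<And>q. poly_fun q \<Longrightarrow> (\<And>\<sigma> p. q (\<sigma>(x := p)) = q \<sigma>) \<Longrightarrow> \<kappa> q = 0"
    and "poly_fun p"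
  shows "\<kappa> p = 0"
proof -
  have mono0: "\<kappa> (site_mono x q a b c) = 0"
    if q: "poly_fun q" "\<And>\<sigma> p. q (\<sigma>(x := p)) = q \<sigma>" for q a b c
  proof -
    define m where "m a b c = \<kappa> (site_mono x q a b c)" for a b c
    note pm = poly_fun_site_mono[OF q(1), of x]
    have lin: "\<kappa> (\<lambda>\<sigma>. r * site_mono x q a b c \<sigma> + s * site_mono x q a' b' c' \<sigma>) = r * m a b c + s * m a' b' c'"
      for r s a b c a' b' c'
      by (subst add) (simp_all add: scale pm m_def poly_fun.mult poly_fun.const)
    have D: "has_rot_deriv x i (coord x j) (dj j) \<Longrightarrow> has_rot_deriv x i (coord x k) (dj k) \<Longrightarrow>
        has_rot_deriv x i (coord x l) (dj l) \<Longrightarrow>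
      has_rot_deriv x i (\<lambda>\<sigma>. q \<sigma> * (coord x j \<sigma> ^ a * coord x k \<sigma> ^ b * coord x l \<sigma> ^ c))
       (\<lambda>\<sigma>. q \<sigma> * ((coord x j \<sigma> ^ a * coord x k \<sigma> ^ b) * ((real c * coord x l \<sigma> ^ (c - 1)) * dj l \<sigma>) +
          (coord x j \<sigma> ^ a * ((real b * coord x k \<sigma> ^ (b - 1)) * dj k \<sigma>) +
           ((real a * coord x j \<sigma> ^ (a - 1)) * dj j \<sigma>) * coord x k \<sigma> ^ b) * coord x l \<sigma> ^ c)
         + 0 * (coord x j \<sigma> ^ a * coord x k \<sigma> ^ b * coord x l \<sigma> ^ c))"
      for i j k l a b c dj
      by (intro has_rot_deriv_mult has_rot_deriv_power has_rot_deriv_indep[OF q(2)])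
    have c3: "has_rot_deriv x 3 (coord x 1) (\<lambda>\<sigma>. - coord x 2 \<sigma>)" "has_rot_deriv x 3 (coord x 2) (coord x 1)"
      "has_rot_deriv x 3 (coord x 3) (\<lambda>_. 0)"
      and c1: "has_rot_deriv x 1 (coord x 2) (\<lambda>\<sigma>. - coord x 3 \<sigma>)" "has_rot_deriv x 1 (coord x 3) (coord x 2)"
      "has_rot_deriv x 1 (coord x 1) (\<lambda>_. 0)"
      and c2: "has_rot_deriv x 2 (coord x 3) (\<lambda>\<sigma>. - coord x 1 \<sigma>)" "has_rot_deriv x 2 (coord x 1) (coord x 3)"
      "has_rot_deriv x 2 (coord x 2) (\<lambda>_. 0)"
      using has_rot_deriv_coords[of x 1] has_rot_deriv_coords[of x 2] has_rot_deriv_coords[of x 3]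
      by (simp_all add: numeral_mod_3)
    have rel: "r * m a b c + s * m a' b' c' = 0"
      if "has_rot_deriv x i (site_mono x q a0 b0 c0) f'"
        "\<And>\<sigma>. f' \<sigma> = r * site_mono x q a b c \<sigma> + s * site_mono x q a' b' c' \<sigma>"
      for i a0 b0 c0 f' r s a b c a' b' c'
    proof -
      have "f' = (\<lambda>\<sigma>. r * site_mono x q a b c \<sigma> + s * site_mono x q a' b' c' \<sigma>)"
        using that(2) by auto
      moreover have "poly_fun \<dots>" by (intro poly_fun.intros pm)
      ultimately show ?thesis using deriv[OF pm _ that(1)] lin by metis
    qed
    have D3: "has_rot_deriv x 3 (site_mono x q a b c) (\<lambda>\<sigma>. q \<sigma> *
        ((coord x 1 \<sigma> ^ a * (real b * coord x 2 \<sigma> ^ (b - 1) * coord x 1 \<sigma>) -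
         real a * coord x 1 \<sigma> ^ (a - 1) * coord x 2 \<sigma> * coord x 2 \<sigma> ^ b) * coord x 3 \<sigma> ^ c))" for a b c
      unfolding site_mono_def[abs_def]
      using D[where dj = "\<lambda>j \<sigma>. if j = 1 then - coord x 2 \<sigma> else if j = 2 then coord x 1 \<sigma> else 0",
          of 3 1 2 3 a b c] c3 by simp
    have D1: "has_rot_deriv x 1 (site_mono x q 0 b c) (\<lambda>\<sigma>. q \<sigma> *
        (coord x 2 \<sigma> ^ b * (real c * coord x 3 \<sigma> ^ (c - 1) * coord x 2 \<sigma>) -
         real b * coord x 2 \<sigma> ^ (b - 1) * coord x 3 \<sigma> * coord x 3 \<sigma> ^ c))" for b c
      unfolding site_mono_def[abs_def]
      using D[where dj = "\<lambda>j \<sigma>. if j = 2 then - coord x 3 \<sigma> else if j = 3 then coord x 2 \<sigma> else 0",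
          of 1 1 2 3 0 b c] c1 by simp
    have D2: "has_rot_deriv x 2 (site_mono x q a 0 c) (\<lambda>\<sigma>. q \<sigma> *
        (real a * coord x 1 \<sigma> ^ (a - 1) * coord x 3 \<sigma> * coord x 3 \<sigma> ^ c -
         coord x 1 \<sigma> ^ a * (real c * coord x 3 \<sigma> ^ (c - 1) * coord x 1 \<sigma>)))" for a c
      unfolding site_mono_def[abs_def]
      using D[where dj = "\<lambda>j \<sigma>. if j = 3 then - coord x 1 \<sigma> else if j = 1 then coord x 3 \<sigma> else 0",
          of 2 1 2 3 a 0 c] c2 by simp
    have "m a b c = 0"
    proof (rule moments_vanish)
      fix a b c
      \<comment> \<open>Writing u, v, w for the coordinates, the rotation about the third axis maps
        u^(a+1) v^(b+1) w^c to (b+1) u^(a+2) v^b w^c - (a+1) u^a v^(b+2) w^c, on which \<kappa>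
        vanishes. The recursions below come from the other axes and from exponents 0 in the same
        way.\<close>
      show "(real b + 1) * m (a + 2) b c = (real a + 1) * m a (b + 2) c"
        using rel[OF D3[of "a + 1" "b + 1" c], of "real b + 1" "a + 2" b c "- (real a + 1)" a "b + 2" c]
        by (simp add: site_mono_def algebra_simps power2_eq_square)
      have "(real b + 1) * m 1 b c = 0"
        using rel[OF D3[of 0 "b + 1" c], of "real b + 1" 1 b c 0 0 0 0]
        by (simp add: site_mono_def algebra_simps)
      then show "m 1 b c = 0" by simp
      show "(real c + 1) * m 0 (b + 2) c = (real b + 1) * m 0 b (c + 2)"
        using rel[OF D1[of "b + 1" "c + 1"], of "real c + 1" 0 "b + 2" c "- (real b + 1)" 0 b "c + 2"]
        by (simp add: site_mono_def algebra_simps power2_eq_square)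
      have "(real c + 1) * m 0 1 c = 0"
        using rel[OF D1[of 0 "c + 1"], of "real c + 1" 0 1 c 0 0 0 0]
        by (simp add: site_mono_def algebra_simps)
      then show "m 0 1 c = 0" by simp
      show "m 0 0 (c + 2) = (real c + 1) * m 2 0 c"
        using rel[OF D2[of 1 "c + 1"], of 1 0 0 "c + 2" "- (real c + 1)" 2 0 c]
        by (simp add: site_mono_def algebra_simps power2_eq_square)
      show "m 0 0 1 = 0"
        using rel[OF D2[of 1 0], of 1 0 0 1 0 0 0 0]
        by (simp add: site_mono_def)
      show "m 2 0 c + m 0 2 c + m 0 0 (c + 2) = m 0 0 c"
      proof -
        have "(coord x 1 \<sigma>)\<^sup>2 + (coord x 2 \<sigma>)\<^sup>2 + (coord x 3 \<sigma>)\<^sup>2 = 1" for \<sigma>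
          using sum_coord_squared[of x \<sigma>] by (simp add: sum_3)
        then have "q \<sigma> * coord x 3 \<sigma> ^ c * ((coord x 1 \<sigma>)\<^sup>2 + (coord x 2 \<sigma>)\<^sup>2 + (coord x 3 \<sigma>)\<^sup>2) =
            q \<sigma> * coord x 3 \<sigma> ^ c" for \<sigma> by simp
        then have "site_mono x q 0 0 c =
          (\<lambda>\<sigma>. (site_mono x q 2 0 c \<sigma> + site_mono x q 0 2 c \<sigma>) + site_mono x q 0 0 (c + 2) \<sigma>)"
          by (simp add: fun_eq_iff site_mono_def algebra_simps power_add power2_eq_square)
        then show ?thesis unfolding m_def by (simp add: add pm poly_fun.add)
      qed
      show "m 0 0 0 = 0"
        unfolding m_def by (rule indep) (simp_all add: pm, simp add: site_mono_def q(2))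
    qed
    then show ?thesis by (simp add: m_def)
  qed
  have "poly_fun f \<and> \<kappa> f = 0" if "site_poly x f" for f
    using that by induction (simp_all add: mono0 poly_fun_site_mono add poly_fun.add)
  then show ?thesis using poly_fun_site_poly[OF assms(5)] by blast
qed

section \<open>From the infinitesimal to the integrated equilibrium condition\<close>

text \<open>The real form of a state. \<rho> is a total map on functions of configurations, but is
  constrained only at continuous ones, so continuity has to accompany every use.\<close>

locale config_state =
  fixes \<rho> :: "('g::countable config \<Rightarrow> real) \<Rightarrow> real"
  assumes add: "continuous_on UNIV f \<Longrightarrow> continuous_on UNIV g \<Longrightarrow> \<rho> (\<lambda>\<sigma>. f \<sigma> + g \<sigma>) = \<rho> f + \<rho> g"
    and scale: "continuous_on UNIV f \<Longrightarrow> \<rho> (\<lambda>\<sigma>. c * f \<sigma>) = c * \<rho> f"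
    and nonneg: "continuous_on UNIV f \<Longrightarrow> (\<And>\<sigma>. 0 \<le> f \<sigma>) \<Longrightarrow> 0 \<le> \<rho> f"
    and one: "\<rho> (\<lambda>_. 1) = 1"
begin

lemma diff: "continuous_on UNIV f \<Longrightarrow> continuous_on UNIV g \<Longrightarrow> \<rho> (\<lambda>\<sigma>. f \<sigma> - g \<sigma>) = \<rho> f - \<rho> g"
  using add[of f "\<lambda>\<sigma>. - 1 * g \<sigma>"] scale[of g "-1"] by (simp add: continuous_on_minus)

lemma const: "\<rho> (\<lambda>_. c) = c"
  using scale[of "\<lambda>_. 1" c] one by simp

lemma mono:
  assumes "continuous_on UNIV f" "continuous_on UNIV g" "\<And>\<sigma>. f \<sigma> \<le> g \<sigma>"
  shows "\<rho> f \<le> \<rho> g"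
  using nonneg[of "\<lambda>\<sigma>. g \<sigma> - f \<sigma>"] diff[OF assms(2,1)] assms by (simp add: continuous_on_diff)

lemma abs_le:
  assumes "continuous_on UNIV f" "\<And>\<sigma>. \<bar>f \<sigma>\<bar> \<le> B"
  shows "\<bar>\<rho> f\<bar> \<le> B"
proof -
  have "\<rho> f \<le> B" "- B \<le> \<rho> f"
    using mono[OF assms(1) continuous_on_const, of B] mono[OF continuous_on_const assms(1), of "- B"]
      assms(2) by (auto simp: const abs_le_iff minus_le_iff)
  then show ?thesis by (simp add: abs_le_iff)
qed

lemma abs_diff_le:
  assumes "continuous_on UNIV f" "continuous_on UNIV g" "\<And>\<sigma>. \<bar>f \<sigma> - g \<sigma>\<bar> \<le> B"
  shows "\<bar>\<rho> f - \<rho> g\<bar> \<le> B"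
  using abs_le[of "\<lambda>\<sigma>. f \<sigma> - g \<sigma>"] assms by (simp add: diff continuous_on_diff)

lemma eq_if_eq_on_poly_fun:
  assumes "\<And>p. poly_fun p \<Longrightarrow> T p = 0"
    and T: "\<And>f g B. continuous_on UNIV f \<Longrightarrow> continuous_on UNIV g \<Longrightarrow> (\<And>\<sigma>. \<bar>f \<sigma> - g \<sigma>\<bar> \<le> B) \<Longrightarrow>
      \<bar>T f - T g\<bar> \<le> C * B"
    and f: "continuous_on UNIV f"
  shows "T (f :: 'g config \<Rightarrow> real) = (0::real)"
proof -
  have "\<bar>T f\<bar> \<le> 0 + e" if "e > 0" for e
  proof -
    \<comment> \<open>The summand 1 and the absolute value keep the divisor positive whatever the
      Lipschitz constant \<open>C\<close> is.\<close>
    have "e / (\<bar>C\<bar> + 1) > 0" using that by simp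
    then obtain p where p: "poly_fun p" "\<And>\<sigma>. \<bar>f \<sigma> - p \<sigma>\<bar> < e / (\<bar>C\<bar> + 1)"
      using poly_fun_dense[OF f] by metis
    then have "\<bar>T f\<bar> \<le> C * (e / (\<bar>C\<bar> + 1))"
      using T[OF f poly_fun_continuous[OF p(1)], of "e / (\<bar>C\<bar> + 1)"] assms(1)[OF p(1)]
      by (simp add: less_imp_le)
    also have "\<dots> \<le> (\<bar>C\<bar> + 1) * (e / (\<bar>C\<bar> + 1))"
      using that by (intro mult_right_mono) auto
    finally show ?thesis by simp
  qed
  then have "\<bar>T f\<bar> \<le> 0" by (rule field_le_epsilon)
  then show ?thesis by simp
qed

text \<open>States are sup norm contractions, so the uniform Taylor remainder of f carries over to
  the expectation.\<close>

lemma rotation_derivative: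
  assumes "continuous_on UNIV f" "continuous_on UNIV f'" "has_rot_deriv x i f f'"
  shows "((\<lambda>u. \<rho> (\<lambda>\<sigma>. f (rotation_curve x i \<sigma> u))) has_real_derivative
      \<rho> (\<lambda>\<sigma>. f' (rotation_curve x i \<sigma> u))) (at u)"
  unfolding has_field_derivative_def has_derivative_at_alt
proof (intro conjI allI impI)
  show "bounded_linear ((*) (\<rho> (\<lambda>\<sigma>. f' (rotation_curve x i \<sigma> u))))"
    by (rule bounded_linear_mult_right)
  fix e :: real assume "e > 0"
  obtain d where d: "d > 0"
    "\<And>h \<sigma>. \<bar>h\<bar> \<le> d \<Longrightarrow> norm (f (rotation_curve x i \<sigma> h) - f \<sigma> - h *\<^sub>R f' \<sigma>) \<le> \<bar>h\<bar> * e"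
    using has_rot_deriv_uniform[OF assms(3,2) \<open>e > 0\<close>] by metis
  have c: "continuous_on UNIV (\<lambda>\<sigma>. g (rotation_curve x i \<sigma> h))" if "continuous_on UNIV g"
    for g :: "'g config \<Rightarrow> real" and h
    by (rule continuous_on_rotation_curve'[OF that continuous_on_id continuous_on_const])
  have "norm (\<rho> (\<lambda>\<sigma>. f (rotation_curve x i \<sigma> v)) - \<rho> (\<lambda>\<sigma>. f (rotation_curve x i \<sigma> u)) -
      \<rho> (\<lambda>\<sigma>. f' (rotation_curve x i \<sigma> u)) * (v - u)) \<le> e * norm (v - u)" if v: "norm (v - u) < d" for v
  proof -
    have "\<bar>(f (rotation_curve x i \<sigma> v) - f (rotation_curve x i \<sigma> u)) -
      (v - u) * f' (rotation_curve x i \<sigma> u)\<bar> \<le> \<bar>v - u\<bar> * e" for \<sigma>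
      using d(2)[of "v - u" "rotation_curve x i \<sigma> u"] v by (simp add: rotation_curve_add)
    then have "\<bar>\<rho> (\<lambda>\<sigma>. f (rotation_curve x i \<sigma> v) - f (rotation_curve x i \<sigma> u)) -
      \<rho> (\<lambda>\<sigma>. (v - u) * f' (rotation_curve x i \<sigma> u))\<bar> \<le> \<bar>v - u\<bar> * e"
      by (intro abs_diff_le continuous_intros c assms)
    then show ?thesis
      by (simp add: diff scale c assms mult.commute)
  qed
  then show "\<exists>d>0. \<forall>v. norm (v - u) < d \<longrightarrow>
    norm (\<rho> (\<lambda>\<sigma>. f (rotation_curve x i \<sigma> v)) - \<rho> (\<lambda>\<sigma>. f (rotation_curve x i \<sigma> u)) -
      \<rho> (\<lambda>\<sigma>. f' (rotation_curve x i \<sigma> u)) * (v - u)) \<le> e * norm (v - u)"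
    using d(1) by blast
qed

text \<open>Integrated over the flow up to time \<open>h\<close>, the identity is stable under uniform limits.\<close>

lemma infinitesimal_extend:
  assumes W: "continuous_on UNIV W"
    and poly: "\<And>p p'. poly_fun p \<Longrightarrow> poly_fun p' \<Longrightarrow> has_rot_deriv x i p p' \<Longrightarrow> \<rho> p' = \<rho> (\<lambda>\<sigma>. p \<sigma> * W \<sigma>)"
    and g: "continuous_on UNIV g" "continuous_on UNIV g'" "has_rot_deriv x i g g'"
  shows "\<rho> g' = \<rho> (\<lambda>\<sigma>. g \<sigma> * W \<sigma>)"
proof -
  obtain B where B: "B > 0" "\<And>\<sigma>. \<bar>W \<sigma>\<bar> \<le> B"
    using bounded_continuous_config[OF W] by (metis real_norm_def)
  have c: "continuous_on UNIV (\<lambda>\<sigma>. g (rotation_curve x i \<sigma> h))" if "continuous_on UNIV g"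
    for g :: "'g config \<Rightarrow> real" and h
    by (rule continuous_on_rotation_curve'[OF that continuous_on_id continuous_on_const])
  \<comment> \<open>The identity for p, integrated over times in [0, h]. The derivative of p has
    disappeared from the estimate, and only its variation \<open>E\<close> along the flow remains;
    hence it can be transferred to g through uniform approximation.\<close>
  have P: "\<bar>\<rho> (\<lambda>\<sigma>. p (rotation_curve x i \<sigma> h)) - \<rho> p - h * \<rho> (\<lambda>\<sigma>. p \<sigma> * W \<sigma>)\<bar> \<le> h * (E * B)"
    if p: "poly_fun p" and h: "h \<ge> 0"
      and E: "\<And>u \<sigma>. 0 \<le> u \<Longrightarrow> u \<le> h \<Longrightarrow> \<bar>p (rotation_curve x i \<sigma> u) - p \<sigma>\<bar> \<le> E"
    for p h E
  proof -
    obtain p' where p': "poly_fun p'" "has_rot_deriv x i p p'"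
      using poly_fun_has_rot_deriv[OF p] by blast
    let ?F = "\<lambda>u. \<rho> (\<lambda>\<sigma>. p (rotation_curve x i \<sigma> u))"
    let ?F' = "\<lambda>u. \<rho> (\<lambda>\<sigma>. p (rotation_curve x i \<sigma> u) * W \<sigma>)"
    have "has_rot_deriv x i (\<lambda>\<sigma>. p (rotation_curve x i \<sigma> u)) (\<lambda>\<sigma>. p' (rotation_curve x i \<sigma> u))" for u
      unfolding has_rot_deriv_def
    proof
      fix \<sigma>
      show "((\<lambda>t. p (rotation_curve x i (rotation_curve x i \<sigma> t) u)) has_vector_derivative
          p' (rotation_curve x i \<sigma> u)) (at 0)"
        using p'(2)[unfolded has_rot_deriv_def, rule_format, of "rotation_curve x i \<sigma> u"]
        by (simp add: rotation_curve_add add.commute)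
    qed
    then have eq: "\<rho> (\<lambda>\<sigma>. p' (rotation_curve x i \<sigma> u)) = ?F' u" for u
      by (intro poly poly_fun_rotation p p'(1))
    have "norm (?F h - ?F 0 - (h - 0) *\<^sub>R ?F' 0) \<le> norm (h - 0) * (E * B)"
    proof (rule vector_differentiable_bound_linearization[where f' = ?F'])
      show "(?F has_vector_derivative ?F' u) (at u within {0..h})" for u
        using rotation_derivative[OF poly_fun_continuous[OF p] poly_fun_continuous[OF p'(1)] p'(2), of u]
        unfolding eq has_real_derivative_iff_has_vector_derivative
        by (rule has_vector_derivative_at_within)
      show "norm (?F' u - ?F' 0) \<le> E * B" if "u \<in> {0..h}" for u
        unfolding real_norm_def
      proof (rule abs_diff_le)
        show "\<bar>p (rotation_curve x i \<sigma> u) * W \<sigma> - p (rotation_curve x i \<sigma> 0) * W \<sigma>\<bar> \<le> E * B" for \<sigma>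
          using mult_mono[OF E[of u \<sigma>] B(2)[of \<sigma>]] that E[of 0] h
          by (force simp: left_diff_distrib[symmetric] abs_mult)
      qed (intro continuous_on_mult W poly_fun_continuous poly_fun_rotation p)+
    qed (use h in \<open>auto simp: closed_segment_eq_real_ivl\<close>)
    then show ?thesis using h by simp
  qed
  have approx: "\<bar>\<rho> g' - \<rho> (\<lambda>\<sigma>. g \<sigma> * W \<sigma>)\<bar> \<le> e * (4 * B + 3)" if e: "e > 0" for e
  proof -
    obtain d1 where d1: "d1 > 0"
      "\<And>t \<sigma>. \<bar>t\<bar> \<le> d1 \<Longrightarrow> norm (g (rotation_curve x i \<sigma> t) - g \<sigma>) \<le> e"
      using rotation_uniformly_continuous[OF g(1) e] by metis
    obtain d2 where d2: "d2 > 0"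
      "\<And>h \<sigma>. \<bar>h\<bar> \<le> d2 \<Longrightarrow> norm (g (rotation_curve x i \<sigma> h) - g \<sigma> - h *\<^sub>R g' \<sigma>) \<le> \<bar>h\<bar> * e"
      using has_rot_deriv_uniform[OF g(3,2) e] by metis
    define h where "h = min 1 (min d1 d2)"
    have h: "0 < h" "h \<le> 1" "h \<le> d1" "h \<le> d2" using d1(1) d2(1) by (auto simp: h_def)
    have he: "h * e > 0" "h * e \<le> e" using h e by auto
    \<comment> \<open>The accuracy h e, rather than e, is needed because the estimates are divided
      by h at the end.\<close>
    obtain p where p: "poly_fun p" "\<And>\<sigma>. \<bar>g \<sigma> - p \<sigma>\<bar> < h * e"
      using poly_fun_dense[OF g(1) he(1)] by metis
    have pc: "continuous_on UNIV p" by (rule poly_fun_continuous[OF p(1)])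
    \<comment> \<open>One e for the variation of g along the flow, and one for each of the two
      replacements of g by p.\<close>
    have E: "\<bar>p (rotation_curve x i \<sigma> u) - p \<sigma>\<bar> \<le> 3 * e" if "0 \<le> u" "u \<le> h" for u \<sigma>
      using p(2)[of \<sigma>] p(2)[of "rotation_curve x i \<sigma> u"] d1(2)[of u \<sigma>] that h he by simp
    have 1: "\<bar>\<rho> (\<lambda>\<sigma>. p (rotation_curve x i \<sigma> h)) - \<rho> p - h * \<rho> (\<lambda>\<sigma>. p \<sigma> * W \<sigma>)\<bar> \<le> h * (3 * e * B)"
      using P[OF p(1) _ E] h by simp
    have 2: "\<bar>\<rho> (\<lambda>\<sigma>. g (rotation_curve x i \<sigma> h)) - \<rho> (\<lambda>\<sigma>. p (rotation_curve x i \<sigma> h))\<bar> \<le> h * e"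
      by (intro abs_diff_le c g(1) pc less_imp_le p(2))
    have 3: "\<bar>\<rho> g - \<rho> p\<bar> \<le> h * e"
      by (intro abs_diff_le g(1) pc less_imp_le p(2))
    have "\<bar>g \<sigma> * W \<sigma> - p \<sigma> * W \<sigma>\<bar> \<le> (h * e) * B" for \<sigma>
      using mult_mono[OF less_imp_le[OF p(2)[of \<sigma>]] B(2)[of \<sigma>]] he
      by (simp add: left_diff_distrib[symmetric] abs_mult)
    then have "\<bar>\<rho> (\<lambda>\<sigma>. g \<sigma> * W \<sigma>) - \<rho> (\<lambda>\<sigma>. p \<sigma> * W \<sigma>)\<bar> \<le> (h * e) * B"
      by (intro abs_diff_le continuous_intros g(1) pc W)
    also have "\<dots> \<le> e * B" using he B by (simp add: mult_right_mono)
    finally have 4: "h * \<bar>\<rho> (\<lambda>\<sigma>. g \<sigma> * W \<sigma>) - \<rho> (\<lambda>\<sigma>. p \<sigma> * W \<sigma>)\<bar> \<le> h * (e * B)"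
      using h by simp
    have "\<bar>\<rho> (\<lambda>\<sigma>. g (rotation_curve x i \<sigma> h) - g \<sigma>) - \<rho> (\<lambda>\<sigma>. h * g' \<sigma>)\<bar> \<le> h * e"
      using d2(2)[of h] h by (intro abs_diff_le continuous_intros c g) auto
    then have 5: "\<bar>\<rho> (\<lambda>\<sigma>. g (rotation_curve x i \<sigma> h)) - \<rho> g - h * \<rho> g'\<bar> \<le> h * e"
      by (simp add: diff scale c g)
    have "h * \<bar>\<rho> g' - \<rho> (\<lambda>\<sigma>. g \<sigma> * W \<sigma>)\<bar> = \<bar>h * \<rho> g' - h * \<rho> (\<lambda>\<sigma>. g \<sigma> * W \<sigma>)\<bar>"
      using h by (simp add: right_diff_distrib[symmetric] abs_mult)
    moreover have "\<bar>h * \<rho> (\<lambda>\<sigma>. g \<sigma> * W \<sigma>) - h * \<rho> (\<lambda>\<sigma>. p \<sigma> * W \<sigma>)\<bar> \<le> h * (e * B)"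
      using 4 h by (simp add: right_diff_distrib[symmetric] abs_mult)
    ultimately have "h * \<bar>\<rho> g' - \<rho> (\<lambda>\<sigma>. g \<sigma> * W \<sigma>)\<bar> \<le> 3 * (h * e) + h * (3 * e * B) + h * (e * B)"
      using 1 2 3 5 by linarith
    also have "\<dots> = h * (e * (4 * B + 3))" by (simp add: algebra_simps)
    finally show ?thesis using h by simp
  qed
  then have "\<bar>\<rho> g' - \<rho> (\<lambda>\<sigma>. g \<sigma> * W \<sigma>)\<bar> \<le> 0 + e" if "e > 0" for e
    using approx[of "e / (4 * B + 3)"] that B(1) by simp
  then have "\<bar>\<rho> g' - \<rho> (\<lambda>\<sigma>. g \<sigma> * W \<sigma>)\<bar> \<le> 0" by (rule field_le_epsilon)
  then show ?thesis by simp
qed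

text \<open>Applied to \<open>p e\<^sup>U\<close>, the identity says that \<open>\<nu> = \<rho> (\<cdot> e\<^sup>U)\<close> is rotation invariant at
  the site \<open>x\<close>, hence integrates out \<open>\<sigma>\<^sub>x\<close>.\<close>

lemma weighted_average:
  assumes U: "continuous_on UNIV U" "\<And>i. continuous_on UNIV (W i)" "\<And>i. has_rot_deriv x i U (W i)"
    and kms: "\<And>i p p'. poly_fun p \<Longrightarrow> poly_fun p' \<Longrightarrow> has_rot_deriv x i p p' \<Longrightarrow> \<rho> p' = \<rho> (\<lambda>\<sigma>. p \<sigma> * W i \<sigma>)"
    and f: "continuous_on UNIV f"
  shows "\<rho> (\<lambda>\<sigma>. f \<sigma> * exp (U \<sigma>)) = \<rho> (\<lambda>\<sigma>. av x f \<sigma> * exp (U \<sigma>))"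
proof -
  have eU: "continuous_on UNIV (\<lambda>\<sigma>. exp (U \<sigma>))" by (intro continuous_intros U)
  obtain B where B: "B > 0" "\<And>\<sigma>. \<bar>exp (U \<sigma>)\<bar> \<le> B"
    using bounded_continuous_config[OF eU] by (metis real_norm_def)
  define \<kappa> where "\<kappa> f = \<rho> (\<lambda>\<sigma>. f \<sigma> * exp (U \<sigma>)) - \<rho> (\<lambda>\<sigma>. av x f \<sigma> * exp (U \<sigma>))" for f
  have c: "continuous_on UNIV (\<lambda>\<sigma>. f \<sigma> * exp (U \<sigma>))" if "continuous_on UNIV f" for f
    by (intro continuous_intros that U)
  have \<kappa>_bound: "\<bar>\<kappa> f - \<kappa> g\<bar> \<le> (2 * B) * b"
    if "continuous_on UNIV f" "continuous_on UNIV g" "\<And>\<sigma>. \<bar>f \<sigma> - g \<sigma>\<bar> \<le> b" for f g b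
  proof -
    have *: "\<bar>\<rho> (\<lambda>\<sigma>. f \<sigma> * exp (U \<sigma>)) - \<rho> (\<lambda>\<sigma>. g \<sigma> * exp (U \<sigma>))\<bar> \<le> b * B"
      if "continuous_on UNIV f" "continuous_on UNIV g" "\<And>\<sigma>. \<bar>f \<sigma> - g \<sigma>\<bar> \<le> b" for f g
    proof (rule abs_diff_le)
      have "0 \<le> b" using that(3) abs_ge_zero order_trans by blast
      then show "\<bar>f \<sigma> * exp (U \<sigma>) - g \<sigma> * exp (U \<sigma>)\<bar> \<le> b * B" for \<sigma>
        using mult_mono[OF that(3)[of \<sigma>] B(2)[of \<sigma>]] by (simp add: left_diff_distrib[symmetric] abs_mult)
    qed (use that c in auto)
    have "\<bar>av x f \<sigma> - av x g \<sigma>\<bar> \<le> b" for \<sigma>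
    proof -
      have "av x f \<sigma> - av x g \<sigma> = av x (\<lambda>\<sigma>. f \<sigma> - g \<sigma>) \<sigma>"
        by (simp add: av_def av_integrable that)
      also have "\<bar>\<dots>\<bar> \<le> b"
        using norm_av_le[of "\<lambda>\<sigma>. f \<sigma> - g \<sigma>" b x \<sigma>] that by (simp add: continuous_on_diff)
      finally show ?thesis .
    qed
    from *[OF that] *[OF av_continuous[OF that(1)] av_continuous[OF that(2)] this]
    moreover have "2 * B * b = b * B + b * B" by simp
    ultimately show ?thesis unfolding \<kappa>_def by linarith
  qed
  have "\<kappa> p = 0" if p: "poly_fun p" for p
  proof (rule vanish_on_poly_fun[OF _ _ _ _ p])
    fix p q :: "'g config \<Rightarrow> real" assume pq: "poly_fun p" "poly_fun q"
    note pqc = pq[THEN poly_fun_continuous, of UNIV]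
    show "\<kappa> (\<lambda>\<sigma>. p \<sigma> + q \<sigma>) = \<kappa> p + \<kappa> q"
      by (simp add: \<kappa>_def distrib_right av_add pqc add c av_continuous)
  next
    fix p :: "'g config \<Rightarrow> real" and r assume p: "poly_fun p"
    have "av x (\<lambda>\<sigma>. r * p \<sigma>) = (\<lambda>\<sigma>. r * av x p \<sigma>)"
      by (simp add: av_def fun_eq_iff)
    then show "\<kappa> (\<lambda>\<sigma>. r * p \<sigma>) = r * \<kappa> p"
      using p[THEN poly_fun_continuous, of UNIV]
      by (simp add: \<kappa>_def mult.assoc scale c av_continuous right_diff_distrib)
  next
    fix p p' i assume p: "poly_fun p" "poly_fun p'" "has_rot_deriv x i p p'"
    note pc = p(1)[THEN poly_fun_continuous, of UNIV] and pc' = p(2)[THEN poly_fun_continuous, of UNIV]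
    \<comment> \<open>The function p e^U is not polynomial, which is where
      \<open>infinitesimal_extend\<close> enters. In the derivative p' e^U + p e^U W the second term
      equals the right-hand side of the identity and cancels, leaving \<rho>(p' e^U) = 0.\<close>
    have "has_rot_deriv x i (\<lambda>\<sigma>. exp (U \<sigma>)) (\<lambda>\<sigma>. exp (U \<sigma>) * W i \<sigma>)"
      by (rule has_rot_deriv_chain[OF U(3)]) (rule DERIV_exp)
    from has_rot_deriv_mult[OF p(3) this]
    have "\<rho> (\<lambda>\<sigma>. p \<sigma> * (exp (U \<sigma>) * W i \<sigma>) + p' \<sigma> * exp (U \<sigma>)) = \<rho> (\<lambda>\<sigma>. p \<sigma> * exp (U \<sigma>) * W i \<sigma>)"
      by (intro infinitesimal_extend[OF U(2) kms] continuous_intros pc pc' U) auto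
    then have "\<rho> (\<lambda>\<sigma>. p' \<sigma> * exp (U \<sigma>)) = 0"
      by (subst (asm) add) (auto intro!: continuous_intros pc pc' U simp: mult.assoc)
    moreover have "av x p' \<sigma> = 0" for \<sigma> using avs_rot_deriv[OF pc pc' p(3), of "[x]" \<sigma>] by simp
    ultimately show "\<kappa> p' = 0" by (simp add: \<kappa>_def const)
  next
    fix q :: "'g config \<Rightarrow> real" assume "\<And>\<sigma> p. q (\<sigma>(x := p)) = q \<sigma>"
    then show "\<kappa> q = 0" by (simp add: \<kappa>_def av_indep)
  qed
  then have "\<kappa> f = 0" by (rule eq_if_eq_on_poly_fun[OF _ \<kappa>_bound f])
  then show ?thesis by (simp add: \<kappa>_def)
qed

end

text \<open>The expectation under the conditional Gibbs distribution of the spin at x, all other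
  spins being frozen at \<sigma>.\<close>

definition gibbs_kernel :: "'g \<Rightarrow> ('g config \<Rightarrow> real) \<Rightarrow> ('g config \<Rightarrow> real) \<Rightarrow> 'g config \<Rightarrow> real"
  where "gibbs_kernel x U f \<sigma> = av x (\<lambda>\<sigma>. f \<sigma> * exp (- U \<sigma>)) \<sigma> / av x (\<lambda>\<sigma>. exp (- U \<sigma>)) \<sigma>"

lemma av_exp_pos:
  assumes "continuous_on UNIV U"
  shows "av x (\<lambda>\<sigma>. exp (- U \<sigma>)) \<sigma> > (0::real)"
proof -
  obtain B where "\<And>\<sigma>. norm (U \<sigma>) \<le> B" using bounded_continuous_config[OF assms] by metis
  then have B: "- B \<le> - U \<sigma>" for \<sigma> by (simp add: abs_le_iff)
  have "exp (- B) = av x (\<lambda>_. exp (- B)) \<sigma>" by (simp add: av_indep)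
  also have "\<dots> \<le> av x (\<lambda>\<sigma>. exp (- U \<sigma>)) \<sigma>"
    using B by (intro av_mono continuous_intros assms) auto
  finally show ?thesis using exp_gt_zero[of "- B"] by linarith
qed

lemma gibbs_kernel_continuous:
  assumes "continuous_on UNIV U" "continuous_on UNIV f"
  shows "continuous_on UNIV (gibbs_kernel x U f)"
  unfolding gibbs_kernel_def[abs_def]
  using av_exp_pos[OF assms(1), of x]
  by (intro continuous_on_divide av_continuous continuous_intros assms) (auto simp: less_le)

lemma gibbs_kernel_update [simp]: "gibbs_kernel x U f (\<sigma>(x := p)) = gibbs_kernel x U f \<sigma>"
  by (simp add: gibbs_kernel_def)

text \<open>The functions f e^(-U) and g e^(-U), with g the kernel applied to f, have the same
  average over \<sigma>_x, since g does not depend on \<sigma>_x. By \<open>weighted_average\<close>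
  they are indistinguishable for \<rho>(\<cdot> e^U), where the exponentials cancel.\<close>

lemma (in config_state) DLR:
  assumes U: "continuous_on UNIV U" "\<And>i. continuous_on UNIV (W i)" "\<And>i. has_rot_deriv x i U (W i)"
    and kms: "\<And>i p p'. poly_fun p \<Longrightarrow> poly_fun p' \<Longrightarrow> has_rot_deriv x i p p' \<Longrightarrow> \<rho> p' = \<rho> (\<lambda>\<sigma>. p \<sigma> * W i \<sigma>)"
    and f: "continuous_on UNIV f"
  shows "\<rho> f = \<rho> (gibbs_kernel x U f)"
proof -
  note wa = weighted_average[OF U kms]
  let ?g = "gibbs_kernel x U f"
  have "\<rho> f = \<rho> (\<lambda>\<sigma>. (f \<sigma> * exp (- U \<sigma>)) * exp (U \<sigma>))"
    by (simp add: mult.assoc exp_add[symmetric])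
  also have "\<dots> = \<rho> (\<lambda>\<sigma>. av x (\<lambda>\<sigma>. f \<sigma> * exp (- U \<sigma>)) \<sigma> * exp (U \<sigma>))"
    by (rule wa) (auto intro!: continuous_intros f U)
  also have "(\<lambda>\<sigma>. av x (\<lambda>\<sigma>. f \<sigma> * exp (- U \<sigma>)) \<sigma>) = (\<lambda>\<sigma>. av x (\<lambda>\<sigma>. ?g \<sigma> * exp (- U \<sigma>)) \<sigma>)"
  proof
    fix \<sigma>
    have "av x (\<lambda>\<sigma>. ?g \<sigma> * exp (- U \<sigma>)) \<sigma> = ?g \<sigma> * av x (\<lambda>\<sigma>. exp (- U \<sigma>)) \<sigma>"
      by (rule av_mult_indep) simp
    then show "av x (\<lambda>\<sigma>. f \<sigma> * exp (- U \<sigma>)) \<sigma> = av x (\<lambda>\<sigma>. ?g \<sigma> * exp (- U \<sigma>)) \<sigma>"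
      using av_exp_pos[OF U(1), of x \<sigma>] by (simp add: gibbs_kernel_def)
  qed
  also have "\<rho> (\<lambda>\<sigma>. (\<lambda>\<sigma>. av x (\<lambda>\<sigma>. ?g \<sigma> * exp (- U \<sigma>)) \<sigma>) \<sigma> * exp (U \<sigma>)) =
      \<rho> (\<lambda>\<sigma>. (?g \<sigma> * exp (- U \<sigma>)) * exp (U \<sigma>))"
    by (rule wa[symmetric]) (auto intro!: continuous_intros gibbs_kernel_continuous f U)
  also have "\<dots> = \<rho> ?g"
    by (simp add: mult.assoc exp_add[symmetric])
  finally show ?thesis .
qed

section \<open>Dobrushin uniqueness\<close>

text \<open>The kernel as a functional on one sphere: two boundary conditions become two weights u
  and v on the same space and can be compared.\<close>

definition sphere_gibbs :: "(s2 \<Rightarrow> real) \<Rightarrow> (s2 \<Rightarrow> real) \<Rightarrow> real"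
  where "sphere_gibbs u F =
    (\<integral>q. F q * exp (- u q) \<partial>sphere_measure) / (\<integral>q. exp (- u q) \<partial>sphere_measure)"

lemma gibbs_kernel_eq:
  "gibbs_kernel x U f \<sigma> = sphere_gibbs (\<lambda>q. U (\<sigma>(x := q))) (\<lambda>q. f (\<sigma>(x := q)))"
  by (simp add: gibbs_kernel_def sphere_gibbs_def av_def)

lemma sphere_integral_exp_pos:
  assumes "continuous_on UNIV u"
  shows "(\<integral>q. exp (- u q) \<partial>sphere_measure) > (0::real)"
proof -
  have "av undefined (\<lambda>\<sigma>::unit config. exp (- u (\<sigma> ()))) (\<lambda>_. undefined) > 0"
    by (intro av_exp_pos continuous_on_compose2[OF assms continuous_on_site]) auto
  then show ?thesis by (simp add: av_def)
qed

text \<open>Replacing v by u changes the numerator and the partition function by factors at most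
  e^\<eta> each. After subtracting its minimum, G lies between 0 and b, so the change of its
  expectation is at most (e^(2 \<eta>) - 1) b; the assumption 2 \<eta> \<le> 1 linearizes this to 4
  \<eta> b.\<close>

lemma sphere_gibbs_diff_le:
  assumes cont: "continuous_on UNIV u" "continuous_on UNIV v" "continuous_on UNIV F" "continuous_on UNIV G"
    and FG: "\<And>q. \<bar>F q - G q\<bar> \<le> a"
    and osc: "\<And>q q'. \<bar>G q - G q'\<bar> \<le> b"
    and uv: "\<And>q. \<bar>u q - v q\<bar> \<le> \<eta>" and \<eta>: "2 * \<eta> \<le> 1"
  shows "sphere_gibbs u F - sphere_gibbs v G \<le> a + 4 * \<eta> * b"
proof -
  have int: "integrable sphere_measure (\<lambda>q. H q * exp (- w q))" "integrable sphere_measure (\<lambda>q. exp (- w q))"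
    if "continuous_on UNIV H" "continuous_on UNIV w" for H w :: "s2 \<Rightarrow> real"
    by (intro sphere_integrable continuous_intros that)+
  let ?Z = "\<lambda>w. \<integral>q. exp (- w q) \<partial>sphere_measure"
  have Z: "?Z u > 0" "?Z v > 0" by (intro sphere_integral_exp_pos cont)+
  have \<eta>0: "0 \<le> \<eta>" using uv[of undefined] by linarith
  have b0: "0 \<le> b" using osc[of undefined undefined] by linarith
  have mono: "sphere_gibbs w H \<le> sphere_gibbs w H'"
    if "continuous_on UNIV H" "continuous_on UNIV H'" "continuous_on UNIV w" "\<And>q. H q \<le> H' q" for w H H'
    unfolding sphere_gibbs_def using sphere_integral_exp_pos[OF that(3)]
    by (intro divide_right_mono integral_mono int that mult_right_mono) auto
  have shift: "sphere_gibbs w (\<lambda>q. H q + r) = sphere_gibbs w H + r"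
    if "continuous_on UNIV H" "continuous_on UNIV w" for w H r
    unfolding sphere_gibbs_def using sphere_integral_exp_pos[OF that(2)]
    by (simp add: distrib_right int[OF that] add_divide_distrib)
  obtain q0 where q0: "\<And>q. G q0 \<le> G q"
    using continuous_attains_inf[OF compact_UNIV_s2 _ cont(4)] by auto
  define H where "H q = G q - G q0" for q
  have Hc: "continuous_on UNIV H" unfolding H_def by (intro continuous_intros cont)
  have H: "0 \<le> H q" "H q \<le> b" for q
    using q0[of q] osc[of q q0] by (simp_all add: H_def)
  have e: "exp (- u q) \<le> exp \<eta> * exp (- v q)" "exp (- v q) \<le> exp \<eta> * exp (- u q)" for q
    using uv[of q] by (simp_all add: exp_add[symmetric] abs_le_iff)
  have num: "(\<integral>q. H q * exp (- u q) \<partial>sphere_measure) \<le> exp \<eta> * (\<integral>q. H q * exp (- v q) \<partial>sphere_measure)"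
  proof -
    have "(\<integral>q. H q * exp (- u q) \<partial>sphere_measure) \<le> (\<integral>q. exp \<eta> * (H q * exp (- v q)) \<partial>sphere_measure)"
      using mult_left_mono[OF e(1) H(1)]
      by (intro integral_mono integrable_mult_right int cont Hc) (simp add: mult.left_commute)
    then show ?thesis by simp
  qed
  have den: "?Z v \<le> exp \<eta> * ?Z u"
  proof -
    have "?Z v \<le> (\<integral>q. exp \<eta> * exp (- u q) \<partial>sphere_measure)"
      using e(2) by (intro integral_mono integrable_mult_right int[of "\<lambda>_. 1"] cont continuous_on_const) auto
    then show ?thesis by simp
  qed
  have "sphere_gibbs v (\<lambda>_. 0) \<le> sphere_gibbs v H" by (rule mono) (auto simp: H cont Hc)
  then have Hv0: "0 \<le> sphere_gibbs v H" by (simp add: sphere_gibbs_def)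
  have "sphere_gibbs v H \<le> sphere_gibbs v (\<lambda>_. b)" by (rule mono) (auto simp: H cont Hc)
  also have "\<dots> = b" using shift[of "\<lambda>_. 0" v b] by (simp add: sphere_gibbs_def cont)
  finally have Hv: "sphere_gibbs v H \<le> b" .
  have "sphere_gibbs u H \<le> exp \<eta> * (\<integral>q. H q * exp (- v q) \<partial>sphere_measure) / ?Z u"
    unfolding sphere_gibbs_def using num Z by (simp add: divide_right_mono)
  also have "\<dots> = exp \<eta> * (?Z v / ?Z u) * sphere_gibbs v H"
    unfolding sphere_gibbs_def using Z by simp
  also have "\<dots> \<le> exp \<eta> * exp \<eta> * sphere_gibbs v H"
    using den Z Hv0 by (intro mult_right_mono mult_left_mono) (simp_all add: divide_le_eq)
  also have "exp \<eta> * exp \<eta> = exp (2 * \<eta>)" by (simp add: exp_add[symmetric])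
  also have "exp (2 * \<eta>) * sphere_gibbs v H \<le> (1 + 4 * \<eta>) * sphere_gibbs v H"
  proof (rule mult_right_mono[OF _ Hv0])
    \<comment> \<open>On [0, 1] the exponential is at most 1 + t + t^2, hence at most 1 + 2
      t.\<close>
    have "exp (2 * \<eta>) \<le> 1 + 2 * \<eta> + (2 * \<eta>)\<^sup>2" using exp_bound[of "2 * \<eta>"] \<eta> \<eta>0 by simp
    also have "(2 * \<eta>)\<^sup>2 \<le> 2 * \<eta>" using \<eta> \<eta>0 mult_left_mono[OF \<eta>, of "2 * \<eta>"] by (simp add: power2_eq_square)
    finally show "exp (2 * \<eta>) \<le> 1 + 4 * \<eta>" by simp
  qed
  also have "\<dots> \<le> sphere_gibbs v H + 4 * \<eta> * b"
    using mult_left_mono[OF Hv, of "4 * \<eta>"] \<eta>0 by (simp add: distrib_right)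
  finally have 1: "sphere_gibbs u H \<le> sphere_gibbs v H + 4 * \<eta> * b" .
  have eq: "(\<lambda>q. H q + G q0) = G" by (simp add: H_def)
  have "sphere_gibbs u G \<le> sphere_gibbs v G + 4 * \<eta> * b"
    using 1 shift[OF Hc cont(1), of "G q0"] shift[OF Hc cont(2), of "G q0"] unfolding eq by simp
  moreover have "F q \<le> G q + a" for q using FG[of q] by linarith
  then have "sphere_gibbs u F \<le> sphere_gibbs u (\<lambda>q. G q + a)"
    by (intro mono cont continuous_intros)
  then have "sphere_gibbs u F \<le> sphere_gibbs u G + a" by (simp add: shift cont)
  ultimately show ?thesis by linarith
qed

text \<open>\<open>d\<close> is any majorant of the oscillations at the single sites rather than the
  exact suprema, so that it can be updated by an explicit formula.\<close>

definition osc_le :: "('g config \<Rightarrow> real) \<Rightarrow> ('g \<Rightarrow> real) \<Rightarrow> bool"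
  where "osc_le f d \<longleftrightarrow> (\<forall>y \<sigma> p. \<bar>f (\<sigma>(y := p)) - f \<sigma>\<bar> \<le> d y)"

lemma osc_le_nonneg: "osc_le f d \<Longrightarrow> 0 \<le> d y"
  by (meson abs_ge_zero order_trans osc_le_def)

text \<open>Dobrushin's one-step estimate. Changing the spin at y acts twice: on f directly, by
  \<open>d y\<close>, and on the distribution of the spin at x, by an energy change of at most
  \<open>\<eta> y\<close>, against which f varies by \<open>d x\<close>.\<close>

lemma osc_le_gibbs_kernel:
  assumes "continuous_on UNIV U" "continuous_on UNIV f" "osc_le U \<eta>" "osc_le f d" "\<And>y. 2 * \<eta> y \<le> 1"
  shows "osc_le (gibbs_kernel x U f) (\<lambda>y. if y = x then 0 else d y + 4 * \<eta> y * d x)"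
  unfolding osc_le_def
proof (intro allI)
  fix y \<sigma> p
  show "\<bar>gibbs_kernel x U f (\<sigma>(y := p)) - gibbs_kernel x U f \<sigma>\<bar> \<le> (if y = x then 0 else d y + 4 * \<eta> y * d x)"
  proof (cases "y = x")
    case False
    then have tw: "\<sigma>(y := p, x := q) = \<sigma>(x := q, y := p)" for q by (rule fun_upd_twist)
    have o: "\<bar>g (\<sigma>(y := p, x := q)) - g (\<sigma>(x := q))\<bar> \<le> b y" "\<bar>g (\<tau>(x := q)) - g (\<tau>(x := q'))\<bar> \<le> b x"
      if "osc_le g b" for g b q q' \<tau>
      using that[unfolded osc_le_def, rule_format, of "\<sigma>(x := q)" y p]
        that[unfolded osc_le_def, rule_format, of "\<tau>(x := q')" x q] by (simp_all add: tw)
    note c = continuous_on_site_update[OF assms(1)] continuous_on_site_update[OF assms(2)]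
    have "gibbs_kernel x U f (\<sigma>(y := p)) - gibbs_kernel x U f \<sigma> \<le> d y + 4 * \<eta> y * d x"
      unfolding gibbs_kernel_eq
      by (rule sphere_gibbs_diff_le) (use o[OF assms(3)] o[OF assms(4)] assms(5) in \<open>auto intro: c\<close>)
    moreover have "gibbs_kernel x U f \<sigma> - gibbs_kernel x U f (\<sigma>(y := p)) \<le> d y + 4 * \<eta> y * d x"
      unfolding gibbs_kernel_eq
      by (rule sphere_gibbs_diff_le)
        (use o[OF assms(3)] o[OF assms(4)] assms(5) in \<open>auto intro: c simp: abs_minus_commute\<close>)
    ultimately show ?thesis using False by (simp add: abs_le_iff)
  qed simp
qed

text \<open>Changing \<sigma> into \<tau> one site at a time bounds the difference when finitely
  many sites change. The modified configurations \<open>g S\<close> converge to \<tau> in the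
  product topology, and f is continuous.\<close>

lemma osc_le_sum_bound:
  fixes f :: "'g config \<Rightarrow> real"
  assumes f: "continuous_on UNIV f" and d: "osc_le f d" "(d has_sum s) UNIV"
  shows "\<bar>f \<sigma> - f \<tau>\<bar> \<le> s"
proof -
  define g where "g S = (\<lambda>x. if x \<in> S then \<tau> x else \<sigma> x)" for S
  have "\<bar>f (g S) - f \<sigma>\<bar> \<le> sum d S" if "finite S" for S
    using that
  proof (induction S rule: finite_induct)
    case empty then show ?case by (simp add: g_def)
  next
    case (insert x S)
    have "g (insert x S) = (g S)(x := \<tau> x)" by (auto simp: g_def)
    then have "\<bar>f (g (insert x S)) - f (g S)\<bar> \<le> d x"
      using d(1) by (simp add: osc_le_def)
    then show ?case using insert by simp
  qed
  moreover have "sum d S \<le> s" if "finite S" for S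
    by (rule finite_sum_le_has_sum[OF d(2)]) (use that osc_le_nonneg[OF d(1)] in auto)
  ultimately have le: "\<bar>f (g S) - f \<sigma>\<bar> \<le> s" if "finite S" for S
    using that by (meson order_trans)
  have "(g \<longlongrightarrow> \<tau>) (finite_subsets_at_top UNIV)"
  proof -
    have "limitin (product_topology (\<lambda>_. euclidean) UNIV) g \<tau> (finite_subsets_at_top UNIV)"
      unfolding limitin_componentwise
    proof (intro conjI ballI)
      fix x :: 'g
      have "eventually (\<lambda>S. g S x = \<tau> x) (finite_subsets_at_top UNIV)"
        unfolding eventually_finite_subsets_at_top by (rule exI[of _ "{x}"]) (auto simp: g_def)
      then show "limitin euclidean (\<lambda>S. g S x) (\<tau> x) (finite_subsets_at_top UNIV)"
        unfolding limitin_canonical_iff by (rule tendsto_eventually)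
    qed auto
    then show ?thesis by (simp add: euclidean_product_topology)
  qed
  then have "((\<lambda>S. f (g S)) \<longlongrightarrow> f \<tau>) (finite_subsets_at_top UNIV)"
    using f by (simp add: continuous_on_def filterlim_compose continuous_on_tendsto_compose[OF f])
  then have "((\<lambda>S. \<bar>f (g S) - f \<sigma>\<bar>) \<longlongrightarrow> \<bar>f \<tau> - f \<sigma>\<bar>) (finite_subsets_at_top UNIV)"
    by (intro tendsto_intros)
  then have "\<bar>f \<tau> - f \<sigma>\<bar> \<le> s"
    by (rule tendsto_upperbound) (auto intro!: eventually_finite_subsets_at_top_weakI le)
  then show ?thesis by (simp add: abs_minus_commute)
qed

text \<open>Resampling the sites of \<open>S\<close> one after the other, each oscillation \<open>d x\<close> is traded for
  oscillations at other sites that add up to at most \<open>c d x\<close>.\<close>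

lemma dobrushin_sweep:
  fixes \<Delta> :: "('g config \<Rightarrow> real) \<Rightarrow> real"
  assumes inv: "\<And>x f. continuous_on UNIV f \<Longrightarrow> \<Delta> f = \<Delta> (gibbs_kernel x (U x) f)"
    and U: "\<And>x. continuous_on UNIV (U x)" "\<And>x. osc_le (U x) (\<eta> x)" "\<And>x y. 2 * \<eta> x y \<le> 1"
    and h: "\<And>x. (\<eta> x has_sum h x) UNIV" "\<And>x. 4 * h x \<le> c" "c \<le> 1"
    and K: "K \<ge> 0"
      "\<And>f d s. continuous_on UNIV f \<Longrightarrow> osc_le f d \<Longrightarrow> (d has_sum s) UNIV \<Longrightarrow> \<bar>\<Delta> f\<bar> \<le> K * s"
    and "finite S" and f: "continuous_on UNIV f" "osc_le f d" "(d has_sum s) UNIV"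
  shows "\<bar>\<Delta> f\<bar> \<le> K * (s - (1 - c) * sum d S)"
  using \<open>finite S\<close> f
proof (induction S arbitrary: f d s rule: finite_induct)
  case empty
  then show ?case using K(2) by simp
next
  case (insert x S)
  let ?d = "\<lambda>y. if y = x then 0 else d y + 4 * \<eta> x y * d x"
  \<comment> \<open>The sum of the updated bounds: every site gains 4 \<open>\<eta> x y\<close>
    \<open>d x\<close>, and the whole entry at x is taken out again, because the kernel no longer
    depends on that spin.\<close>
  let ?s = "(s + 4 * h x * d x) + (- (d x + 4 * \<eta> x x * d x))"
  have dx: "d x \<ge> 0" and \<eta>0: "\<eta> x y \<ge> 0" for y
    by (rule osc_le_nonneg[OF insert.prems(2)], rule osc_le_nonneg[OF U(2)])
  have "((\<lambda>y. (d y + 4 * \<eta> x y * d x) + (if y = x then - (d x + 4 * \<eta> x x * d x) else 0)) has_sum ?s) UNIV"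
    by (rule has_sum_add[OF has_sum_add[OF insert.prems(3)
            has_sum_cmult_left[OF has_sum_cmult_right[OF h(1)]]]])
      (rule has_sum_finite_neutralI[of "{x}"], simp_all)
  also have "(\<lambda>y. (d y + 4 * \<eta> x y * d x) + (if y = x then - (d x + 4 * \<eta> x x * d x) else 0)) = ?d"
    by auto
  finally have hs: "(?d has_sum ?s) UNIV" .
  have "\<bar>\<Delta> f\<bar> = \<bar>\<Delta> (gibbs_kernel x (U x) f)\<bar>" using inv[OF insert.prems(1)] by metis
  also have "\<dots> \<le> K * (?s - (1 - c) * sum ?d S)"
    by (rule insert.IH[OF gibbs_kernel_continuous[OF U(1) insert.prems(1)]
          osc_le_gibbs_kernel[OF U(1) insert.prems(1) U(2) insert.prems(2) U(3)] hs])
  also have "\<dots> \<le> K * (s - (1 - c) * sum d (insert x S))"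
  proof (rule mult_left_mono[OF _ K(1)])
    \<comment> \<open>The bounds at the sites still to be resampled can only have grown, so the gain
      promised by the induction hypothesis is at least the one computed from the original d.\<close>
    have "sum d S \<le> sum ?d S"
      using insert.hyps \<eta>0 dx by (intro sum_mono) auto
    then have "(1 - c) * sum d S \<le> (1 - c) * sum ?d S" using h(3) by (simp add: mult_left_mono)
    moreover have "4 * h x * d x \<le> c * d x" using h(2) dx by (simp add: mult_right_mono)
    moreover have "0 \<le> 4 * \<eta> x x * d x" using \<eta>0 dx by simp
    moreover have "(1 - c) * sum d (insert x S) = (d x - c * d x) + (1 - c) * sum d S"
      using insert.hyps by (simp add: algebra_simps)
    ultimately show "?s - (1 - c) * sum ?d S \<le> s - (1 - c) * sum d (insert x S)" by linarith
  qed
  finally show ?case .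
qed

text \<open>Letting the resampled set exhaust the lattice turns the a priori bound K s into K c s,
  for all functions of summable oscillation at once. This is again a bound of the assumed form, so
  iteration gives K c^n s, which tends to 0.\<close>

lemma dobrushin_contraction:
  fixes \<Delta> :: "('g config \<Rightarrow> real) \<Rightarrow> real"
  assumes inv: "\<And>x f. continuous_on UNIV f \<Longrightarrow> \<Delta> f = \<Delta> (gibbs_kernel x (U x) f)"
    and U: "\<And>x. continuous_on UNIV (U x)" "\<And>x. osc_le (U x) (\<eta> x)" "\<And>x y. 2 * \<eta> x y \<le> 1"
    and h: "\<And>x. (\<eta> x has_sum h x) UNIV" "\<And>x. 4 * h x \<le> c" "c < 1"
    and K: "K \<ge> 0"
      "\<And>f d s. continuous_on UNIV f \<Longrightarrow> osc_le f d \<Longrightarrow> (d has_sum s) UNIV \<Longrightarrow> \<bar>\<Delta> f\<bar> \<le> K * s"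
    and f: "continuous_on UNIV f" "osc_le f d" "(d has_sum s) UNIV"
  shows "\<Delta> f = 0"
proof -
  have c0: "c \<ge> 0"
  proof -
    have "0 \<le> h undefined"
      by (rule has_sum_nonneg[OF h(1)]) (use osc_le_nonneg[OF U(2)] in auto)
    then show ?thesis using h(2)[of undefined] by linarith
  qed
  have step: "\<bar>\<Delta> f\<bar> \<le> (K * c) * s"
    if K: "K \<ge> 0"
      "\<And>f d s. continuous_on UNIV f \<Longrightarrow> osc_le f d \<Longrightarrow> (d has_sum s) UNIV \<Longrightarrow> \<bar>\<Delta> f\<bar> \<le> K * s"
    and f: "continuous_on UNIV f" "osc_le f d" "(d has_sum s) UNIV" for K f d s
  proof -
    have "((\<lambda>S. K * (s - (1 - c) * sum d S)) \<longlongrightarrow> K * (s - (1 - c) * s)) (finite_subsets_at_top UNIV)"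
      by (intro tendsto_intros) (use f(3) in \<open>simp add: has_sum_def\<close>)
    then have "\<bar>\<Delta> f\<bar> \<le> K * (s - (1 - c) * s)"
    proof (rule tendsto_lowerbound)
      show "\<forall>\<^sub>F S in finite_subsets_at_top UNIV. \<bar>\<Delta> f\<bar> \<le> K * (s - (1 - c) * sum d S)"
      proof (rule eventually_finite_subsets_at_top_weakI)
        fix S :: "'g set" assume "finite S"
        with h(3) show "\<bar>\<Delta> f\<bar> \<le> K * (s - (1 - c) * sum d S)"
          by (intro dobrushin_sweep[where \<eta>=\<eta> and h=h and U=U] inv U h K f) auto
      qed
    qed simp
    then show ?thesis by (simp add: algebra_simps)
  qed
  have iter: "\<forall>f d s. continuous_on UNIV f \<longrightarrow> osc_le f d \<longrightarrow> (d has_sum s) UNIV \<longrightarrow> \<bar>\<Delta> f\<bar> \<le> (K * c ^ n) * s" for n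
  proof (induction n)
    case 0 then show ?case using K by simp
  next
    case (Suc n)
    show ?case
    proof (intro allI impI)
      fix f :: "'g config \<Rightarrow> real" and d s
      assume "continuous_on UNIV f" "osc_le f d" "(d has_sum s) UNIV"
      then have "\<bar>\<Delta> f\<bar> \<le> ((K * c ^ n) * c) * s"
        using Suc.IH K(1) c0 by (intro step) auto
      then show "\<bar>\<Delta> f\<bar> \<le> (K * c ^ Suc n) * s" by (simp add: mult.assoc mult.commute[of c])
    qed
  qed
  have "(\<lambda>n. (K * c ^ n) * s) \<longlonglongrightarrow> (K * 0) * s"
    by (intro tendsto_intros LIMSEQ_power_zero) (use c0 h(3) in auto)
  then have "\<bar>\<Delta> f\<bar> \<le> (K * 0) * s"
    by (rule LIMSEQ_le_const) (use iter f in blast)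
  then show ?thesis by simp
qed

lemma poly_fun_depends_only_on:
  assumes "poly_fun p"
  shows "\<exists>\<Lambda>. finite \<Lambda> \<and> depends_only_on \<Lambda> p"
  using assms
proof induction
  case (const c)
  show ?case by (rule exI[of _ "{}"]) (simp add: depends_only_on_def)
next
  case (coord x i)
  show ?case by (rule exI[of _ "{x}"]) (simp add: depends_only_on_def coord_def)
next
  case (add f g)
  then obtain A B where "finite A" "depends_only_on A f" "finite B" "depends_only_on B g" by blast
  then show ?case
    by (intro exI[of _ "A \<union> B"]) (simp add: depends_only_on_def, metis UnI1 UnI2)
next
  case (mult f g)
  then obtain A B where "finite A" "depends_only_on A f" "finite B" "depends_only_on B g" by blast
  then show ?case
    by (intro exI[of _ "A \<union> B"]) (simp add: depends_only_on_def, metis UnI1 UnI2)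
qed

lemma poly_fun_osc_le:
  assumes "poly_fun p"
  shows "\<exists>d s. osc_le p d \<and> (d has_sum s) UNIV"
proof -
  obtain A where A: "finite A" "depends_only_on A p" using poly_fun_depends_only_on[OF assms] by blast
  obtain B where B: "\<And>\<sigma>. norm (p \<sigma>) \<le> B"
    using bounded_continuous_config[OF poly_fun_continuous[OF assms]] by metis
  have "\<bar>p (\<sigma>(y := q)) - p \<sigma>\<bar> \<le> (if y \<in> A then 2 * B else 0)" for \<sigma> y q
  proof (cases "y \<in> A")
    case True
    then show ?thesis using B[of \<sigma>] B[of "\<sigma>(y := q)"] by (simp add: abs_le_iff)
  next
    case False
    then have "p (\<sigma>(y := q)) = p \<sigma>"
      by (intro A(2)[unfolded depends_only_on_def, rule_format]) auto
    then show ?thesis using False by simp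
  qed
  then have "osc_le p (\<lambda>y. if y \<in> A then 2 * B else 0)" by (simp add: osc_le_def)
  moreover have "((\<lambda>y. if y \<in> A then 2 * B else 0) has_sum (\<Sum>y\<in>A. if y \<in> A then 2 * B else 0)) UNIV"
    by (rule has_sum_finite_neutralI[OF A(1)]) auto
  ultimately show ?thesis by blast
qed

text \<open>Each state lies within the total oscillation of f from one value of f, so the difference
  of the two starts the contraction with K = 2. Polynomial functions have summable oscillation;
  density covers the remaining continuous functions.\<close>

lemma dobrushin_uniqueness:
  fixes \<rho>1 \<rho>2 :: "('g::countable config \<Rightarrow> real) \<Rightarrow> real"
  assumes st: "config_state \<rho>1" "config_state \<rho>2"
    and inv: "\<And>x f. continuous_on UNIV f \<Longrightarrow> \<rho>1 f = \<rho>1 (gibbs_kernel x (U x) f)"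
      "\<And>x f. continuous_on UNIV f \<Longrightarrow> \<rho>2 f = \<rho>2 (gibbs_kernel x (U x) f)"
    and U: "\<And>x. continuous_on UNIV (U x)" "\<And>x. osc_le (U x) (\<eta> x)" "\<And>x y. 2 * \<eta> x y \<le> 1"
    and h: "\<And>x. (\<eta> x has_sum h x) UNIV" "\<And>x. 4 * h x \<le> c" "c < 1"
    and f: "continuous_on UNIV f"
  shows "\<rho>1 f = \<rho>2 f"
proof -
  interpret r1: config_state \<rho>1 by fact
  interpret r2: config_state \<rho>2 by fact
  define \<Delta> where "\<Delta> f = \<rho>1 f - \<rho>2 f" for f
  have bound: "\<bar>\<Delta> f\<bar> \<le> 2 * s"
    if f: "continuous_on UNIV f" "osc_le f d" "(d has_sum s) UNIV" for f d s
  proof -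
    define \<tau> :: "'g config" where "\<tau> = undefined"
    have "\<bar>f \<sigma> - f \<tau>\<bar> \<le> s" for \<sigma> by (rule osc_le_sum_bound[OF f])
    then have "\<bar>\<rho>1 f - \<rho>1 (\<lambda>_. f \<tau>)\<bar> \<le> s" "\<bar>\<rho>2 f - \<rho>2 (\<lambda>_. f \<tau>)\<bar> \<le> s"
      by (auto intro!: r1.abs_diff_le r2.abs_diff_le f)
    then show ?thesis by (simp add: \<Delta>_def r1.const r2.const)
  qed
  have "\<Delta> f = 0"
  proof (rule r1.eq_if_eq_on_poly_fun[where T = \<Delta> and C = 2])
    fix p :: "'g config \<Rightarrow> real" assume p: "poly_fun p"
    then obtain d s where "osc_le p d" "(d has_sum s) UNIV" using poly_fun_osc_le by blast
    with p show "\<Delta> p = 0"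
      using inv by (intro dobrushin_contraction[where \<eta>=\<eta> and h=h and U=U and K=2 and c=c] U h bound
          poly_fun_continuous[OF p]) (auto simp: \<Delta>_def)
  next
    fix f g :: "'g config \<Rightarrow> real" and B
    assume "continuous_on UNIV f" "continuous_on UNIV g" "\<And>\<sigma>. \<bar>f \<sigma> - g \<sigma>\<bar> \<le> B"
    then have "\<bar>\<rho>1 f - \<rho>1 g\<bar> \<le> B" "\<bar>\<rho>2 f - \<rho>2 g\<bar> \<le> B"
      by (auto intro: r1.abs_diff_le r2.abs_diff_le)
    then show "\<bar>\<Delta> f - \<Delta> g\<bar> \<le> 2 * B" by (simp add: \<Delta>_def)
  qed (rule f)
  then show ?thesis by (simp add: \<Delta>_def)
qed

section \<open>Interactions\<close>

lemma Ck_mono: "Ck k \<Lambda> f \<Longrightarrow> j \<le> k \<Longrightarrow> Ck j \<Lambda> f"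
  by (fastforce simp: Ck_def field_words_def)

lemma depends_only_onD: "depends_only_on \<Lambda> f \<Longrightarrow> x \<notin> \<Lambda> \<Longrightarrow> f (\<sigma>(x := p)) = f \<sigma>"
  unfolding depends_only_on_def by (metis fun_upd_other)

lemma Ck_has_rot_deriv:
  assumes "Ck k \<Lambda> f" "(x, i) # w \<in> field_words k \<Lambda>"
  shows "has_rot_deriv x i (apply_word w f) (rot_field x i (apply_word w f))"
    "continuous_on UNIV (rot_field x i (apply_word w f))"
proof -
  show "has_rot_deriv x i (apply_word w f) (rot_field x i (apply_word w f))"
    unfolding has_rot_deriv_def rot_field_def
    using assms by (auto simp: Ck_def vector_derivative_works)
  have "continuous_on UNIV (apply_word ((x, i) # w) f)"
    using assms unfolding Ck_def by blast
  then show "continuous_on UNIV (rot_field x i (apply_word w f))" by simp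
qed

lemma Ck_continuous:
  assumes "Ck k \<Lambda> f"
  shows "continuous_on UNIV f"
proof -
  have "continuous_on UNIV (apply_word [] f)"
    using assms unfolding Ck_def field_words_def by fastforce
  then show ?thesis by simp
qed

lemma c1_at_indep:
  assumes "continuous_on UNIV f" "\<And>\<sigma> p. f (\<sigma>(x := p)) = f \<sigma>"
  shows "c1_at x f"
  by (rule c1_atI[OF assms(1) continuous_on_const has_rot_deriv_indep[OF assms(2)]])

lemma Ck_c1_at:
  assumes "Ck (Suc k) \<Lambda> f"
  shows "c1_at x f"
proof (cases "x \<in> \<Lambda>")
  case True
  then have "[(x, i)] \<in> field_words (Suc k) \<Lambda>" for i by (simp add: field_words_def)
  from Ck_has_rot_deriv[OF assms this] show ?thesis
    using Ck_continuous[OF assms] by (simp add: c1_at_def)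
next
  case False
  with assms show ?thesis
    by (intro c1_at_indep Ck_continuous[OF assms] depends_only_onD) (auto simp: Ck_def)
qed

lemma rot_field_indep: "(\<And>\<sigma> p. f (\<sigma>(x := p)) = f \<sigma>) \<Longrightarrow> rot_field x i f = (\<lambda>_. 0)"
  by (rule rot_field_eq[OF has_rot_deriv_indep])

lemma has_rot_deriv_of_real:
  "has_rot_deriv x i f f' \<Longrightarrow> has_rot_deriv x i (cplx f) (cplx f')"
  by (rule has_rot_deriv_linear[OF bounded_linear_of_real])

lemma c1_at_of_real:
  assumes "c1_at x f"
  shows "c1_at x (cplx f)"
    "rot_field x i (cplx f) \<sigma> = complex_of_real (rot_field x i f \<sigma>)"
proof -
  have *: "has_rot_deriv x i (cplx f) (\<lambda>\<sigma>. complex_of_real (rot_field x i f \<sigma>))" for i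
    using assms by (intro has_rot_deriv_of_real) (simp add: c1_at_def)
  show "c1_at x (cplx f)"
    by (rule c1_atI[OF _ _ *]) (use assms in \<open>auto intro!: continuous_intros simp: c1_at_def\<close>)
  show "rot_field x i (cplx f) \<sigma> = complex_of_real (rot_field x i f \<sigma>)"
    by (simp add: rot_field_eq[OF *])
qed

lemma poly_fun_apply_word:
  assumes "poly_fun p"
  shows "\<exists>q. poly_fun q \<and> apply_word w (cplx p) = (cplx q)"
proof (induction w)
  case Nil
  then show ?case using assms by (intro exI[of _ p]) simp
next
  case (Cons xi w)
  obtain x i where xi: "xi = (x, i)" by fastforce
  from Cons obtain q where q: "poly_fun q"
    "apply_word w (cplx p) = (cplx q)" by blast
  obtain q' where q': "poly_fun q'" "has_rot_deriv x i q q'"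
    using poly_fun_has_rot_deriv[OF q(1)] by blast
  then show ?case
    by (intro exI[of _ q']) (simp add: xi q(2) rot_field_eq[OF has_rot_deriv_of_real])
qed

lemma poly_fun_Csmooth:
  assumes "poly_fun p" "depends_only_on \<Lambda> p"
  shows "Csmooth \<Lambda> (cplx p)"
  unfolding Csmooth_def Ck_def
proof (intro allI conjI ballI impI)
  show "depends_only_on \<Lambda> (cplx p)"
    using assms(2) unfolding depends_only_on_def by metis
  fix w
  obtain q where q: "poly_fun q" "apply_word w (cplx p) = (cplx q)"
    using poly_fun_apply_word[OF assms(1)] by blast
  show "continuous_on UNIV (apply_word w (cplx p))"
    unfolding q(2) by (intro continuous_on_of_real poly_fun_continuous q(1))
  fix x i \<sigma>
  obtain q' where q': "has_rot_deriv x i q q'"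
    using poly_fun_has_rot_deriv[OF q(1)] by blast
  show "(\<lambda>t. apply_word w (cplx p) (rotation_curve x i \<sigma> t)) differentiable at 0"
    using has_rot_deriv_of_real[OF q'] unfolding q(2) has_rot_deriv_def
    by (blast intro: differentiableI_vector)
qed

lemma site_poisson_indep:
  "(\<And>\<sigma> p. f (\<sigma>(x := p)) = f \<sigma>) \<Longrightarrow> site_poisson x f g \<sigma> = 0"
  by (simp add: site_poisson_def rot_field_indep complex_cross3_def sum_3)

text \<open>Only sites on which the first argument depends contribute, which makes the bracket
  independent of the chosen ambient volume M.\<close>

lemma poisson_eq_sum_support:
  assumes "finite M" "\<Lambda> \<subseteq> M" "depends_only_on \<Lambda> f" "\<And>x. c1_at x f" "\<And>x. c1_at x g"
  shows "poisson M f g \<sigma> = (\<Sum>x\<in>\<Lambda>. site_poisson x f g \<sigma>)"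
proof -
  have "(\<Sum>x\<in>M. site_poisson x f g \<sigma>) = (\<Sum>x\<in>\<Lambda>. site_poisson x f g \<sigma>)"
    using assms(1-3) by (intro sum.mono_neutral_right ballI site_poisson_indep depends_only_onD) auto
  then show ?thesis by (simp add: poisson_eq_sum assms)
qed

lemma site_poisson_continuous:
  assumes "c1_at x f" "c1_at x g"
  shows "continuous_on UNIV (site_poisson x f g)"
proof -
  have "continuous_on UNIV (rot_field x i f)" "continuous_on UNIV (rot_field x i g)" for i
    using assms by (auto simp: c1_at_def)
  then show ?thesis
    unfolding site_poisson_def[abs_def] complex_cross3_def sum_3 vector_3 vec_lambda_beta
    by (intro continuous_on_add continuous_on_diff continuous_on_mult continuous_on_of_real
        continuous_on_coord continuous_on_const)
qed

text \<open>12 = 2 \<cdot> 3 \<cdot> 2: the prefactor of the bracket, three components, two products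
  in each; the coordinates are at most 1 in modulus.\<close>

lemma norm_site_poisson_le:
  assumes "\<And>i. norm (rot_field x i f \<sigma>) \<le> A" "\<And>i. norm (rot_field x i g \<sigma>) \<le> B"
  shows "norm (site_poisson x f g \<sigma>) \<le> 12 * A * B"
proof -
  have A: "0 \<le> A" using assms(1)[of 1] norm_ge_zero order_trans by blast
  have m: "norm (rot_field x i f \<sigma> * rot_field x j g \<sigma>) \<le> A * B" for i j
    unfolding norm_mult by (rule mult_mono[OF assms A norm_ge_zero])
  have d: "norm (rot_field x i f \<sigma> * rot_field x j g \<sigma> - rot_field x k f \<sigma> * rot_field x l g \<sigma>) \<le> 2 * (A * B)"
    for i j k l
    using norm_triangle_ineq4[of "rot_field x i f \<sigma> * rot_field x j g \<sigma>" "rot_field x k f \<sigma> * rot_field x l g \<sigma>"]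
      m[of i j] m[of k l] by linarith
  have "norm (complex_of_real (coord x j \<sigma>)) \<le> 1" for j
    using component_le_norm_cart[of "vec_of_s2 (\<sigma> x)" j] by (simp add: coord_def)
  then have t: "norm (complex_of_real (coord x j \<sigma>) * z) \<le> 2 * (A * B)" if "norm z \<le> 2 * (A * B)" for j z
    using mult_mono[of "norm (complex_of_real (coord x j \<sigma>))" 1 "norm z" "2 * (A * B)"] that
    by (simp add: norm_mult)
  show ?thesis
    unfolding site_poisson_def norm_mult sum_3 complex_cross3_def vector_3 vec_lambda_beta
    using norm_triangle_mono[OF norm_triangle_mono[OF t[OF d] t[OF d]] t[OF d]]
    by (simp add: mult.assoc)
qed

text \<open>The vector of rotation derivatives is \<sigma>_x \<times> \<nabla>f, hence orthogonal to
  \<sigma>_x.\<close>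

lemma rot_field_tangential:
  assumes "c1_at x f"
  shows "(\<Sum>i\<in>UNIV. of_real (coord x i \<sigma>) * rot_field x i f \<sigma>) = (0::complex)"
  unfolding rot_field_site_gradient[OF assms] coord_def
  by (simp add: sum_3 cross3_def axis_def vector_def algebra_simps)

text \<open>The j-th coordinate generates the rotations about the j-th axis: 2 \<sigma> \<cdot> (e_j
  \<times> \<nabla>f) = - 2 (e_j \<times> \<sigma>) \<cdot> \<nabla>f. In terms of rotation
  derivatives the computation uses |\<sigma>_x| = 1 and \<open>rot_field_tangential\<close>.\<close>

lemma site_poisson_coord:
  assumes "c1_at x f"
  shows "site_poisson x (\<lambda>\<sigma>. complex_of_real (coord x j \<sigma>)) f \<sigma> = - 2 * rot_field x j f \<sigma>"
proof -
  have rf: "rot_field x i (\<lambda>\<sigma>. complex_of_real (coord x j \<sigma>)) \<sigma> =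
      complex_of_real (cross3 (axis i 1) (vec_of_s2 (\<sigma> x)) $ j)" for i
    using rot_field_eq[OF has_rot_deriv_of_real[OF has_rot_deriv_coord[of x i x j]]] by simp
  define v1 v2 v3 where "v1 = complex_of_real (coord x 1 \<sigma>)" "v2 = complex_of_real (coord x 2 \<sigma>)"
    "v3 = complex_of_real (coord x 3 \<sigma>)"
  have "complex_of_real ((coord x 1 \<sigma>)\<^sup>2 + (coord x 2 \<sigma>)\<^sup>2 + (coord x 3 \<sigma>)\<^sup>2) = 1"
    using sum_coord_squared[of x \<sigma>] by (simp add: sum_3)
  then have v: "v1 * v1 + v2 * v2 + v3 * v3 = 1" by (simp add: v1_v2_v3_def power2_eq_square)
  define r1 r2 r3 where "r1 = rot_field x 1 f \<sigma>" "r2 = rot_field x 2 f \<sigma>" "r3 = rot_field x 3 f \<sigma>"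
  have t: "v1 * r1 + v2 * r2 + v3 * r3 = 0"
    using rot_field_tangential[OF assms, of \<sigma>] by (simp add: v1_v2_v3_def r1_r2_r3_def sum_3)
  consider "j = 1" | "j = 2" | "j = 3" using exhaust_3 by blast
  then show ?thesis
  proof cases
    case 1
    have "2 * (v1 * (v3 * r3 + v2 * r2) - v2 * (v2 * r1) - v3 * (v3 * r1)) = - 2 * r1"
      using v t by algebra
    then show ?thesis
      unfolding site_poisson_def sum_3 complex_cross3_def vector_3 vec_lambda_beta rf
      unfolding 1
      by (simp add: cross3_def axis_def vector_def coord_def[symmetric]
          v1_v2_v3_def[symmetric] r1_r2_r3_def[symmetric] algebra_simps)
  next
    case 2
    have "2 * (v2 * (v1 * r1 + v3 * r3) - v1 * (v1 * r2) - v3 * (v3 * r2)) = - 2 * r2"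
      using v t by algebra
    then show ?thesis
      unfolding site_poisson_def sum_3 complex_cross3_def vector_3 vec_lambda_beta rf
      unfolding 2
      by (simp add: cross3_def axis_def vector_def coord_def[symmetric]
          v1_v2_v3_def[symmetric] r1_r2_r3_def[symmetric] algebra_simps)
  next
    case 3
    have "2 * (v3 * (v1 * r1 + v2 * r2) - v1 * (v1 * r3) - v2 * (v2 * r3)) = - 2 * r3"
      using v t by algebra
    then show ?thesis
      unfolding site_poisson_def sum_3 complex_cross3_def vector_3 vec_lambda_beta rf
      unfolding 3
      by (simp add: cross3_def axis_def vector_def coord_def[symmetric]
          v1_v2_v3_def[symmetric] r1_r2_r3_def[symmetric] algebra_simps)
  qed
qed

lemma has_sum_diff:
  fixes f g :: "'a \<Rightarrow> real"
  assumes "(f has_sum s) A" "(g has_sum t) A"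
  shows "((\<lambda>x. f x - g x) has_sum (s - t)) A"
  using has_sum_add[OF assms(1) has_sum_uminusI[OF assms(2)]] by simp

lemma has_sum_sum:
  fixes f :: "'i \<Rightarrow> 'a \<Rightarrow> real"
  assumes "\<And>i. i \<in> I \<Longrightarrow> (f i has_sum s i) A"
  shows "((\<lambda>x. \<Sum>i\<in>I. f i x) has_sum (\<Sum>i\<in>I. s i)) A"
  using assms by (induction I rule: infinite_finite_induct) (auto intro: has_sum_add)

text \<open>The setting shared by existence and uniqueness: \<open>n X\<close> dominates an
  interaction and its first rotation derivatives. The weight \<open>card X\<close> counts the sites
  whose influence on x is due to X.\<close>

locale interaction =
  fixes \<phi> :: "'g::countable set \<Rightarrow> 'g config \<Rightarrow> real" and n :: "'g set \<Rightarrow> real"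
  assumes Ck1: "finite X \<Longrightarrow> Ck 1 X (\<phi> X)"
    and bound: "finite X \<Longrightarrow> \<bar>\<phi> X \<sigma>\<bar> \<le> n X"
    and rot_bound: "finite X \<Longrightarrow> \<bar>rot_field x i (\<phi> X) \<sigma>\<bar> \<le> n X"
    and weighted_summable: "(\<lambda>X. real (card X) * n X) summable_on {X. finite X \<and> x \<in> X}"
begin

definition star :: "'g \<Rightarrow> 'g set set" where "star x = {X. finite X \<and> x \<in> X}"

definition energy :: "'g \<Rightarrow> 'g config \<Rightarrow> real"
  where "energy x \<sigma> = (\<Sum>\<^sub>\<infinity>X\<in>star x. \<phi> X \<sigma>)"

definition energy_rot :: "'g \<Rightarrow> 3 \<Rightarrow> 'g config \<Rightarrow> real"
  where "energy_rot x i \<sigma> = (\<Sum>\<^sub>\<infinity>X\<in>star x. rot_field x i (\<phi> X) \<sigma>)"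

lemma n_nonneg: "finite X \<Longrightarrow> 0 \<le> n X"
  using bound abs_ge_zero order_trans by blast

lemma c1_at: "finite X \<Longrightarrow> c1_at x (\<phi> X)"
  by (rule Ck_c1_at[of 0 X]) (use Ck1 in simp)

lemma n_le_weighted: "X \<in> star x \<Longrightarrow> n X \<le> real (card X) * n X"
proof -
  assume "X \<in> star x"
  then have "finite X" "1 \<le> card X" by (auto simp: star_def Suc_le_eq card_gt_0_iff)
  then show ?thesis using mult_right_mono[of 1 "real (card X)" "n X"] n_nonneg by simp
qed

lemma n_summable: "n summable_on star x"
  by (rule summable_on_comparison_test[OF weighted_summable[of x, folded star_def] n_le_weighted])
    (auto simp: star_def n_nonneg)

lemma summable_norm_le:
  fixes f :: "'g set \<Rightarrow> 'b::banach"
  assumes "n summable_on A" "\<And>X. X \<in> A \<Longrightarrow> norm (f X) \<le> C * n X"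
  shows "f summable_on A"
proof -
  have "(\<lambda>X. norm (f X)) summable_on A"
    by (rule summable_on_comparison_test[OF summable_on_cmult_right[OF assms(1), of C]]) (use assms(2) in auto)
  then show ?thesis by (rule abs_summable_summable)
qed

lemma phi_summable: "(\<lambda>X. \<phi> X \<sigma>) summable_on star x"
  and rot_summable: "(\<lambda>X. rot_field x i (\<phi> X) \<sigma>) summable_on star x"
  by (rule summable_norm_le[OF n_summable, of _ _ 1]; auto simp: star_def bound rot_bound)+

lemma uniform_sum_continuous:
  fixes f :: "'g set \<Rightarrow> 'g config \<Rightarrow> real"
  assumes "\<And>X \<sigma>. X \<in> star x \<Longrightarrow> \<bar>f X \<sigma>\<bar> \<le> n X" "\<And>X. X \<in> star x \<Longrightarrow> continuous_on UNIV (f X)"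
  shows "continuous_on UNIV (\<lambda>\<sigma>. \<Sum>\<^sub>\<infinity>X\<in>star x. f X \<sigma>)"
proof (rule uniform_limit_theorem)
  show "uniform_limit UNIV (\<lambda>F \<sigma>. \<Sum>X\<in>F. f X \<sigma>) (\<lambda>\<sigma>. \<Sum>\<^sub>\<infinity>X\<in>star x. f X \<sigma>) (finite_subsets_at_top (star x))"
    by (rule Weierstrass_m_test_general[OF _ n_summable]) (use assms(1) in auto)
  show "\<forall>\<^sub>F F in finite_subsets_at_top (star x). continuous_on UNIV (\<lambda>\<sigma>. \<Sum>X\<in>F. f X \<sigma>)"
    by (rule eventually_finite_subsets_at_top_weakI) (use assms(2) in \<open>auto intro!: continuous_on_sum\<close>)
qed simp

lemma energy_continuous: "continuous_on UNIV (energy x)"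
  and energy_rot_continuous: "continuous_on UNIV (energy_rot x i)"
  unfolding energy_def[abs_def] energy_rot_def[abs_def]
  using c1_at by (intro uniform_sum_continuous; simp add: bound rot_bound star_def c1_at_def)+

text \<open>Bounds the difference quotients of each interaction uniformly in the angle, providing
  the majorant for termwise differentiation.\<close>

lemma phi_rotation_lipschitz:
  assumes "finite X"
  shows "\<bar>\<phi> X (rotation_curve x i \<sigma> t) - \<phi> X \<sigma>\<bar> \<le> n X * \<bar>t\<bar>"
proof -
  have "has_rot_deriv x i (\<phi> X) (rot_field x i (\<phi> X))"
    using c1_at[OF assms] by (simp add: c1_at_def)
  then have "((\<lambda>t. \<phi> X (rotation_curve x i \<sigma> t)) has_field_derivative
      rot_field x i (\<phi> X) (rotation_curve x i \<sigma> u)) (at u)" for u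
    by (simp add: has_real_derivative_iff_has_vector_derivative has_rot_derivD)
  from field_differentiable_bound[of UNIV, OF _ this, of "n X" t 0] show ?thesis
    using rot_bound[OF assms] by simp
qed

text \<open>By the Weierstrass test the series of difference quotients converges uniformly in the
  angle, so its limit at angle 0 may be taken term by term.\<close>

lemma energy_has_rot_deriv: "has_rot_deriv x i (energy x) (energy_rot x i)"
  unfolding has_rot_deriv_def has_real_derivative_iff_has_vector_derivative[symmetric] DERIV_def
proof
  fix \<sigma>
  let ?q = "\<lambda>X t. (\<phi> X (rotation_curve x i \<sigma> t) - \<phi> X \<sigma>) / t"
  have fin: "X \<in> star x \<Longrightarrow> finite X" for X by (simp add: star_def)
  have "((\<lambda>t. \<Sum>\<^sub>\<infinity>X\<in>star x. ?q X t) \<longlongrightarrow> energy_rot x i \<sigma>) (at 0)"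
  proof (rule swap_uniform_limit'[where F = "finite_subsets_at_top (star x)" and S = UNIV])
    show "uniform_limit UNIV (\<lambda>F t. \<Sum>X\<in>F. ?q X t) (\<lambda>t. \<Sum>\<^sub>\<infinity>X\<in>star x. ?q X t) (finite_subsets_at_top (star x))"
    proof (rule Weierstrass_m_test_general[OF _ n_summable])
      fix X t assume "X \<in> star x"
      then show "norm (?q X t) \<le> n X"
        using phi_rotation_lipschitz[OF fin, of X x i \<sigma> t] n_nonneg[OF fin]
        by (cases "t = 0") (auto simp: divide_le_eq)
    qed
    show "\<forall>\<^sub>F F in finite_subsets_at_top (star x).
        ((\<lambda>t. \<Sum>X\<in>F. ?q X t) \<longlongrightarrow> (\<Sum>X\<in>F. rot_field x i (\<phi> X) \<sigma>)) (at 0)"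
    proof (rule eventually_finite_subsets_at_top_weakI, rule tendsto_sum)
      fix F X assume "F \<subseteq> star x" "X \<in> F"
      then have "has_rot_deriv x i (\<phi> X) (rot_field x i (\<phi> X))"
        using c1_at fin by (auto simp: c1_at_def)
      then show "(?q X \<longlongrightarrow> rot_field x i (\<phi> X) \<sigma>) (at 0)"
        by (simp add: has_rot_deriv_def has_real_derivative_iff_has_vector_derivative[symmetric] DERIV_def)
    qed
    show "((\<lambda>F. \<Sum>X\<in>F. rot_field x i (\<phi> X) \<sigma>) \<longlongrightarrow> energy_rot x i \<sigma>) (finite_subsets_at_top (star x))"
      using has_sum_infsum[OF rot_summable] by (simp add: energy_rot_def has_sum_def)
  qed auto
  moreover have "(\<Sum>\<^sub>\<infinity>X\<in>star x. ?q X t) = (energy x (rotation_curve x i \<sigma> t) - energy x \<sigma>) / t" for t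
    unfolding energy_def divide_inverse
    by (rule infsumI, rule has_sum_cmult_left, rule has_sum_diff; rule has_sum_infsum[OF phi_summable])
  ultimately show "((\<lambda>t. (energy x (rotation_curve x i \<sigma> (0 + t)) - energy x (rotation_curve x i \<sigma> 0)) / t)
      \<longlongrightarrow> energy_rot x i \<sigma>) (at 0)" by simp
qed

text \<open>Up to a factor 2, a bound for the influence of the spin at y on the energy at x; only
  sets containing both sites contribute.\<close>

definition coupling :: "'g \<Rightarrow> 'g \<Rightarrow> real"
  where "coupling x y = (\<Sum>\<^sub>\<infinity>X\<in>star x. if y \<in> X then n X else 0)"

definition strength :: "'g \<Rightarrow> real"
  where "strength x = (\<Sum>\<^sub>\<infinity>X\<in>star x. real (card X) * n X)"

lemma coupling_summable: "(\<lambda>X. if y \<in> X then n X else 0) summable_on star x"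
  by (rule summable_on_comparison_test[OF n_summable]) (auto simp: star_def n_nonneg)

lemma coupling_nonneg: "0 \<le> coupling x y"
  unfolding coupling_def by (rule infsum_nonneg) (auto simp: star_def n_nonneg)

text \<open>Double counting: summed over y, every X containing x appears at most once for each of
  its elements.\<close>

lemma sum_coupling_le: "finite Y \<Longrightarrow> sum (coupling x) Y \<le> strength x"
proof -
  assume Y: "finite Y"
  have "sum (coupling x) Y = (\<Sum>\<^sub>\<infinity>X\<in>star x. \<Sum>y\<in>Y. if y \<in> X then n X else 0)"
    unfolding coupling_def by (rule sym, rule infsumI, rule has_sum_sum)
      (rule has_sum_infsum[OF coupling_summable])
  also have "\<dots> \<le> strength x"
    unfolding strength_def
  proof (rule infsum_mono)
    fix X assume X: "X \<in> star x"
    have "(\<Sum>y\<in>Y. if y \<in> X then n X else 0) = real (card (Y \<inter> X)) * n X"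
      using Y by (simp add: sum.If_cases Int_def)
    also have "\<dots> \<le> real (card X) * n X"
      using X n_nonneg by (intro mult_right_mono) (auto simp: star_def card_mono)
    finally show "(\<Sum>y\<in>Y. if y \<in> X then n X else 0) \<le> real (card X) * n X" .
  qed (auto intro: has_sum_imp_summable[OF has_sum_sum[OF has_sum_infsum[OF coupling_summable]]]
      weighted_summable[of x, folded star_def])
  finally show ?thesis .
qed

lemma coupling_has_sum: "\<exists>h. (coupling x has_sum h) UNIV \<and> h \<le> strength x"
proof -
  have "coupling x summable_on UNIV"
    by (rule nonneg_bdd_above_summable_on)
      (auto intro!: bdd_aboveI[of _ "strength x"] simp: coupling_nonneg sum_coupling_le)
  moreover from this have "infsum (coupling x) UNIV \<le> strength x"
    by (rule infsum_le_finite_sums) (rule sum_coupling_le)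
  ultimately show ?thesis by (meson has_sum_infsum)
qed

text \<open>Only interactions containing y change, each by at most twice its sup norm.\<close>

lemma energy_osc: "osc_le (energy x) (\<lambda>y. 2 * coupling x y)"
  unfolding osc_le_def
proof (intro allI)
  fix y \<sigma> p
  have "energy x (\<sigma>(y := p)) - energy x \<sigma> = (\<Sum>\<^sub>\<infinity>X\<in>star x. \<phi> X (\<sigma>(y := p)) - \<phi> X \<sigma>)"
    unfolding energy_def
    by (rule sym, rule infsumI, rule has_sum_diff; rule has_sum_infsum[OF phi_summable])
  also have "norm \<dots> \<le> (\<Sum>\<^sub>\<infinity>X\<in>star x. 2 * (if y \<in> X then n X else 0))"
  proof (rule norm_infsum_le[OF has_sum_infsum has_sum_infsum])
    show "(\<lambda>X. \<phi> X (\<sigma>(y := p)) - \<phi> X \<sigma>) summable_on star x"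
      by (rule has_sum_imp_summable, rule has_sum_diff; rule has_sum_infsum[OF phi_summable])
    show "(\<lambda>X. 2 * (if y \<in> X then n X else 0)) summable_on star x"
      by (intro summable_on_cmult_right coupling_summable)
    fix X assume "X \<in> star x"
    then have X: "finite X" by (simp add: star_def)
    show "norm (\<phi> X (\<sigma>(y := p)) - \<phi> X \<sigma>) \<le> 2 * (if y \<in> X then n X else 0)"
    proof (cases "y \<in> X")
      case True
      then show ?thesis using bound[OF X, of \<sigma>] bound[OF X, of "\<sigma>(y := p)"] by (simp add: abs_le_iff)
    next
      case False
      then show ?thesis using Ck1[OF X] depends_only_onD[of X "\<phi> X" y] by (simp add: Ck_def)
    qed
  qed
  also have "\<dots> = 2 * coupling x y"
    unfolding coupling_def by (rule infsum_cmult_right) (rule coupling_summable)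
  finally show "\<bar>energy x (\<sigma>(y := p)) - energy x \<sigma>\<bar> \<le> 2 * coupling x y" by simp
qed

end

section \<open>Convergence of the derivation in the sup norm\<close>

instance bcontfun :: (metric_space, banach) banach ..

lemma finite_rot_field_bound:
  assumes "finite \<Lambda>" "\<And>x. c1_at x f"
  obtains A where "\<And>x i \<sigma>. x \<in> \<Lambda> \<Longrightarrow> norm (rot_field x i f \<sigma>) \<le> A" "A \<ge> 0"
proof -
  have "\<exists>B. B > 0 \<and> (\<forall>\<sigma>. norm (rot_field x i f \<sigma>) \<le> B)" for x i
    using assms(2)[of x] bounded_continuous_config[of "rot_field x i f"] unfolding c1_at_def by metis
  then obtain B where B: "\<And>x i. B x i > 0" "\<And>x i \<sigma>. norm (rot_field x i f \<sigma>) \<le> B x i"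
    by metis
  have "norm (rot_field x i f \<sigma>) \<le> (\<Sum>x\<in>\<Lambda>. \<Sum>i\<in>UNIV. B x i)" if "x \<in> \<Lambda>" for x i \<sigma>
  proof -
    have "B x i \<le> (\<Sum>i\<in>UNIV. B x i)" by (rule member_le_sum) (auto simp: less_imp_le B)
    also have "\<dots> \<le> (\<Sum>x\<in>\<Lambda>. \<Sum>i\<in>UNIV. B x i)"
      by (rule member_le_sum) (auto intro!: sum_nonneg simp: that less_imp_le B assms)
    finally show ?thesis using B(2)[of x i \<sigma>] by linarith
  qed
  moreover have "(\<Sum>x\<in>\<Lambda>. \<Sum>i\<in>UNIV. B x i) \<ge> 0" by (intro sum_nonneg) (auto simp: less_imp_le B)
  ultimately show ?thesis using that by blast
qed

context interaction begin

definition meeting :: "'g set \<Rightarrow> 'g set set" where "meeting \<Lambda> = {X. finite X \<and> X \<inter> \<Lambda> \<noteq> {}}"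

text \<open>A set that meets \<Lambda> lies in the star of some site of \<Lambda>, so partial sums
  are dominated by the finitely many sums over stars.\<close>

lemma n_summable_meeting:
  assumes "finite \<Lambda>"
  shows "n summable_on meeting \<Lambda>"
proof (rule nonneg_bdd_above_summable_on)
  show "bdd_above (sum n ` {F. F \<subseteq> meeting \<Lambda> \<and> finite F})"
  proof (rule bdd_aboveI)
    fix r assume "r \<in> sum n ` {F. F \<subseteq> meeting \<Lambda> \<and> finite F}"
    then obtain F where F: "F \<subseteq> meeting \<Lambda>" "finite F" "r = sum n F" by auto
    have "sum n F \<le> (\<Sum>X\<in>F. \<Sum>x\<in>\<Lambda>. if x \<in> X then n X else 0)"
    proof (rule sum_mono)
      fix X assume "X \<in> F"
      then obtain x where "x \<in> \<Lambda>" "x \<in> X" "finite X" using F(1) by (auto simp: meeting_def)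
      then show "n X \<le> (\<Sum>x\<in>\<Lambda>. if x \<in> X then n X else 0)"
        using member_le_sum[of x \<Lambda> "\<lambda>x. if x \<in> X then n X else 0"] assms by (simp add: n_nonneg)
    qed
    also have "\<dots> = (\<Sum>x\<in>\<Lambda>. \<Sum>X\<in>F. if x \<in> X then n X else 0)" by (rule sum.swap)
    also have "\<dots> = (\<Sum>x\<in>\<Lambda>. sum n (F \<inter> star x))"
    proof (rule sum.cong[OF refl])
      fix x
      have "F \<inter> star x = {X \<in> F. x \<in> X}" using F(1) by (auto simp: star_def meeting_def)
      then show "(\<Sum>X\<in>F. if x \<in> X then n X else 0) = sum n (F \<inter> star x)"
        by (simp add: sum.inter_filter[OF F(2)])
    qed
    also have "\<dots> \<le> (\<Sum>x\<in>\<Lambda>. infsum n (star x))"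
      using F by (intro sum_mono finite_sum_le_infsum n_summable) (auto simp: star_def n_nonneg)
    finally show "r \<le> (\<Sum>x\<in>\<Lambda>. infsum n (star x))" by (simp add: F)
  qed
qed (auto simp: meeting_def n_nonneg)

definition phi_bracket :: "'g set \<Rightarrow> ('g config \<Rightarrow> complex) \<Rightarrow> 'g set \<Rightarrow> 'g config \<Rightarrow>\<^sub>C complex"
  where "phi_bracket \<Lambda> a X = Bcontfun (poisson (\<Lambda> \<union> X) a (cplx (\<phi> X)))"

lemma derivation_eq: "derivation \<phi> \<Lambda> a = (\<Sum>\<^sub>\<infinity>X\<in>meeting \<Lambda>. phi_bracket \<Lambda> a X)"
  by (simp add: derivation_def meeting_def phi_bracket_def)

lemma apply_phi_bracket:
  assumes "finite \<Lambda>" "depends_only_on \<Lambda> a" "\<And>x. c1_at x a" "finite X"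
  shows "apply_bcontfun (phi_bracket \<Lambda> a X) \<sigma> =
    (\<Sum>x\<in>\<Lambda>. site_poisson x a (cplx (\<phi> X)) \<sigma>)"
proof -
  note c = c1_at_of_real(1)[OF c1_at[OF assms(4)]]
  have eq: "poisson (\<Lambda> \<union> X) a (cplx (\<phi> X)) =
      (\<lambda>\<sigma>. \<Sum>x\<in>\<Lambda>. site_poisson x a (cplx (\<phi> X)) \<sigma>)"
    using assms by (intro ext poisson_eq_sum_support c) auto
  have "continuous_on UNIV (poisson (\<Lambda> \<union> X) a (cplx (\<phi> X)))"
    unfolding eq by (intro continuous_on_sum site_poisson_continuous assms c)
  then show ?thesis by (simp add: phi_bracket_def eq)
qed

lemma phi_bracket_summable:
  assumes "finite \<Lambda>" "depends_only_on \<Lambda> a" "\<And>x. c1_at x a"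
  shows "phi_bracket \<Lambda> a summable_on meeting \<Lambda>"
proof -
  obtain A where A: "\<And>x i \<sigma>. x \<in> \<Lambda> \<Longrightarrow> norm (rot_field x i a \<sigma>) \<le> A" "A \<ge> 0"
    using finite_rot_field_bound[OF assms(1,3)] by metis
  show ?thesis
  proof (rule summable_norm_le[OF n_summable_meeting[OF assms(1)], of _ "real (card \<Lambda>) * (12 * A)"])
    fix X assume "X \<in> meeting \<Lambda>"
    then have X: "finite X" by (simp add: meeting_def)
    show "norm (phi_bracket \<Lambda> a X) \<le> real (card \<Lambda>) * (12 * A) * n X"
    proof (rule norm_bound)
      fix \<sigma>
      have "norm (\<Sum>x\<in>\<Lambda>. site_poisson x a (cplx (\<phi> X)) \<sigma>) \<le> (\<Sum>x\<in>\<Lambda>. 12 * A * n X)"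
        by (intro sum_norm_le norm_site_poisson_le A)
          (simp_all add: c1_at_of_real(2)[OF c1_at[OF X]] rot_bound[OF X])
      then show "norm (apply_bcontfun (phi_bracket \<Lambda> a X) \<sigma>) \<le> real (card \<Lambda>) * (12 * A) * n X"
        by (simp add: apply_phi_bracket[OF assms X])
    qed
  qed
qed

text \<open>The sets meeting {x} are exactly those containing x, and the bracket of a coordinate
  with \<phi>_X is -2 times a rotation derivative; the series becomes that of
  \<open>energy_rot\<close>.\<close>

lemma derivation_coord:
  "apply_bcontfun (derivation \<phi> {x} (cplx (coord x i))) \<sigma> =
    - 2 * complex_of_real (energy_rot x i \<sigma>)"
proof -
  let ?a = "\<lambda>\<sigma>. complex_of_real (coord x i \<sigma>)"
  have dep: "depends_only_on {x} ?a" by (simp add: depends_only_on_def coord_def)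
  have a: "Csmooth {x} ?a"
    by (rule poly_fun_Csmooth[OF poly_fun.coord]) (simp add: depends_only_on_def coord_def)
  then have c1: "c1_at y ?a" for y
    using a unfolding Csmooth_def by (intro Ck_c1_at[of 0 "{x}"]) blast
  \<comment> \<open>Evaluation at \<sigma> is bounded for the sup norm, so the series of functions
    may be summed pointwise.\<close>
  have bl: "bounded_linear (\<lambda>f. apply_bcontfun f \<sigma> :: complex)"
    by (rule bounded_linear_intro[of _ 1]) (auto simp: norm_bounded)
  have m: "meeting {x} = star x" by (auto simp: meeting_def star_def)
  have "((\<lambda>X. apply_bcontfun (phi_bracket {x} ?a X) \<sigma>) has_sum
      apply_bcontfun (derivation \<phi> {x} ?a) \<sigma>) (meeting {x})"
    unfolding derivation_eq
    by (rule has_sum_bounded_linear[OF bl has_sum_infsum[OF phi_bracket_summable]]) (auto simp: dep c1)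
  moreover have "((\<lambda>X. apply_bcontfun (phi_bracket {x} ?a X) \<sigma>) has_sum
      (- 2 * complex_of_real (energy_rot x i \<sigma>))) (meeting {x})"
  proof -
    have "((\<lambda>X. - 2 * complex_of_real (rot_field x i (\<phi> X) \<sigma>)) has_sum
        (- 2 * complex_of_real (energy_rot x i \<sigma>))) (star x)"
      unfolding energy_rot_def
      by (intro has_sum_cmult_right has_sum_bounded_linear[OF bounded_linear_of_real]
          has_sum_infsum rot_summable)
    moreover have "apply_bcontfun (phi_bracket {x} ?a X) \<sigma> = - 2 * complex_of_real (rot_field x i (\<phi> X) \<sigma>)"
      if "X \<in> star x" for X
    proof -
      have X: "finite X" using that by (simp add: star_def)
      show ?thesis
        by (subst apply_phi_bracket[OF _ dep c1 X])
          (simp_all add: site_poisson_coord c1_at_of_real[OF c1_at[OF X]])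
    qed
    ultimately show ?thesis unfolding m by (subst has_sum_cong) auto
  qed
  ultimately show ?thesis by (rule has_sum_unique)
qed

end

section \<open>Complex states and their restrictions to real functions\<close>

lemma apply_plus_bcontfun: "apply_bcontfun (f + g) \<sigma> = apply_bcontfun f \<sigma> + apply_bcontfun g \<sigma>"
  by simp

lemma Bcontfun_add:
  fixes f g :: "'g config \<Rightarrow> complex"
  assumes "continuous_on UNIV f" "continuous_on UNIV g"
  shows "Bcontfun (\<lambda>\<sigma>. f \<sigma> + g \<sigma>) = Bcontfun f + Bcontfun g"
  by (rule bcontfun_eqI) (simp add: assms continuous_on_add)

lemma is_state_add: "is_state \<omega> \<Longrightarrow> \<omega> (f + g) = \<omega> f + \<omega> g"
  and is_state_scale: "is_state \<omega> \<Longrightarrow> \<omega> (Bcontfun (\<lambda>\<sigma>. c * apply_bcontfun f \<sigma>)) = c * \<omega> f"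
  and is_state_nonneg: "is_state \<omega> \<Longrightarrow> (\<And>\<sigma>. apply_bcontfun f \<sigma> \<in> \<real> \<and> 0 \<le> Re (apply_bcontfun f \<sigma>)) \<Longrightarrow>
    \<omega> f \<in> \<real> \<and> 0 \<le> Re (\<omega> f)"
  and is_state_one: "is_state \<omega> \<Longrightarrow> \<omega> (const_bcontfun 1) = 1"
  by (simp_all add: is_state_def)

definition real_part_state :: "(('g config \<Rightarrow>\<^sub>C complex) \<Rightarrow> complex) \<Rightarrow> ('g config \<Rightarrow> real) \<Rightarrow> real"
  where "real_part_state \<omega> f = Re (\<omega> (Bcontfun (cplx f)))"

text \<open>Positivity controls nonnegative functions only. Adding a constant bound B makes f
  nonnegative, and the state takes the value B on the constant; thus no imaginary part is lost in
  \<open>real_part_state\<close>.\<close>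

lemma is_state_of_real:
  assumes "is_state \<omega>" "continuous_on UNIV f"
  shows "\<omega> (Bcontfun (cplx f)) = of_real (real_part_state \<omega> f)"
proof -
  obtain B where "\<And>\<sigma>. norm (f \<sigma>) \<le> B" using bounded_continuous_config[OF assms(2)] by metis
  then have "- f \<sigma> \<le> B" for \<sigma> by (simp add: abs_le_iff)
  then have B: "0 \<le> f \<sigma> + B" for \<sigma> by (smt (verit))
  have c: "continuous_on UNIV (cplx f)" by (intro continuous_intros assms)
  have "\<omega> (Bcontfun (cplx f) + Bcontfun (\<lambda>\<sigma>. complex_of_real B)) \<in> \<real>"
    using is_state_nonneg[OF assms(1), of "Bcontfun (cplx f) + Bcontfun (\<lambda>\<sigma>. complex_of_real B)"] B c
    by simp
  moreover have "Bcontfun (\<lambda>\<sigma>::'a config. complex_of_real B) =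
      Bcontfun (\<lambda>\<sigma>. complex_of_real B * apply_bcontfun (const_bcontfun 1) \<sigma>)"
    by (simp add: const_bcontfun.rep_eq)
  then have "\<omega> (Bcontfun (\<lambda>\<sigma>. complex_of_real B)) = complex_of_real B"
    by (simp only: is_state_scale[OF assms(1)] is_state_one[OF assms(1)] mult_1_right)
  ultimately have "\<omega> (Bcontfun (cplx f)) + complex_of_real B \<in> \<real>"
    by (simp add: is_state_add[OF assms(1)])
  then have "\<omega> (Bcontfun (cplx f)) \<in> \<real>"
    by (metis Reals_diff Reals_of_real add_diff_cancel_right')
  then show ?thesis by (simp add: real_part_state_def)
qed

lemma is_state_decompose:
  assumes "is_state \<omega>"
  shows "\<omega> F = of_real (real_part_state \<omega> (\<lambda>\<sigma>. Re (apply_bcontfun F \<sigma>))) +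
    \<i> * of_real (real_part_state \<omega> (\<lambda>\<sigma>. Im (apply_bcontfun F \<sigma>)))"
proof -
  have c: "continuous_on UNIV (\<lambda>\<sigma>. Re (apply_bcontfun F \<sigma>))" "continuous_on UNIV (\<lambda>\<sigma>. Im (apply_bcontfun F \<sigma>))"
    by (intro continuous_intros continuous_on_apply_bcontfun)+
  then have c': "continuous_on UNIV (\<lambda>\<sigma>. complex_of_real (Re (apply_bcontfun F \<sigma>)))"
    "continuous_on UNIV (\<lambda>\<sigma>. complex_of_real (Im (apply_bcontfun F \<sigma>)))"
    by (auto intro: continuous_on_of_real)
  have "F = Bcontfun (\<lambda>\<sigma>. complex_of_real (Re (apply_bcontfun F \<sigma>))) +
      Bcontfun (\<lambda>\<sigma>. \<i> * apply_bcontfun (Bcontfun (\<lambda>\<sigma>. complex_of_real (Im (apply_bcontfun F \<sigma>)))) \<sigma>)"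
    by (rule bcontfun_eqI) (simp add: c continuous_on_mult continuous_on_const complex_eq)
  then have "\<omega> F = \<omega> (Bcontfun (\<lambda>\<sigma>. complex_of_real (Re (apply_bcontfun F \<sigma>)))) +
      \<i> * \<omega> (Bcontfun (\<lambda>\<sigma>. complex_of_real (Im (apply_bcontfun F \<sigma>))))"
    by (metis is_state_add[OF assms] is_state_scale[OF assms])
  then show ?thesis by (simp only: is_state_of_real[OF assms] c)
qed

lemma config_state_real_part:
  fixes \<omega> :: "('g::countable config \<Rightarrow>\<^sub>C complex) \<Rightarrow> complex"
  assumes "is_state \<omega>"
  shows "config_state (real_part_state \<omega>)"
proof
  fix f g :: "'g config \<Rightarrow> real" and c
  assume f: "continuous_on UNIV f"
  then have fc: "continuous_on UNIV (cplx f)" by (rule continuous_on_of_real)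
  show "0 \<le> real_part_state \<omega> f" if "\<And>\<sigma>. 0 \<le> f \<sigma>"
    unfolding real_part_state_def
    by (rule is_state_nonneg[OF assms, THEN conjunct2]) (simp add: f that)
  have "real_part_state \<omega> (\<lambda>\<sigma>. c * f \<sigma>) =
      Re (\<omega> (Bcontfun (\<lambda>\<sigma>. complex_of_real c * apply_bcontfun (Bcontfun (cplx f)) \<sigma>)))"
    by (simp add: f real_part_state_def)
  then show "real_part_state \<omega> (\<lambda>\<sigma>. c * f \<sigma>) = c * real_part_state \<omega> f"
    by (simp only: is_state_scale[OF assms]) (simp add: real_part_state_def)
  assume g: "continuous_on UNIV g"
  then have gc: "continuous_on UNIV (cplx g)" by (rule continuous_on_of_real)
  show "real_part_state \<omega> (\<lambda>\<sigma>. f \<sigma> + g \<sigma>) = real_part_state \<omega> f + real_part_state \<omega> g"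
    by (simp add: real_part_state_def Bcontfun_add[OF fc gc] is_state_add[OF assms])
next
  have "Bcontfun (\<lambda>\<sigma>::'g config. complex_of_real 1) = const_bcontfun 1"
    by (rule bcontfun_eqI) (simp add: const_bcontfun.rep_eq)
  then show "real_part_state \<omega> (\<lambda>_. 1) = 1"
    using is_state_one[OF assms] by (simp add: real_part_state_def)
qed

section \<open>Uniqueness of the KMS state\<close>

context interaction begin

text \<open>The test function a is the i-th coordinate of the spin at x. Both the bracket and the
  derivation then carry the factor -2, which cancels.\<close>

lemma KMS_poly_fun:
  assumes "classical_KMS \<beta> \<phi> \<omega>" "poly_fun p" "poly_fun p'" "has_rot_deriv x i p p'"
  shows "real_part_state \<omega> p' = real_part_state \<omega> (\<lambda>\<sigma>. p \<sigma> * (\<beta> * energy_rot x i \<sigma>))"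
proof -
  have st: "is_state \<omega>" using assms(1) by (simp add: classical_KMS_def)
  interpret config_state "real_part_state \<omega>" by (rule config_state_real_part[OF st])
  let ?a = "\<lambda>\<sigma>. complex_of_real (coord x i \<sigma>)"
  let ?b = "cplx p"
  obtain \<Lambda> where \<Lambda>: "finite \<Lambda>" "depends_only_on \<Lambda> p"
    using poly_fun_depends_only_on[OF assms(2)] by blast
  have dep: "depends_only_on {x} ?a" by (simp add: depends_only_on_def coord_def)
  have a: "Csmooth {x} ?a"
    by (rule poly_fun_Csmooth[OF poly_fun.coord]) (simp add: depends_only_on_def coord_def)
  have b: "Csmooth \<Lambda> ?b" by (rule poly_fun_Csmooth[OF assms(2) \<Lambda>(2)])
  have c1: "c1_at y ?a" "c1_at y ?b" for y
    using a b unfolding Csmooth_def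
    by (intro Ck_c1_at[of 0 "{x}"], blast, intro Ck_c1_at[of 0 \<Lambda>], blast)
  have "poisson ({x} \<union> \<Lambda>) ?a ?b = (\<lambda>\<sigma>. complex_of_real (- 2 * p' \<sigma>))"
  proof
    fix \<sigma>
    have "poisson ({x} \<union> \<Lambda>) ?a ?b \<sigma> = (\<Sum>y\<in>{x}. site_poisson y ?a ?b \<sigma>)"
      by (rule poisson_eq_sum_support) (auto simp: \<Lambda> dep c1)
    then show "poisson ({x} \<union> \<Lambda>) ?a ?b \<sigma> = complex_of_real (- 2 * p' \<sigma>)"
      by (simp add: site_poisson_coord c1 rot_field_eq[OF has_rot_deriv_of_real[OF assms(4)]])
  qed
  moreover have "(\<lambda>\<sigma>. ?b \<sigma> * apply_bcontfun (derivation \<phi> {x} ?a) \<sigma>) =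
      (\<lambda>\<sigma>. complex_of_real (- 2 * (p \<sigma> * energy_rot x i \<sigma>)))"
    by (simp add: derivation_coord fun_eq_iff)
  moreover have "\<omega> (Bcontfun (poisson ({x} \<union> \<Lambda>) ?a ?b)) =
      of_real \<beta> * \<omega> (Bcontfun (\<lambda>\<sigma>. ?b \<sigma> * apply_bcontfun (derivation \<phi> {x} ?a) \<sigma>))"
    using assms(1) a b \<Lambda>(1) unfolding classical_KMS_def by blast
  ultimately have "real_part_state \<omega> (\<lambda>\<sigma>. - 2 * p' \<sigma>) =
      \<beta> * real_part_state \<omega> (\<lambda>\<sigma>. - 2 * (p \<sigma> * energy_rot x i \<sigma>))"
    by (simp add: real_part_state_def)
  moreover have c: "continuous_on UNIV p'" "continuous_on UNIV (\<lambda>\<sigma>. p \<sigma> * energy_rot x i \<sigma>)"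
    by (intro continuous_on_mult poly_fun_continuous assms energy_rot_continuous)+
  ultimately have "- 2 * real_part_state \<omega> p' = \<beta> * (- 2 * real_part_state \<omega> (\<lambda>\<sigma>. p \<sigma> * energy_rot x i \<sigma>))"
    by (simp only: scale)
  then have "real_part_state \<omega> p' = real_part_state \<omega> (\<lambda>\<sigma>. \<beta> * (p \<sigma> * energy_rot x i \<sigma>))"
    by (simp only: scale[OF c(2)])
  then show ?thesis by (simp add: mult.left_commute)
qed

text \<open>The factor 8 is the 4 of the kernel estimate times the 2 in the oscillation of the
  energy; the sum of the couplings of x is bounded by \<open>strength x\<close>. A state is
  determined by its values on real functions.\<close>

lemma KMS_unique:
  assumes \<beta>: "0 \<le> \<beta>" "\<And>x. 8 * (\<beta> * strength x) \<le> c" "c < 1"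
    and K: "classical_KMS \<beta> \<phi> \<omega>1" "classical_KMS \<beta> \<phi> \<omega>2"
  shows "\<omega>1 = \<omega>2"
proof
  fix F
  have st: "is_state \<omega>1" "is_state \<omega>2" using K by (auto simp: classical_KMS_def)
  define U where "U x \<sigma> = \<beta> * energy x \<sigma>" for x \<sigma>
  have Uc: "continuous_on UNIV (U x)" for x
    unfolding U_def by (intro continuous_on_mult continuous_on_const energy_continuous)
  have Ud: "has_rot_deriv x i (U x) (\<lambda>\<sigma>. \<beta> * energy_rot x i \<sigma>)" for x i
    unfolding U_def by (rule has_rot_deriv_linear[OF bounded_linear_mult_right energy_has_rot_deriv])
  have Wc: "continuous_on UNIV (\<lambda>\<sigma>. \<beta> * energy_rot x i \<sigma>)" for x i
    by (intro continuous_on_mult continuous_on_const energy_rot_continuous)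
  obtain h where h: "\<And>x. (coupling x has_sum h x) UNIV" "\<And>x. h x \<le> strength x"
    using coupling_has_sum by metis
  have osc: "osc_le (U x) (\<lambda>y. \<beta> * (2 * coupling x y))" for x
    unfolding osc_le_def
  proof (intro allI)
    fix y \<sigma> p
    have "\<bar>energy x (\<sigma>(y := p)) - energy x \<sigma>\<bar> \<le> 2 * coupling x y"
      using energy_osc unfolding osc_le_def by blast
    from mult_left_mono[OF this \<beta>(1)] show "\<bar>U x (\<sigma>(y := p)) - U x \<sigma>\<bar> \<le> \<beta> * (2 * coupling x y)"
      using \<beta>(1) by (simp add: U_def abs_mult right_diff_distrib[symmetric])
  qed
  have "coupling x y \<le> strength x" for x y using sum_coupling_le[of "{y}" x] by simp
  then have le: "\<beta> * coupling x y \<le> \<beta> * strength x" for x y by (rule mult_left_mono[OF _ \<beta>(1)])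
  have small: "2 * (\<beta> * (2 * coupling x y)) \<le> 1" for x y
    using le[of x y] \<beta>(2)[of x] \<beta>(3) mult_nonneg_nonneg[OF \<beta>(1) coupling_nonneg[of x y]] by linarith
  have hs: "((\<lambda>y. \<beta> * (2 * coupling x y)) has_sum (\<beta> * (2 * h x))) UNIV" for x
    by (rule has_sum_cmult_right[OF has_sum_cmult_right[OF h(1)]])
  have hc: "4 * (\<beta> * (2 * h x)) \<le> c" for x
    using mult_left_mono[OF h(2)[of x] \<beta>(1)] \<beta>(2)[of x] by linarith
  have inv: "real_part_state \<omega> f = real_part_state \<omega> (gibbs_kernel x (U x) f)"
    if "classical_KMS \<beta> \<phi> \<omega>" "continuous_on UNIV f" for \<omega> x f
  proof -
    interpret config_state "real_part_state \<omega>"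
      by (rule config_state_real_part) (use that in \<open>simp add: classical_KMS_def\<close>)
    show ?thesis by (rule DLR[OF Uc Wc Ud KMS_poly_fun[OF that(1)] that(2)])
  qed
  have "real_part_state \<omega>1 f = real_part_state \<omega>2 f" if "continuous_on UNIV f" for f
    by (rule dobrushin_uniqueness[OF config_state_real_part[OF st(1)] config_state_real_part[OF st(2)]
          inv[OF K(1)] inv[OF K(2)] Uc osc small hs hc \<beta>(3) that])
  then have "real_part_state \<omega>1 (\<lambda>\<sigma>. Re (apply_bcontfun F \<sigma>)) = real_part_state \<omega>2 (\<lambda>\<sigma>. Re (apply_bcontfun F \<sigma>))"
    "real_part_state \<omega>1 (\<lambda>\<sigma>. Im (apply_bcontfun F \<sigma>)) = real_part_state \<omega>2 (\<lambda>\<sigma>. Im (apply_bcontfun F \<sigma>))"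
    by (simp_all add: continuous_on_Re continuous_on_Im)
  then show "\<omega>1 F = \<omega>2 F"
    using is_state_decompose[OF st(1), of F] is_state_decompose[OF st(2), of F] by (simp only:)
qed

end

section \<open>Hamiltonian vector fields are divergence free\<close>

text \<open>Linear functions of one spin with an arbitrary coefficient vector: rotation fields keep
  them linear and act on u by cross products, so iterated derivatives reduce to vector
  algebra.\<close>

definition lin :: "'g \<Rightarrow> real^3 \<Rightarrow> 'g config \<Rightarrow> real"
  where "lin x u \<sigma> = u \<bullet> vec_of_s2 (\<sigma> x)"

lemma inner_cross3: "u \<bullet> cross3 v w = cross3 u v \<bullet> w"
  by (simp add: cross3_def inner_vec_def sum_3 vector_def algebra_simps)

lemma has_rot_deriv_lin: "has_rot_deriv x i (lin x u) (lin x (cross3 u (axis i 1)))"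
  unfolding has_rot_deriv_def
proof
  fix \<sigma>
  have "((\<lambda>t. u \<bullet> rotate_vec i t (vec_of_s2 (\<sigma> x))) has_vector_derivative
      u \<bullet> cross3 (axis i 1) (vec_of_s2 (\<sigma> x))) (at 0)"
    by (rule bounded_linear.has_vector_derivative[OF bounded_linear_inner_right rotate_vec_derivative])
  then show "((\<lambda>t. lin x u (rotation_curve x i \<sigma> t)) has_vector_derivative
      lin x (cross3 u (axis i 1)) \<sigma>) (at 0)"
    by (simp add: lin_def rotation_curve_def vec_of_s2_rotate inner_cross3)
qed

lemma poly_fun_lin: "poly_fun (lin x u)"
proof -
  have "lin x u = (\<lambda>\<sigma>. (u $ 1 * coord x 1 \<sigma> + u $ 2 * coord x 2 \<sigma>) + u $ 3 * coord x 3 \<sigma>)"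
    by (simp add: fun_eq_iff lin_def coord_def inner_vec_def sum_3)
  then show ?thesis by (simp add: poly_fun.intros)
qed

lemma coord_eq_lin: "coord x j = lin x (axis j 1)"
  by (simp add: fun_eq_iff coord_def lin_def inner_axis')

text \<open>The relation [L_i, L_(i+1)] = - L_(i+2) of the rotation algebra, evaluated on linear
  functions.\<close>

lemma cross3_axis_commutator:
  "cross3 (cross3 u (axis (i + 1) 1)) (axis i 1) - cross3 (cross3 u (axis i 1)) (axis (i + 1) 1) =
    - cross3 u (axis (i + 2) 1)"
  using exhaust_3[of i]
  by (auto simp: cross3_def axis_def vector_def vec_eq_iff forall_3 numeral_mod_3)

text \<open>P i stands for L_i p and Q i j for L_i L_j p. The commutator relation holds for
  coordinates and passes to products because the mixed terms P P' of the product rule are symmetric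
  and cancel.\<close>

lemma poly_fun_commutator:
  assumes "poly_fun p"
  shows "\<exists>P Q. (\<forall>i. poly_fun (P i)) \<and> (\<forall>i j. poly_fun (Q i j)) \<and> (\<forall>i. has_rot_deriv x i p (P i)) \<and>
    (\<forall>i j. has_rot_deriv x i (P j) (Q i j)) \<and> (\<forall>i \<sigma>. Q i (i + 1) \<sigma> - Q (i + 1) i \<sigma> = - P (i + 2) \<sigma>)"
  using assms
proof induction
  case (const c)
  show ?case
    by (rule exI[of _ "\<lambda>_ _. 0"], rule exI[of _ "\<lambda>_ _ _. 0"])
      (simp add: has_rot_deriv_const poly_fun.const)
next
  case (coord y j)
  show ?case
  proof (cases "y = x")
    case True
    show ?thesis
    proof (rule exI[of _ "\<lambda>i. lin x (cross3 (axis j 1) (axis i 1))"],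
        rule exI[of _ "\<lambda>i k. lin x (cross3 (cross3 (axis j 1) (axis k 1)) (axis i 1))"], intro conjI allI)
      fix i \<sigma>
      show "lin x (cross3 (cross3 (axis j 1) (axis (i + 1) 1)) (axis i 1)) \<sigma> -
          lin x (cross3 (cross3 (axis j 1) (axis i 1)) (axis (i + 1) 1)) \<sigma> =
        - lin x (cross3 (axis j 1) (axis (i + 2) 1)) \<sigma>"
        unfolding lin_def inner_diff_left[symmetric] cross3_axis_commutator by simp
    qed (simp_all add: True coord_eq_lin has_rot_deriv_lin poly_fun_lin)
  next
    case False
    then show ?thesis
      by (intro exI[of _ "\<lambda>_ _. 0"] exI[of _ "\<lambda>_ _ _. 0"])
        (auto simp: has_rot_deriv_const poly_fun.const coord_def intro!: has_rot_deriv_indep)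
  qed
next
  case (add f g)
  then obtain P Q P' Q' where fg:
    "\<forall>i. poly_fun (P i)" "\<forall>i j. poly_fun (Q i j)" "\<forall>i. has_rot_deriv x i f (P i)"
    "\<forall>i j. has_rot_deriv x i (P j) (Q i j)" "\<forall>i \<sigma>. Q i (i + 1) \<sigma> - Q (i + 1) i \<sigma> = - P (i + 2) \<sigma>"
    "\<forall>i. poly_fun (P' i)" "\<forall>i j. poly_fun (Q' i j)" "\<forall>i. has_rot_deriv x i g (P' i)"
    "\<forall>i j. has_rot_deriv x i (P' j) (Q' i j)" "\<forall>i \<sigma>. Q' i (i + 1) \<sigma> - Q' (i + 1) i \<sigma> = - P' (i + 2) \<sigma>"
    by blast
  show ?case
  proof (intro exI[of _ "\<lambda>i \<sigma>. P i \<sigma> + P' i \<sigma>"] exI[of _ "\<lambda>i j \<sigma>. Q i j \<sigma> + Q' i j \<sigma>"] conjI allI)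
    fix i \<sigma>
    show "(Q i (i + 1) \<sigma> + Q' i (i + 1) \<sigma>) - (Q (i + 1) i \<sigma> + Q' (i + 1) i \<sigma>) =
        - (P (i + 2) \<sigma> + P' (i + 2) \<sigma>)"
      using fg(5)[rule_format, of i \<sigma>] fg(10)[rule_format, of i \<sigma>] by linarith
  qed (use fg in \<open>simp_all add: has_rot_deriv_add poly_fun.add\<close>)
next
  case (mult f g)
  then obtain P Q P' Q' where fg:
    "\<forall>i. poly_fun (P i)" "\<forall>i j. poly_fun (Q i j)" "\<forall>i. has_rot_deriv x i f (P i)"
    "\<forall>i j. has_rot_deriv x i (P j) (Q i j)" "\<forall>i \<sigma>. Q i (i + 1) \<sigma> - Q (i + 1) i \<sigma> = - P (i + 2) \<sigma>"
    "\<forall>i. poly_fun (P' i)" "\<forall>i j. poly_fun (Q' i j)" "\<forall>i. has_rot_deriv x i g (P' i)"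
    "\<forall>i j. has_rot_deriv x i (P' j) (Q' i j)" "\<forall>i \<sigma>. Q' i (i + 1) \<sigma> - Q' (i + 1) i \<sigma> = - P' (i + 2) \<sigma>"
    by blast
  show ?case
  proof (intro exI[of _ "\<lambda>i \<sigma>. f \<sigma> * P' i \<sigma> + P i \<sigma> * g \<sigma>"]
      exI[of _ "\<lambda>i j \<sigma>. (f \<sigma> * Q' i j \<sigma> + P i \<sigma> * P' j \<sigma>) + (P j \<sigma> * P' i \<sigma> + Q i j \<sigma> * g \<sigma>)"] conjI allI)
    fix i j \<sigma>
    have "f \<sigma> * (Q' i (i + 1) \<sigma> - Q' (i + 1) i \<sigma>) + (Q i (i + 1) \<sigma> - Q (i + 1) i \<sigma>) * g \<sigma> =
        - (f \<sigma> * P' (i + 2) \<sigma> + P (i + 2) \<sigma> * g \<sigma>)"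
      using fg(5,10) by simp
    then show "(f \<sigma> * Q' i (i + 1) \<sigma> + P i \<sigma> * P' (i + 1) \<sigma>) + (P (i + 1) \<sigma> * P' i \<sigma> + Q i (i + 1) \<sigma> * g \<sigma>) -
      ((f \<sigma> * Q' (i + 1) i \<sigma> + P (i + 1) \<sigma> * P' i \<sigma>) + (P i \<sigma> * P' (i + 1) \<sigma> + Q (i + 1) i \<sigma> * g \<sigma>)) =
      - (f \<sigma> * P' (i + 2) \<sigma> + P (i + 2) \<sigma> * g \<sigma>)"
      by (simp add: algebra_simps)
    show "has_rot_deriv x i (\<lambda>\<sigma>. f \<sigma> * g \<sigma>) (\<lambda>\<sigma>. f \<sigma> * P' i \<sigma> + P i \<sigma> * g \<sigma>)"
      using fg by (intro has_rot_deriv_mult) auto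
    show "has_rot_deriv x i (\<lambda>\<sigma>. f \<sigma> * P' j \<sigma> + P j \<sigma> * g \<sigma>)
       (\<lambda>\<sigma>. (f \<sigma> * Q' i j \<sigma> + P i \<sigma> * P' j \<sigma>) + (P j \<sigma> * P' i \<sigma> + Q i j \<sigma> * g \<sigma>))"
      using fg by (intro has_rot_deriv_add has_rot_deriv_mult) auto
  qed (use fg mult.hyps in \<open>simp_all add: poly_fun.intros\<close>)
qed

lemma c1_at_mult:
  fixes f g :: "'g config \<Rightarrow> complex"
  assumes "c1_at x f" "c1_at x g"
  shows "c1_at x (\<lambda>\<sigma>. f \<sigma> * g \<sigma>)"
    "rot_field x i (\<lambda>\<sigma>. f \<sigma> * g \<sigma>) \<sigma> = f \<sigma> * rot_field x i g \<sigma> + rot_field x i f \<sigma> * g \<sigma>"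
proof -
  have *: "has_rot_deriv x i (\<lambda>\<sigma>. f \<sigma> * g \<sigma>) (\<lambda>\<sigma>. f \<sigma> * rot_field x i g \<sigma> + rot_field x i f \<sigma> * g \<sigma>)" for i
    using assms by (intro has_rot_deriv_mult) (auto simp: c1_at_def)
  show "c1_at x (\<lambda>\<sigma>. f \<sigma> * g \<sigma>)"
    using assms by (intro c1_atI[OF _ _ *] continuous_on_add continuous_on_mult) (auto simp: c1_at_def)
  show "rot_field x i (\<lambda>\<sigma>. f \<sigma> * g \<sigma>) \<sigma> = f \<sigma> * rot_field x i g \<sigma> + rot_field x i f \<sigma> * g \<sigma>"
    by (simp add: rot_field_eq[OF *])
qed

lemma c1_at_diff:
  fixes f g :: "'g config \<Rightarrow> complex"
  assumes "c1_at x f" "c1_at x g"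
  shows "c1_at x (\<lambda>\<sigma>. f \<sigma> - g \<sigma>)"
    "rot_field x i (\<lambda>\<sigma>. f \<sigma> - g \<sigma>) \<sigma> = rot_field x i f \<sigma> - rot_field x i g \<sigma>"
proof -
  have *: "has_rot_deriv x i (\<lambda>\<sigma>. f \<sigma> - g \<sigma>) (\<lambda>\<sigma>. rot_field x i f \<sigma> - rot_field x i g \<sigma>)" for i
    using assms by (auto simp: c1_at_def has_rot_deriv_def intro!: has_vector_derivative_diff)
  show "c1_at x (\<lambda>\<sigma>. f \<sigma> - g \<sigma>)"
    using assms by (intro c1_atI[OF _ _ *] continuous_on_diff) (auto simp: c1_at_def)
  show "rot_field x i (\<lambda>\<sigma>. f \<sigma> - g \<sigma>) \<sigma> = rot_field x i f \<sigma> - rot_field x i g \<sigma>"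
    by (simp add: rot_field_eq[OF *])
qed

lemma c1_at_poly_fun:
  assumes "poly_fun p"
  shows "c1_at x p"
proof -
  have "\<exists>p'. poly_fun p' \<and> has_rot_deriv x i p p'" for i by (rule poly_fun_has_rot_deriv[OF assms])
  then obtain p' where "\<And>i. poly_fun (p' i)" "\<And>i. has_rot_deriv x i p (p' i)" by metis
  then show ?thesis by (intro c1_atI[of p p'] poly_fun_continuous assms) auto
qed

text \<open>The components of \<sigma>_x \<times> L f, where L f is the vector of rotation
  derivatives. Up to the factor 2 they express the Hamiltonian vector field of f through the
  rotation fields.\<close>

definition hamiltonian_coeff :: "'g \<Rightarrow> ('g config \<Rightarrow> complex) \<Rightarrow> 3 \<Rightarrow> 'g config \<Rightarrow> complex"
  where "hamiltonian_coeff x f k \<sigma> = complex_of_real (coord x (k + 1) \<sigma>) * rot_field x (k + 2) f \<sigma> -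
    complex_of_real (coord x (k + 2) \<sigma>) * rot_field x (k + 1) f \<sigma>"

lemma site_poisson_eq_hamiltonian:
  "site_poisson x f g \<sigma> = 2 * (\<Sum>k\<in>UNIV. hamiltonian_coeff x f k \<sigma> * rot_field x k g \<sigma>)"
  unfolding site_poisson_def hamiltonian_coeff_def sum_3 complex_cross3_def vector_3 vec_lambda_beta
  by (simp add: numeral_mod_3 algebra_simps)

lemma site_poisson_antisym: "site_poisson x f g \<sigma> = - site_poisson x g f \<sigma>"
  unfolding site_poisson_def sum_3 complex_cross3_def vector_3 vec_lambda_beta
  by (simp add: algebra_simps)

lemma c1_at_hamiltonian_coeff:
  assumes "\<And>i. c1_at x (rot_field x i f)"
  shows "c1_at x (hamiltonian_coeff x f k)"
  unfolding hamiltonian_coeff_def[abs_def]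
  by (intro c1_at_diff c1_at_mult c1_at_of_real assms c1_at_poly_fun poly_fun.coord)

text \<open>The derivatives falling on the coordinates add up to -2 \<sigma>_x \<cdot> L p, and the
  commutators of the second derivatives to \<sigma>_x \<cdot> L p. Their sum vanishes because L p is
  tangential.\<close>

lemma hamiltonian_divergence_poly_fun:
  assumes "poly_fun p"
  shows "(\<Sum>k\<in>UNIV. rot_field x k (hamiltonian_coeff x (cplx p) k) \<sigma>) = 0"
proof -
  obtain P Q where PQ: "\<And>i. poly_fun (P i)" "\<And>i j. poly_fun (Q i j)" "\<And>i. has_rot_deriv x i p (P i)"
    "\<And>i j. has_rot_deriv x i (P j) (Q i j)" "\<And>i \<sigma>. Q i (i + 1) \<sigma> - Q (i + 1) i \<sigma> = - P (i + 2) \<sigma>"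
    using poly_fun_commutator[OF assms, of x] by blast
  have rf: "rot_field x i (cplx p) = (\<lambda>\<sigma>. complex_of_real (P i \<sigma>))" for i
    by (rule rot_field_eq[OF has_rot_deriv_of_real[OF PQ(3)]])
  have hc: "hamiltonian_coeff x (cplx p) k =
      (\<lambda>\<sigma>. complex_of_real (coord x (k + 1) \<sigma> * P (k + 2) \<sigma> + - 1 * (coord x (k + 2) \<sigma> * P (k + 1) \<sigma>)))" for k
    by (simp add: fun_eq_iff hamiltonian_coeff_def rf)
  have "has_rot_deriv x k (\<lambda>\<sigma>. coord x (k + 1) \<sigma> * P (k + 2) \<sigma> + - 1 * (coord x (k + 2) \<sigma> * P (k + 1) \<sigma>))
     (\<lambda>\<sigma>. (coord x (k + 1) \<sigma> * Q k (k + 2) \<sigma> + - coord x (k + 2) \<sigma> * P (k + 2) \<sigma>) +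
       (- 1 * (coord x (k + 2) \<sigma> * Q k (k + 1) \<sigma> + coord x (k + 1) \<sigma> * P (k + 1) \<sigma>) +
         0 * (coord x (k + 2) \<sigma> * P (k + 1) \<sigma>)))" for k
    by (intro has_rot_deriv_add has_rot_deriv_mult has_rot_deriv_const PQ has_rot_deriv_coords)
  from rot_field_eq[OF has_rot_deriv_of_real[OF this]]
  have rhc: "rot_field x k (hamiltonian_coeff x (cplx p) k) \<sigma> =
      complex_of_real (coord x (k + 1) \<sigma> * Q k (k + 2) \<sigma> - coord x (k + 2) \<sigma> * P (k + 2) \<sigma> -
        coord x (k + 2) \<sigma> * Q k (k + 1) \<sigma> - coord x (k + 1) \<sigma> * P (k + 1) \<sigma>)" for k
    unfolding hc by simp
  have "complex_of_real (coord x 1 \<sigma> * P 1 \<sigma> + coord x 2 \<sigma> * P 2 \<sigma> + coord x 3 \<sigma> * P 3 \<sigma>) = 0"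
    using rot_field_tangential[OF c1_at_of_real(1)[OF c1_at_poly_fun[OF assms]], of x \<sigma>]
    by (simp add: rf sum_3)
  then have t: "coord x 1 \<sigma> * P 1 \<sigma> + coord x 2 \<sigma> * P 2 \<sigma> + coord x 3 \<sigma> * P 3 \<sigma> = 0"
    unfolding of_real_eq_0_iff .
  have "Q 1 2 \<sigma> = Q 2 1 \<sigma> - P 3 \<sigma>" "Q 2 3 \<sigma> = Q 3 2 \<sigma> - P 1 \<sigma>" "Q 3 1 \<sigma> = Q 1 3 \<sigma> - P 2 \<sigma>"
    using PQ(5)[of 1 \<sigma>] PQ(5)[of 2 \<sigma>] PQ(5)[of 3 \<sigma>] by (simp_all add: numeral_mod_3)
  then have "(coord x 2 \<sigma> * Q 1 3 \<sigma> - coord x 3 \<sigma> * P 3 \<sigma> - coord x 3 \<sigma> * Q 1 2 \<sigma> - coord x 2 \<sigma> * P 2 \<sigma>) +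
     (coord x 3 \<sigma> * Q 2 1 \<sigma> - coord x 1 \<sigma> * P 1 \<sigma> - coord x 1 \<sigma> * Q 2 3 \<sigma> - coord x 3 \<sigma> * P 3 \<sigma>) +
     (coord x 1 \<sigma> * Q 3 2 \<sigma> - coord x 2 \<sigma> * P 2 \<sigma> - coord x 2 \<sigma> * Q 3 1 \<sigma> - coord x 1 \<sigma> * P 1 \<sigma>) = 0"
    using t by algebra
  then show ?thesis
    unfolding rhc sum_3 of_real_add[symmetric] by (simp add: numeral_mod_3)
qed

text \<open>What integration by parts at x uses of an average over the spin at x: linearity, sup
  norm continuity and vanishing on rotation derivatives.\<close>

locale invariant_functional =
  fixes J :: "('g::countable config \<Rightarrow> complex) \<Rightarrow> complex" and x :: 'g
  assumes add: "continuous_on UNIV f \<Longrightarrow> continuous_on UNIV g \<Longrightarrow> J (\<lambda>\<sigma>. f \<sigma> + g \<sigma>) = J f + J g"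
    and scale: "continuous_on UNIV f \<Longrightarrow> J (\<lambda>\<sigma>. c * f \<sigma>) = c * J f"
    and bound: "continuous_on UNIV f \<Longrightarrow> (\<And>\<sigma>. norm (f \<sigma>) \<le> B) \<Longrightarrow> norm (J f) \<le> B"
    and deriv: "continuous_on UNIV f \<Longrightarrow> continuous_on UNIV f' \<Longrightarrow> has_rot_deriv x i f f' \<Longrightarrow> J f' = 0"
begin

lemma sum:
  "finite I \<Longrightarrow> (\<And>k. k \<in> I \<Longrightarrow> continuous_on UNIV (f k)) \<Longrightarrow> J (\<lambda>\<sigma>. \<Sum>k\<in>I. f k \<sigma>) = (\<Sum>k\<in>I. J (f k))"
proof (induction I rule: finite_induct)
  case empty
  then show ?case using scale[of "\<lambda>_. 0" 0] by simp
next
  case (insert k I)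
  then show ?case by (simp add: add continuous_on_sum)
qed

lemma by_parts:
  assumes "c1_at x f" "c1_at x g"
  shows "J (\<lambda>\<sigma>. f \<sigma> * rot_field x i g \<sigma>) = - J (\<lambda>\<sigma>. rot_field x i f \<sigma> * g \<sigma>)"
proof -
  have c: "continuous_on UNIV f" "continuous_on UNIV g" "continuous_on UNIV (rot_field x i f)"
    "continuous_on UNIV (rot_field x i g)"
    and d: "has_rot_deriv x i f (rot_field x i f)" "has_rot_deriv x i g (rot_field x i g)"
    using assms by (auto simp: c1_at_def)
  have "J (\<lambda>\<sigma>. f \<sigma> * rot_field x i g \<sigma> + rot_field x i f \<sigma> * g \<sigma>) = 0"
    by (rule deriv[OF _ _ has_rot_deriv_mult[OF d]]) (intro continuous_on_add continuous_on_mult c)+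
  moreover have "J (\<lambda>\<sigma>. f \<sigma> * rot_field x i g \<sigma> + rot_field x i f \<sigma> * g \<sigma>) =
      J (\<lambda>\<sigma>. f \<sigma> * rot_field x i g \<sigma>) + J (\<lambda>\<sigma>. rot_field x i f \<sigma> * g \<sigma>)"
    by (intro add continuous_on_mult c)
  ultimately show ?thesis by (simp add: add_eq_0_iff)
qed

lemma site_poisson_by_parts:
  assumes "\<And>i. c1_at x (rot_field x i f)" "c1_at x g"
  shows "J (site_poisson x f g) =
    - 2 * J (\<lambda>\<sigma>. (\<Sum>k\<in>UNIV. rot_field x k (hamiltonian_coeff x f k) \<sigma>) * g \<sigma>)"
proof -
  note V = c1_at_hamiltonian_coeff[OF assms(1)]
  have c: "continuous_on UNIV (hamiltonian_coeff x f k)" "continuous_on UNIV g"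
    "continuous_on UNIV (rot_field x i (hamiltonian_coeff x f k))" "continuous_on UNIV (rot_field x i g)" for k i
    using V assms(2) by (auto simp: c1_at_def)
  have "J (site_poisson x f g) = J (\<lambda>\<sigma>. 2 * (\<Sum>k\<in>UNIV. hamiltonian_coeff x f k \<sigma> * rot_field x k g \<sigma>))"
    by (rule arg_cong[where f=J]) (simp add: fun_eq_iff site_poisson_eq_hamiltonian)
  also have "\<dots> = 2 * (\<Sum>k\<in>UNIV. J (\<lambda>\<sigma>. hamiltonian_coeff x f k \<sigma> * rot_field x k g \<sigma>))"
    by (subst scale, (intro continuous_on_sum continuous_on_mult c)[1], subst sum)
      (auto intro!: continuous_on_mult c)
  also have "\<dots> = - 2 * (\<Sum>k\<in>UNIV. J (\<lambda>\<sigma>. rot_field x k (hamiltonian_coeff x f k) \<sigma> * g \<sigma>))"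
    by (simp add: by_parts[OF V assms(2)] sum_negf)
  also have "(\<Sum>k\<in>UNIV. J (\<lambda>\<sigma>. rot_field x k (hamiltonian_coeff x f k) \<sigma> * g \<sigma>)) =
      J (\<lambda>\<sigma>. \<Sum>k\<in>UNIV. rot_field x k (hamiltonian_coeff x f k) \<sigma> * g \<sigma>)"
    by (rule sum[symmetric]) (auto intro!: continuous_on_mult c)
  finally show ?thesis by (simp add: sum_distrib_right)
qed

text \<open>A Hamiltonian vector field is divergence free. For polynomial functions this is a computation with
  commutators; in general, the divergence is orthogonal to all polynomial functions, because the
  bracket with a polynomial function can be integrated by parts either way.\<close>

lemma site_poisson_null:
  assumes "c1_at x f" "\<And>i. c1_at x (rot_field x i f)" "c1_at x g"
  shows "J (site_poisson x f g) = 0"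
proof -
  define D where "D \<sigma> = (\<Sum>k\<in>UNIV. rot_field x k (hamiltonian_coeff x f k) \<sigma>)" for \<sigma>
  have Dc: "continuous_on UNIV D"
    unfolding D_def using c1_at_hamiltonian_coeff[OF assms(2)]
    by (intro continuous_on_sum) (auto simp: c1_at_def)
  have eq: "J (site_poisson x f h) = - 2 * J (\<lambda>\<sigma>. D \<sigma> * h \<sigma>)" if "c1_at x h" for h
    unfolding D_def by (rule site_poisson_by_parts[OF assms(2) that])
  have P: "J (\<lambda>\<sigma>. D \<sigma> * complex_of_real (p \<sigma>)) = 0" if p: "poly_fun p" for p
  proof -
    let ?p = "cplx p"
    have c1p: "c1_at x ?p" by (rule c1_at_of_real(1)[OF c1_at_poly_fun[OF p]])
    have c2p: "c1_at x (rot_field x i ?p)" for i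
    proof -
      obtain p' where "poly_fun p'" "has_rot_deriv x i p p'"
        using poly_fun_has_rot_deriv[OF p] by blast
      then show ?thesis
        by (simp add: rot_field_eq[OF has_rot_deriv_of_real] c1_at_of_real(1) c1_at_poly_fun)
    qed
    \<comment> \<open>With p in the first place, integration by parts produces the divergence of the
      field of p, which is known to vanish. By antisymmetry the bracket with p in the second place
      has expectation 0 too, and \<open>eq\<close> turns this into orthogonality of D to p.\<close>
    have "J (site_poisson x ?p f) = 0"
      unfolding site_poisson_by_parts[OF c2p assms(1)] hamiltonian_divergence_poly_fun[OF p]
      using scale[of "\<lambda>_. 0" 0] by simp
    moreover have "J (site_poisson x f ?p) = J (\<lambda>\<sigma>. - 1 * site_poisson x ?p f \<sigma>)"
      by (rule arg_cong[where f=J]) (simp add: fun_eq_iff site_poisson_antisym[of x f ?p])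
    ultimately show ?thesis
      using eq[OF c1p] scale[OF site_poisson_continuous[OF c1p assms(1)], of "-1"] by simp
  qed
  obtain B where B: "B > 0" "\<And>\<sigma>. norm (D \<sigma>) \<le> B" using bounded_continuous_config[OF Dc] by metis
  have gc: "continuous_on UNIV g" using assms(3) by (simp add: c1_at_def)
  have "norm (J (\<lambda>\<sigma>. D \<sigma> * g \<sigma>)) \<le> 0 + e" if e: "e > 0" for e
  proof -
    have eB: "e / (2 * B) > 0" using e B by simp
    obtain p where p: "poly_fun p" "\<And>\<sigma>. \<bar>Re (g \<sigma>) - p \<sigma>\<bar> < e / (2 * B)"
      using poly_fun_dense[OF continuous_on_Re[OF gc] eB] by metis
    obtain q where q: "poly_fun q" "\<And>\<sigma>. \<bar>Im (g \<sigma>) - q \<sigma>\<bar> < e / (2 * B)"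
      using poly_fun_dense[OF continuous_on_Im[OF gc] eB] by metis
    \<comment> \<open>h is g minus its polynomial approximation p + i q. As D is orthogonal to
      polynomial functions, D h and D g have the same expectation, and D h is uniformly
      small.\<close>
    define h where "h \<sigma> = g \<sigma> + (- 1 * complex_of_real (p \<sigma>) + (- \<i>) * complex_of_real (q \<sigma>))" for \<sigma>
    have pq: "continuous_on UNIV (cplx p)" "continuous_on UNIV (cplx q)"
      by (rule continuous_on_of_real, rule poly_fun_continuous, fact)+
    have hc: "continuous_on UNIV h"
      unfolding h_def by (intro continuous_on_add continuous_on_mult continuous_on_const gc pq)
    have "norm (h \<sigma>) \<le> e / B" for \<sigma>
    proof -
      have "norm (h \<sigma>) \<le> \<bar>Re (h \<sigma>)\<bar> + \<bar>Im (h \<sigma>)\<bar>" by (rule cmod_le)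
      also have "\<dots> \<le> e / (2 * B) + e / (2 * B)"
        using p(2)[of \<sigma>] q(2)[of \<sigma>] by (simp add: h_def)
      finally show ?thesis by simp
    qed
    then have "norm (D \<sigma> * h \<sigma>) \<le> e" for \<sigma>
      using mult_mono[OF B(2)[of \<sigma>], of "norm (h \<sigma>)" "e / B"] B(1) by (simp add: norm_mult)
    then have "norm (J (\<lambda>\<sigma>. D \<sigma> * h \<sigma>)) \<le> e" by (intro bound continuous_on_mult Dc hc)
    moreover have "J (\<lambda>\<sigma>. D \<sigma> * h \<sigma>) = J (\<lambda>\<sigma>. D \<sigma> * g \<sigma> +
        (- 1 * (D \<sigma> * complex_of_real (p \<sigma>)) + (- \<i>) * (D \<sigma> * complex_of_real (q \<sigma>))))"
      by (rule arg_cong[where f=J]) (simp add: fun_eq_iff h_def algebra_simps)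
    moreover have "\<dots> = J (\<lambda>\<sigma>. D \<sigma> * g \<sigma>) + J (\<lambda>\<sigma>. - 1 * (D \<sigma> * complex_of_real (p \<sigma>)) +
        (- \<i>) * (D \<sigma> * complex_of_real (q \<sigma>)))"
      by (rule add) (intro continuous_on_add continuous_on_mult continuous_on_const Dc gc pq)+
    moreover have "J (\<lambda>\<sigma>. - 1 * (D \<sigma> * complex_of_real (p \<sigma>)) + (- \<i>) * (D \<sigma> * complex_of_real (q \<sigma>))) =
        J (\<lambda>\<sigma>. - 1 * (D \<sigma> * complex_of_real (p \<sigma>))) + J (\<lambda>\<sigma>. (- \<i>) * (D \<sigma> * complex_of_real (q \<sigma>)))"
      by (rule add) (intro continuous_on_mult continuous_on_const Dc pq)+
    moreover have zero: "J (\<lambda>\<sigma>. c * (D \<sigma> * complex_of_real (r \<sigma>))) = 0" if "poly_fun r" for c r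
      using scale[of "\<lambda>\<sigma>. D \<sigma> * complex_of_real (r \<sigma>)" c] P[OF that] that
      by (simp add: continuous_on_mult Dc poly_fun_continuous)
    ultimately show ?thesis by (simp only: zero[OF p(1)] zero[OF q(1)] add_0_left add_0_right)
  qed
  then have "norm (J (\<lambda>\<sigma>. D \<sigma> * g \<sigma>)) \<le> 0" by (rule field_le_epsilon)
  then show ?thesis by (simp add: eq[OF assms(3)])
qed

end

section \<open>Gibbs states in finite volume\<close>

lemma avs_of_real: "avs xs (cplx f) = (\<lambda>\<sigma>. complex_of_real (avs xs f \<sigma>))"
  by (induction xs) (simp, simp, intro ext av_of_real)

lemma avs_ge:
  fixes f :: "'g config \<Rightarrow> real"
  assumes "continuous_on UNIV f" "\<And>\<sigma>. c \<le> f \<sigma>"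
  shows "c \<le> avs xs f \<sigma>"
proof (induction xs arbitrary: \<sigma>)
  case (Cons x xs)
  have "c = av x (\<lambda>_. c) \<sigma>" by (simp add: av_indep)
  also have "\<dots> \<le> av x (avs xs f) \<sigma>"
    by (intro av_mono continuous_on_const avs_continuous assms Cons)
  finally show ?case by simp
qed (simp add: assms)

lemma invariant_functional_avs:
  fixes x :: "'g::countable"
  assumes "x \<in> set xs"
  shows "invariant_functional (\<lambda>f. avs xs f \<sigma>) x"
  by standard (auto simp: avs_add avs_scale norm_avs_le avs_rot_deriv[OF _ _ _ assms])

text \<open>The spins off \<open>xs\<close> are frozen at an arbitrary value.\<close>

definition gibbs_state :: "'g list \<Rightarrow> ('g config \<Rightarrow> real) \<Rightarrow> ('g config \<Rightarrow>\<^sub>C complex) \<Rightarrow> complex"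
  where "gibbs_state xs U F =
    avs xs (\<lambda>\<sigma>. apply_bcontfun F \<sigma> * complex_of_real (exp (- U \<sigma>))) (\<lambda>_. undefined) /
    avs xs (\<lambda>\<sigma>. complex_of_real (exp (- U \<sigma>))) (\<lambda>_. undefined)"

lemma partition_pos:
  fixes U :: "'g config \<Rightarrow> real"
  assumes "continuous_on UNIV U"
  shows "avs xs (\<lambda>\<sigma>. exp (- U \<sigma>)) \<tau> > 0"
proof -
  obtain B where "\<And>\<sigma>. norm (U \<sigma>) \<le> B" using bounded_continuous_config[OF assms] by metis
  then have B: "- B \<le> - U \<sigma>" for \<sigma> by (simp add: abs_le_iff)
  have "exp (- B) \<le> avs xs (\<lambda>\<sigma>. exp (- U \<sigma>)) \<tau>"
    using B by (intro avs_ge continuous_intros assms) auto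
  then show ?thesis using exp_gt_zero[of "- B"] by linarith
qed

lemma is_state_gibbs_state:
  fixes U :: "'g config \<Rightarrow> real"
  assumes "continuous_on UNIV U"
  shows "is_state (gibbs_state xs U)"
proof -
  define z where "z = avs xs (\<lambda>\<sigma>. exp (- U \<sigma>)) (\<lambda>_. undefined)"
  have z: "z > 0" unfolding z_def by (rule partition_pos[OF assms])
  have eU: "continuous_on UNIV (\<lambda>\<sigma>. exp (- U \<sigma>))" by (intro continuous_intros assms)
  have hc: "continuous_on UNIV (\<lambda>\<sigma>. complex_of_real (exp (- U \<sigma>)))" by (rule continuous_on_of_real[OF eU])
  have G: "gibbs_state xs U F = avs xs (\<lambda>\<sigma>. apply_bcontfun F \<sigma> * complex_of_real (exp (- U \<sigma>))) (\<lambda>_. undefined) /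
      complex_of_real z" for F
    unfolding gibbs_state_def avs_of_real z_def ..
  have Fc: "continuous_on UNIV (\<lambda>\<sigma>. apply_bcontfun F \<sigma> * complex_of_real (exp (- U \<sigma>)))"
    for F :: "'g config \<Rightarrow>\<^sub>C complex"
    by (intro continuous_on_mult hc continuous_on_apply_bcontfun)
  show ?thesis
    unfolding is_state_def
  proof (intro conjI allI impI)
    fix F H :: "'g config \<Rightarrow>\<^sub>C complex" and c
    show "gibbs_state xs U (F + H) = gibbs_state xs U F + gibbs_state xs U H"
      unfolding G by (simp add: distrib_right avs_add[OF Fc Fc] add_divide_distrib)
    have "continuous_on UNIV (\<lambda>\<sigma>. c * apply_bcontfun F \<sigma>)"
      by (intro continuous_on_mult continuous_on_const continuous_on_apply_bcontfun)
    then show "gibbs_state xs U (Bcontfun (\<lambda>\<sigma>. c * apply_bcontfun F \<sigma>)) = c * gibbs_state xs U F"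
      unfolding G by (simp add: mult.assoc avs_scale)
  next
    fix F :: "'g config \<Rightarrow>\<^sub>C complex"
    assume F: "\<forall>\<sigma>. apply_bcontfun F \<sigma> \<in> \<real> \<and> 0 \<le> Re (apply_bcontfun F \<sigma>)"
    have eq: "(\<lambda>\<sigma>. apply_bcontfun F \<sigma> * complex_of_real (exp (- U \<sigma>))) =
        (\<lambda>\<sigma>. complex_of_real (Re (apply_bcontfun F \<sigma>) * exp (- U \<sigma>)))"
      using F by (simp add: fun_eq_iff)
    have "0 \<le> avs xs (\<lambda>\<sigma>. Re (apply_bcontfun F \<sigma>) * exp (- U \<sigma>)) (\<lambda>_. undefined)"
      by (rule avs_ge)
        (use F in \<open>auto intro!: continuous_on_mult eU continuous_on_Re continuous_on_apply_bcontfun\<close>)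
    moreover have "gibbs_state xs U F = complex_of_real
        (avs xs (\<lambda>\<sigma>. Re (apply_bcontfun F \<sigma>) * exp (- U \<sigma>)) (\<lambda>_. undefined) / z)"
      unfolding G eq avs_of_real by simp
    ultimately show "gibbs_state xs U F \<in> \<real>" "0 \<le> Re (gibbs_state xs U F)"
      using z by simp_all
  next
    show "gibbs_state xs U (const_bcontfun 1) = 1"
      unfolding gibbs_state_def using z by (simp add: const_bcontfun.rep_eq avs_of_real z_def)
  qed
qed

lemma site_poisson_mult_right:
  assumes "c1_at x g" "c1_at x h"
  shows "site_poisson x f (\<lambda>\<sigma>. g \<sigma> * h \<sigma>) \<sigma> = site_poisson x f g \<sigma> * h \<sigma> + g \<sigma> * site_poisson x f h \<sigma>"
  unfolding site_poisson_eq_hamiltonian c1_at_mult(2)[OF assms]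
  by (simp add: sum_3 algebra_simps)

lemma c1_at_exp:
  assumes "c1_at x U"
  shows "c1_at x (\<lambda>\<sigma>. complex_of_real (exp (- U \<sigma>)))"
    "rot_field x i (\<lambda>\<sigma>. complex_of_real (exp (- U \<sigma>))) \<sigma> =
      - complex_of_real (exp (- U \<sigma>)) * complex_of_real (rot_field x i U \<sigma>)"
proof -
  have "has_rot_deriv x i (\<lambda>\<sigma>. exp (- U \<sigma>)) (\<lambda>\<sigma>. (- exp (- U \<sigma>)) * rot_field x i U \<sigma>)" for i
    by (rule has_rot_deriv_chain[where g = "\<lambda>u. exp (- u)" and g' = "\<lambda>u. - exp (- u)"])
      (use assms in \<open>auto simp: c1_at_def intro!: derivative_eq_intros\<close>)
  note d = has_rot_deriv_of_real[OF this]
  have c: "continuous_on UNIV (\<lambda>\<sigma>. complex_of_real (exp (- U \<sigma>)))"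
    "continuous_on UNIV (\<lambda>\<sigma>. complex_of_real (- exp (- U \<sigma>) * rot_field x i U \<sigma>))" for i
    using assms unfolding c1_at_def by (intro continuous_intros; blast)+
  show "c1_at x (\<lambda>\<sigma>. complex_of_real (exp (- U \<sigma>)))" by (rule c1_atI[OF c d])
  show "rot_field x i (\<lambda>\<sigma>. complex_of_real (exp (- U \<sigma>))) \<sigma> =
      - complex_of_real (exp (- U \<sigma>)) * complex_of_real (rot_field x i U \<sigma>)"
    unfolding rot_field_eq[OF d] by simp
qed

text \<open>The bracket of f with g e^(-U) has average 0. By the Leibniz rule it equals ({f, g} - g
  {f, U}) e^(-U), and the partition function divides out on both sides.\<close>

lemma gibbs_state_site_KMS:
  fixes U :: "'g::countable config \<Rightarrow> real"
  assumes "x \<in> set xs" "c1_at x f" "\<And>i. c1_at x (rot_field x i f)" "c1_at x g" "c1_at x U"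
  shows "gibbs_state xs U (Bcontfun (site_poisson x f g)) =
    gibbs_state xs U (Bcontfun (\<lambda>\<sigma>. g \<sigma> * site_poisson x f (cplx U) \<sigma>))"
proof -
  let ?h = "\<lambda>\<sigma>. complex_of_real (exp (- U \<sigma>))"
  let ?U = "\<lambda>\<sigma>. complex_of_real (U \<sigma>)"
  interpret invariant_functional "\<lambda>f. avs xs f (\<lambda>_. undefined)" x
    by (rule invariant_functional_avs[OF assms(1)])
  note h = c1_at_exp[OF assms(5)]
  have hU: "site_poisson x f ?h \<sigma> = - 1 * (?h \<sigma> * site_poisson x f ?U \<sigma>)" for \<sigma>
    unfolding site_poisson_eq_hamiltonian h(2) c1_at_of_real(2)[OF assms(5)]
    by (simp add: sum_3 algebra_simps)
  have gc: "continuous_on UNIV g" and hc: "continuous_on UNIV ?h"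
    using assms(4) h(1) by (simp_all add: c1_at_def)
  have c: "continuous_on UNIV (site_poisson x f g)" "continuous_on UNIV (site_poisson x f ?U)"
    by (intro site_poisson_continuous assms c1_at_of_real)+
  have "avs xs (site_poisson x f (\<lambda>\<sigma>. g \<sigma> * ?h \<sigma>)) (\<lambda>_. undefined) = 0"
    by (intro site_poisson_null assms c1_at_mult h)
  also have "site_poisson x f (\<lambda>\<sigma>. g \<sigma> * ?h \<sigma>) =
      (\<lambda>\<sigma>. site_poisson x f g \<sigma> * ?h \<sigma> + - 1 * (g \<sigma> * site_poisson x f ?U \<sigma> * ?h \<sigma>))"
    by (simp add: fun_eq_iff site_poisson_mult_right[OF assms(4) h(1)] hU algebra_simps)
  finally have "avs xs (\<lambda>\<sigma>. site_poisson x f g \<sigma> * ?h \<sigma>) (\<lambda>_. undefined) =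
      avs xs (\<lambda>\<sigma>. g \<sigma> * site_poisson x f ?U \<sigma> * ?h \<sigma>) (\<lambda>_. undefined)"
    by (subst (asm) add, (intro continuous_on_mult continuous_on_const c gc hc)+, subst (asm) scale,
        (intro continuous_on_mult c gc hc)+) simp
  then show ?thesis
    by (simp add: gibbs_state_def c gc continuous_on_mult)
qed

section \<open>Existence of KMS states\<close>

lemma is_state_sum:
  fixes f :: "'i \<Rightarrow> 'g config \<Rightarrow> complex"
  assumes "is_state \<omega>" "finite I" "\<And>k. k \<in> I \<Longrightarrow> continuous_on UNIV (f k)"
  shows "\<omega> (Bcontfun (\<lambda>\<sigma>. \<Sum>k\<in>I. f k \<sigma>)) = (\<Sum>k\<in>I. \<omega> (Bcontfun (f k)))"
  using assms(2,3)
proof (induction I rule: finite_induct)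
  case empty
  have "\<omega> (Bcontfun (\<lambda>\<sigma>::'g config. 0 * apply_bcontfun (const_bcontfun 1) \<sigma>)) = 0"
    by (subst is_state_scale[OF assms(1)]) simp
  then show ?case by simp
next
  case (insert k I)
  then show ?case
    by (simp add: Bcontfun_add is_state_add[OF assms(1)] continuous_on_sum)
qed

text \<open>The factor 2 comes from estimating real and imaginary part separately. A bound depending
  only on \<open>norm F\<close> is what compactness and the limit argument need.\<close>

lemma is_state_bound:
  fixes F :: "'g::countable config \<Rightarrow>\<^sub>C complex"
  assumes "is_state \<omega>"
  shows "norm (\<omega> F) \<le> 2 * norm F"
proof -
  interpret config_state "real_part_state \<omega>" by (rule config_state_real_part[OF assms])
  have b: "\<bar>Re (apply_bcontfun F \<sigma>)\<bar> \<le> norm F" "\<bar>Im (apply_bcontfun F \<sigma>)\<bar> \<le> norm F" for \<sigma>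
    using norm_bounded[of F \<sigma>] abs_Re_le_cmod[of "apply_bcontfun F \<sigma>"] abs_Im_le_cmod[of "apply_bcontfun F \<sigma>"]
    by linarith+
  have "\<bar>real_part_state \<omega> (\<lambda>\<sigma>. Re (apply_bcontfun F \<sigma>))\<bar> \<le> norm F"
    "\<bar>real_part_state \<omega> (\<lambda>\<sigma>. Im (apply_bcontfun F \<sigma>))\<bar> \<le> norm F"
    by (intro abs_le b continuous_on_Re continuous_on_Im continuous_on_apply_bcontfun)+
  moreover have "norm (\<omega> F) \<le> \<bar>Re (\<omega> F)\<bar> + \<bar>Im (\<omega> F)\<bar>" by (rule cmod_le)
  moreover have "Re (\<omega> F) = real_part_state \<omega> (\<lambda>\<sigma>. Re (apply_bcontfun F \<sigma>))"
    "Im (\<omega> F) = real_part_state \<omega> (\<lambda>\<sigma>. Im (apply_bcontfun F \<sigma>))"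
    by (subst is_state_decompose[OF assms]; simp)+
  ultimately show ?thesis by linarith
qed

text \<open>The Banach-Alaoglu argument: by \<open>is_state_bound\<close> the states lie in a
  product of closed discs, compact by Tychonoff. The conditions on a state are closed under
  pointwise convergence. The cluster point comes with a finer filter G, along which every evaluation
  converges.\<close>

lemma state_cluster_point:
  fixes \<Omega> :: "'i \<Rightarrow> ('g::countable config \<Rightarrow>\<^sub>C complex) \<Rightarrow> complex"
  assumes "F \<noteq> bot" "\<forall>\<^sub>F i in F. is_state (\<Omega> i)"
  obtains \<omega> G where "G \<noteq> bot" "G \<le> filtermap \<Omega> F" "\<And>f. ((\<lambda>\<eta>. \<eta> f) \<longlongrightarrow> \<omega> f) G" "is_state \<omega>"
proof -
  define K :: "(('g config \<Rightarrow>\<^sub>C complex) \<Rightarrow> complex) set"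
    where "K = PiE UNIV (\<lambda>f. cball 0 (2 * norm f))"
  have "compact K"
    using compactin_PiE[of "\<lambda>_. euclidean" UNIV "\<lambda>f::'g config \<Rightarrow>\<^sub>C complex. cball (0::complex) (2 * norm f)"]
    by (simp add: euclidean_product_topology K_def)
  moreover have "filtermap \<Omega> F \<noteq> bot" using assms(1) by (simp add: filtermap_bot_iff)
  moreover have "\<forall>\<^sub>F \<eta> in filtermap \<Omega> F. \<eta> \<in> K"
    unfolding eventually_filtermap
    using assms(2) by eventually_elim (auto simp: K_def is_state_bound)
  ultimately obtain \<omega> where "inf (nhds \<omega>) (filtermap \<Omega> F) \<noteq> bot"
    unfolding compact_filter by blast
  \<comment> \<open>Proper because \<omega> is a cluster point; it refines both the neighbourhoods
    of \<omega> and the given net of states.\<close>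
  define G where "G = inf (nhds \<omega>) (filtermap \<Omega> F)"
  have G: "G \<noteq> bot" "G \<le> filtermap \<Omega> F" "G \<le> nhds \<omega>"
    using \<open>inf (nhds \<omega>) (filtermap \<Omega> F) \<noteq> bot\<close> by (auto simp: G_def)
  have lim: "((\<lambda>\<eta>. \<eta> f) \<longlongrightarrow> \<omega> f) G" for f
  proof -
    have "continuous_on UNIV (\<lambda>\<eta>::('g config \<Rightarrow>\<^sub>C complex) \<Rightarrow> complex. \<eta> f)"
      by (rule continuous_on_product_then_coordinatewise[OF continuous_on_id])
    then have "((\<lambda>\<eta>. \<eta> f) \<longlongrightarrow> \<omega> f) (at \<omega>)"
      by (simp add: continuous_on_def)
    then have "((\<lambda>\<eta>. \<eta> f) \<longlongrightarrow> \<omega> f) (nhds \<omega>)"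
      by (rule tendsto_at_iff_tendsto_nhds[of "\<lambda>\<eta>. \<eta> f" \<omega>, THEN iffD1])
    then show ?thesis by (rule tendsto_mono[OF G(3)])
  qed
  have ev: "\<forall>\<^sub>F \<eta> in G. is_state \<eta>"
    by (rule filter_leD[OF G(2)]) (simp add: eventually_filtermap assms(2))
  have "is_state \<omega>"
    unfolding is_state_def
  proof (intro conjI allI impI)
    fix f g :: "'g config \<Rightarrow>\<^sub>C complex" and c
    have "((\<lambda>\<eta>. \<eta> (f + g) - (\<eta> f + \<eta> g)) \<longlongrightarrow> \<omega> (f + g) - (\<omega> f + \<omega> g)) G" by (intro tendsto_intros lim)
    moreover have "((\<lambda>\<eta>. \<eta> (f + g) - (\<eta> f + \<eta> g)) \<longlongrightarrow> 0) G"
      by (rule tendsto_eventually) (use ev in eventually_elim, simp add: is_state_add)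
    ultimately show "\<omega> (f + g) = \<omega> f + \<omega> g"
      using tendsto_unique[OF G(1)] by fastforce
    have "((\<lambda>\<eta>. \<eta> (Bcontfun (\<lambda>\<sigma>. c * apply_bcontfun f \<sigma>)) - c * \<eta> f) \<longlongrightarrow>
        \<omega> (Bcontfun (\<lambda>\<sigma>. c * apply_bcontfun f \<sigma>)) - c * \<omega> f) G" by (intro tendsto_intros lim)
    moreover have "((\<lambda>\<eta>. \<eta> (Bcontfun (\<lambda>\<sigma>. c * apply_bcontfun f \<sigma>)) - c * \<eta> f) \<longlongrightarrow> 0) G"
      by (rule tendsto_eventually) (use ev in eventually_elim, simp add: is_state_scale)
    ultimately show "\<omega> (Bcontfun (\<lambda>\<sigma>. c * apply_bcontfun f \<sigma>)) = c * \<omega> f"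
      using tendsto_unique[OF G(1)] by fastforce
  next
    fix f :: "'g config \<Rightarrow>\<^sub>C complex"
    assume f: "\<forall>\<sigma>. apply_bcontfun f \<sigma> \<in> \<real> \<and> 0 \<le> Re (apply_bcontfun f \<sigma>)"
    have pos: "\<forall>\<^sub>F \<eta> in G. \<eta> f \<in> \<real> \<and> 0 \<le> Re (\<eta> f)"
      using ev by eventually_elim (rule is_state_nonneg, use f in auto)
    have "((\<lambda>\<eta>. Im (\<eta> f)) \<longlongrightarrow> 0) G"
      by (rule tendsto_eventually) (use pos in eventually_elim, simp add: complex_is_Real_iff)
    moreover have "((\<lambda>\<eta>. Im (\<eta> f)) \<longlongrightarrow> Im (\<omega> f)) G" by (intro tendsto_intros lim)
    ultimately have "Im (\<omega> f) = 0" using tendsto_unique[OF G(1)] by blast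
    then show "\<omega> f \<in> \<real>" by (simp add: complex_is_Real_iff)
    have "((\<lambda>\<eta>. Re (\<eta> f)) \<longlongrightarrow> Re (\<omega> f)) G" by (intro tendsto_intros lim)
    then show "0 \<le> Re (\<omega> f)"
      by (rule tendsto_lowerbound[OF _ _ G(1)]) (use pos in eventually_elim, simp)
  next
    have "((\<lambda>\<eta>. \<eta> (const_bcontfun 1)) \<longlongrightarrow> 1) G"
      by (rule tendsto_eventually) (use ev in eventually_elim, simp add: is_state_one)
    then show "\<omega> (const_bcontfun 1) = 1" using tendsto_unique[OF G(1) lim] by blast
  qed
  with G lim show ?thesis using that by blast
qed

context interaction begin

text \<open>Free boundary conditions: only interactions inside the volume are kept, a finite
  sum.\<close>

definition volume_energy :: "'g set \<Rightarrow> 'g config \<Rightarrow> real"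
  where "volume_energy \<Lambda> \<sigma> = (\<Sum>X\<in>Pow \<Lambda>. \<phi> X \<sigma>)"

lemma volume_energy:
  assumes "finite \<Lambda>"
  shows "c1_at x (\<lambda>\<sigma>. \<beta> * volume_energy \<Lambda> \<sigma>)"
    "rot_field x i (\<lambda>\<sigma>. \<beta> * volume_energy \<Lambda> \<sigma>) \<sigma> = \<beta> * (\<Sum>X\<in>Pow \<Lambda>. rot_field x i (\<phi> X) \<sigma>)"
proof -
  have fin: "finite X" if "X \<in> Pow \<Lambda>" for X using that assms finite_subset by auto
  have d: "has_rot_deriv x i (\<lambda>\<sigma>. \<beta> * volume_energy \<Lambda> \<sigma>) (\<lambda>\<sigma>. \<beta> * (\<Sum>X\<in>Pow \<Lambda>. rot_field x i (\<phi> X) \<sigma>))" for i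
    unfolding volume_energy_def
    by (rule has_rot_deriv_linear[OF bounded_linear_mult_right has_rot_deriv_sum])
      (use c1_at[OF fin] in \<open>simp add: c1_at_def\<close>)
  show "c1_at x (\<lambda>\<sigma>. \<beta> * volume_energy \<Lambda> \<sigma>)"
  proof (rule c1_atI[OF _ _ d])
    show "continuous_on UNIV (\<lambda>\<sigma>. \<beta> * volume_energy \<Lambda> \<sigma>)"
      unfolding volume_energy_def using c1_at[OF fin]
      by (intro continuous_on_mult continuous_on_const continuous_on_sum) (simp add: c1_at_def)
    show "continuous_on UNIV (\<lambda>\<sigma>. \<beta> * (\<Sum>X\<in>Pow \<Lambda>. rot_field x i (\<phi> X) \<sigma>))" for i
      using c1_at[OF fin]
      by (intro continuous_on_mult continuous_on_const continuous_on_sum) (simp add: c1_at_def)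
  qed
  show "rot_field x i (\<lambda>\<sigma>. \<beta> * volume_energy \<Lambda> \<sigma>) \<sigma> = \<beta> * (\<Sum>X\<in>Pow \<Lambda>. rot_field x i (\<phi> X) \<sigma>)"
    by (simp add: rot_field_eq[OF d])
qed

text \<open>The one-site identities are summed over \<Lambda>1, where all derivatives of a live.
  Interactions disjoint from \<Lambda>1 have zero bracket with a, which leaves the derivation
  truncated to sets inside the volume.\<close>

lemma finite_volume_KMS:
  assumes xs: "\<Lambda>1 \<subseteq> set xs" and fin: "finite \<Lambda>1" "finite \<Lambda>2"
    and a: "Csmooth \<Lambda>1 a" and b: "Csmooth \<Lambda>2 b"
  shows "gibbs_state xs (\<lambda>\<sigma>. \<beta> * volume_energy (set xs) \<sigma>) (Bcontfun (poisson (\<Lambda>1 \<union> \<Lambda>2) a b)) =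
    of_real \<beta> * gibbs_state xs (\<lambda>\<sigma>. \<beta> * volume_energy (set xs) \<sigma>)
      (Bcontfun (\<lambda>\<sigma>. b \<sigma> * apply_bcontfun (\<Sum>X\<in>Pow (set xs) \<inter> meeting \<Lambda>1. phi_bracket \<Lambda>1 a X) \<sigma>))"
proof -
  let ?U = "\<lambda>\<sigma>. \<beta> * volume_energy (set xs) \<sigma>"
  let ?\<omega> = "gibbs_state xs ?U"
  let ?A = "Bcontfun (poisson (\<Lambda>1 \<union> \<Lambda>2) a b)"
  let ?B = "Bcontfun (\<lambda>\<sigma>. b \<sigma> * apply_bcontfun (\<Sum>X\<in>Pow (set xs) \<inter> meeting \<Lambda>1. phi_bracket \<Lambda>1 a X) \<sigma>)"
  have U: "c1_at x ?U" for x by (rule volume_energy) simp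
  then have st: "is_state ?\<omega>" by (intro is_state_gibbs_state) (simp add: c1_at_def)
  have "Ck 1 \<Lambda>1 a" "Ck 1 \<Lambda>2 b" "Ck 2 \<Lambda>1 a" using a b unfolding Csmooth_def by blast+
  then have a1: "c1_at x a" and b1: "c1_at x b" for x
    using Ck_c1_at[of 0] by simp_all
  have dep: "depends_only_on \<Lambda>1 a" using \<open>Ck 1 \<Lambda>1 a\<close> by (simp add: Ck_def)
  have a2: "c1_at x (rot_field x i a)" if "x \<in> \<Lambda>1" for x i
  proof -
    have w: "(x, j) # [(x, i)] \<in> field_words 2 \<Lambda>1" "(x, i) # [] \<in> field_words 2 \<Lambda>1" for j
      using that by (auto simp: field_words_def)
    show ?thesis
      using Ck_has_rot_deriv[OF \<open>Ck 2 \<Lambda>1 a\<close> w(1)] Ck_has_rot_deriv(2)[OF \<open>Ck 2 \<Lambda>1 a\<close> w(2)]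
      by (simp add: c1_at_def)
  qed
  have bc: "continuous_on UNIV b" using b1[of undefined] by (simp add: c1_at_def)
  have sU: "site_poisson x a (cplx ?U) \<sigma> =
      complex_of_real \<beta> * (\<Sum>X\<in>Pow (set xs). site_poisson x a (cplx (\<phi> X)) \<sigma>)" for x \<sigma>
  proof -
    have "rot_field x i (cplx (\<phi> X)) \<sigma> = complex_of_real (rot_field x i (\<phi> X) \<sigma>)"
      if "X \<in> Pow (set xs)" for X i
      using that by (intro c1_at_of_real(2) c1_at) (auto intro: finite_subset)
    then have "rot_field x i (cplx ?U) \<sigma> =
        complex_of_real \<beta> * (\<Sum>X\<in>Pow (set xs). rot_field x i (cplx (\<phi> X)) \<sigma>)" for i
      unfolding c1_at_of_real(2)[OF U] volume_energy(2)[OF finite_set] by simp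
    then show ?thesis
      unfolding site_poisson_eq_hamiltonian
      by (simp add: sum_3 sum_distrib_left sum.distrib algebra_simps)
  qed
  have sum_sites: "(\<Sum>x\<in>\<Lambda>1. site_poisson x a (cplx ?U) \<sigma>) =
      complex_of_real \<beta> * apply_bcontfun (\<Sum>X\<in>Pow (set xs) \<inter> meeting \<Lambda>1. phi_bracket \<Lambda>1 a X) \<sigma>" for \<sigma>
  proof -
    let ?s = "\<lambda>X. \<Sum>x\<in>\<Lambda>1. site_poisson x a (cplx (\<phi> X)) \<sigma>"
    have "(\<Sum>X\<in>Pow (set xs). ?s X) = (\<Sum>X\<in>Pow (set xs) \<inter> meeting \<Lambda>1. ?s X)"
    proof (rule sum.mono_neutral_right)
      show "\<forall>X\<in>Pow (set xs) - Pow (set xs) \<inter> meeting \<Lambda>1. ?s X = 0"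
      proof (intro ballI sum.neutral)
        fix X x assume X: "X \<in> Pow (set xs) - Pow (set xs) \<inter> meeting \<Lambda>1" and x: "x \<in> \<Lambda>1"
        then have "finite X" "X \<inter> \<Lambda>1 = {}" by (auto simp: meeting_def intro: finite_subset)
        with x have "depends_only_on X (\<phi> X)" "x \<notin> X" using Ck1[of X] by (auto simp: Ck_def)
        then have "site_poisson x (cplx (\<phi> X)) a \<sigma> = 0"
          by (intro site_poisson_indep) (simp add: depends_only_onD)
        then show "site_poisson x a (cplx (\<phi> X)) \<sigma> = 0"
          by (subst site_poisson_antisym) simp
      qed
    qed auto
    also have "\<dots> = (\<Sum>X\<in>Pow (set xs) \<inter> meeting \<Lambda>1. apply_bcontfun (phi_bracket \<Lambda>1 a X) \<sigma>)"
      by (intro sum.cong refl apply_phi_bracket[symmetric] fin dep a1) (auto simp: meeting_def)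
    also have "\<dots> = apply_bcontfun (\<Sum>X\<in>Pow (set xs) \<inter> meeting \<Lambda>1. phi_bracket \<Lambda>1 a X) \<sigma>"
      by (induction rule: infinite_finite_induct) simp_all
    finally have "(\<Sum>X\<in>Pow (set xs). ?s X) = \<dots>" .
    moreover have "(\<Sum>x\<in>\<Lambda>1. site_poisson x a (cplx ?U) \<sigma>) =
        complex_of_real \<beta> * (\<Sum>X\<in>Pow (set xs). ?s X)"
      unfolding sU sum_distrib_left[symmetric] by (subst sum.swap) (rule refl)
    ultimately show ?thesis by simp
  qed
  have sc: "continuous_on UNIV (site_poisson x a b)"
    "continuous_on UNIV (site_poisson x a (cplx ?U))" for x
    by (intro site_poisson_continuous a1 b1 c1_at_of_real U)+
  have "poisson (\<Lambda>1 \<union> \<Lambda>2) a b = (\<lambda>\<sigma>. \<Sum>x\<in>\<Lambda>1. site_poisson x a b \<sigma>)"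
    using fin by (intro ext poisson_eq_sum_support dep a1 b1) auto
  then have "?\<omega> ?A = (\<Sum>x\<in>\<Lambda>1. ?\<omega> (Bcontfun (site_poisson x a b)))"
    by (simp add: is_state_sum[OF st fin(1)] sc)
  also have "\<dots> = (\<Sum>x\<in>\<Lambda>1. ?\<omega> (Bcontfun (\<lambda>\<sigma>. b \<sigma> * site_poisson x a (cplx ?U) \<sigma>)))"
    using xs by (intro sum.cong refl gibbs_state_site_KMS a1 a2 b1 U) auto
  also have "\<dots> = ?\<omega> (Bcontfun (\<lambda>\<sigma>. \<Sum>x\<in>\<Lambda>1. b \<sigma> * site_poisson x a (cplx ?U) \<sigma>))"
    by (rule is_state_sum[symmetric, OF st fin(1)]) (intro continuous_on_mult bc sc)
  also have "(\<lambda>\<sigma>. \<Sum>x\<in>\<Lambda>1. b \<sigma> * site_poisson x a (cplx ?U) \<sigma>) =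
      (\<lambda>\<sigma>. of_real \<beta> * apply_bcontfun ?B \<sigma>)"
  proof
    fix \<sigma>
    have cB: "continuous_on UNIV (\<lambda>\<sigma>. b \<sigma> * apply_bcontfun D \<sigma>)" for D
      by (intro continuous_on_mult bc continuous_on_apply_bcontfun)
    show "(\<Sum>x\<in>\<Lambda>1. b \<sigma> * site_poisson x a (cplx ?U) \<sigma>) =
        of_real \<beta> * apply_bcontfun ?B \<sigma>"
      unfolding sum_distrib_left[symmetric] sum_sites apply_Bcontfun_config[OF cB] by (rule mult.left_commute)
  qed
  also have "?\<omega> (Bcontfun \<dots>) = of_real \<beta> * ?\<omega> ?B"
    by (rule is_state_scale[OF st])
  finally show ?thesis .
qed

text \<open>The truncated derivations \<open>?S \<Lambda>\<close> converge to the full one in the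
  sup norm. As all states obey the same norm bound, the finite-volume states satisfy the full
  condition up to an arbitrarily small error, and the condition passes to the cluster point.\<close>

lemma KMS_exists: "\<exists>\<omega>. classical_KMS \<beta> \<phi> \<omega>"
proof -
  define enum where "enum \<Lambda> = (SOME xs. set xs = \<Lambda>)" for \<Lambda> :: "'g set"
  have enum: "set (enum \<Lambda>) = \<Lambda>" if "finite \<Lambda>" for \<Lambda>
    unfolding enum_def using someI_ex[OF finite_list[OF that]] .
  define \<Omega> where "\<Omega> \<Lambda> = gibbs_state (enum \<Lambda>) (\<lambda>\<sigma>. \<beta> * volume_energy (set (enum \<Lambda>)) \<sigma>)" for \<Lambda>
  have st: "is_state (\<Omega> \<Lambda>)" for \<Lambda>
    unfolding \<Omega>_def
    by (rule is_state_gibbs_state) (use volume_energy(1)[of "set (enum \<Lambda>)"] in \<open>simp add: c1_at_def\<close>)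
  let ?F = "finite_subsets_at_top (UNIV :: 'g set)"
  obtain \<omega> G where G: "G \<noteq> bot" "G \<le> filtermap \<Omega> ?F" "\<And>f. ((\<lambda>\<eta>. \<eta> f) \<longlongrightarrow> \<omega> f) G" "is_state \<omega>"
    using state_cluster_point[of ?F \<Omega>] st by (metis always_eventually finite_subsets_at_top_neq_bot)
  have "classical_KMS \<beta> \<phi> \<omega>"
    unfolding classical_KMS_def
  proof (intro conjI allI impI G(4))
    fix \<Lambda>1 \<Lambda>2 :: "'g set" and a b :: "'g config \<Rightarrow> complex"
    assume fin: "finite \<Lambda>1" "finite \<Lambda>2" and a: "Csmooth \<Lambda>1 a" and b: "Csmooth \<Lambda>2 b"
    let ?A = "Bcontfun (poisson (\<Lambda>1 \<union> \<Lambda>2) a b)"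
    let ?B = "\<lambda>D. Bcontfun (\<lambda>\<sigma>. b \<sigma> * apply_bcontfun D \<sigma>)"
    let ?D = "derivation \<phi> \<Lambda>1 a"
    let ?S = "\<lambda>\<Lambda>. \<Sum>X\<in>Pow \<Lambda> \<inter> meeting \<Lambda>1. phi_bracket \<Lambda>1 a X"
    have "Ck 1 \<Lambda>1 a" "Ck 1 \<Lambda>2 b" using a b unfolding Csmooth_def by blast+
    then have a1: "c1_at x a" and bc: "continuous_on UNIV b" and dep: "depends_only_on \<Lambda>1 a" for x
      using Ck_c1_at[of 0 \<Lambda>1 a] Ck_continuous[of 1 \<Lambda>2 b] by (simp_all, simp add: Ck_def)
    obtain Bb where Bb: "Bb > 0" "\<And>\<sigma>. norm (b \<sigma>) \<le> Bb" using bounded_continuous_config[OF bc] by metis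
    have lim: "((\<lambda>\<F>. \<Sum>X\<in>\<F>. phi_bracket \<Lambda>1 a X) \<longlongrightarrow> ?D) (finite_subsets_at_top (meeting \<Lambda>1))"
      using has_sum_infsum[OF phi_bracket_summable[OF fin(1) dep a1]]
      by (simp add: has_sum_def derivation_eq)
    \<comment> \<open>Every finite family of interaction sets is captured as soon as the volume
      contains its union.\<close>
    have "filterlim (\<lambda>\<Lambda>. Pow \<Lambda> \<inter> meeting \<Lambda>1) (finite_subsets_at_top (meeting \<Lambda>1)) ?F"
      unfolding filterlim_finite_subsets_at_top
    proof (intro allI impI)
      fix \<F> assume \<F>: "finite \<F> \<and> \<F> \<subseteq> meeting \<Lambda>1"
      then have "finite (\<Union>\<F>)" by (auto simp: meeting_def)
      then show "\<forall>\<^sub>F \<Lambda> in ?F. finite (Pow \<Lambda> \<inter> meeting \<Lambda>1) \<and> \<F> \<subseteq> Pow \<Lambda> \<inter> meeting \<Lambda>1 \<and>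
          Pow \<Lambda> \<inter> meeting \<Lambda>1 \<subseteq> meeting \<Lambda>1"
        unfolding eventually_finite_subsets_at_top using \<F>
        by (intro exI[of _ "\<Union>\<F>"]) auto
    qed
    from filterlim_compose[OF lim this]
    have limS: "(?S \<longlongrightarrow> ?D) ?F" by simp
    have "norm (\<omega> ?A - of_real \<beta> * \<omega> (?B ?D)) \<le> e" if e: "e > 0" for e
    proof -
      \<comment> \<open>Chosen to absorb |\<beta>|, the factor 2 of \<open>is_state_bound\<close>
        and the bound on b; the summand 1 covers \<beta> = 0.\<close>
      define e' where "e' = e / (\<bar>\<beta>\<bar> * (2 * Bb) + 1)"
      have pos: "\<bar>\<beta>\<bar> * (2 * Bb) + 1 > 0" using Bb(1) by (simp add: add_nonneg_pos)
      have e': "e' > 0" using e pos by (simp add: e'_def)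
      have "\<forall>\<^sub>F \<Lambda> in ?F. finite \<Lambda> \<and> \<Lambda>1 \<subseteq> \<Lambda>"
        unfolding eventually_finite_subsets_at_top using fin(1) by blast
      moreover have "\<forall>\<^sub>F \<Lambda> in ?F. dist (?S \<Lambda>) ?D < e'" by (rule tendstoD[OF limS e'])
      ultimately have "\<forall>\<^sub>F \<Lambda> in ?F. norm (\<Omega> \<Lambda> ?A - of_real \<beta> * \<Omega> \<Lambda> (?B ?D)) \<le> e"
      proof eventually_elim
        case (elim \<Lambda>)
        have cB: "continuous_on UNIV (\<lambda>\<sigma>. b \<sigma> * apply_bcontfun D \<sigma>)" for D
          by (intro continuous_on_mult bc continuous_on_apply_bcontfun)
        have "\<Omega> \<Lambda> ?A = of_real \<beta> * \<Omega> \<Lambda> (?B (?S \<Lambda>))"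
          using finite_volume_KMS[of \<Lambda>1 "enum \<Lambda>" \<Lambda>2 a b \<beta>] elim enum[of \<Lambda>] fin a b
          by (simp add: \<Omega>_def)
        moreover have "?B (?S \<Lambda>) = ?B ?D + ?B (?S \<Lambda> - ?D)"
          by (rule bcontfun_eqI, unfold apply_plus_bcontfun apply_Bcontfun_config[OF cB])
            (simp add: distrib_left[symmetric])
        ultimately have "\<Omega> \<Lambda> ?A - of_real \<beta> * \<Omega> \<Lambda> (?B ?D) = of_real \<beta> * \<Omega> \<Lambda> (?B (?S \<Lambda> - ?D))"
          by (simp add: is_state_add[OF st] distrib_left)
        also have "norm \<dots> \<le> \<bar>\<beta>\<bar> * (2 * norm (?B (?S \<Lambda> - ?D)))"
          unfolding norm_mult norm_of_real by (intro mult_left_mono is_state_bound st) simp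
        also have "norm (?B (?S \<Lambda> - ?D)) \<le> Bb * e'"
        proof (rule norm_bound)
          fix \<sigma>
          have "norm (apply_bcontfun (?S \<Lambda> - ?D) \<sigma>) \<le> e'"
            using norm_bounded[of "?S \<Lambda> - ?D" \<sigma>] elim(2) unfolding dist_norm by linarith
          then show "norm (apply_bcontfun (?B (?S \<Lambda> - ?D)) \<sigma>) \<le> Bb * e'"
            unfolding apply_Bcontfun_config[OF cB] norm_mult
            using Bb by (intro mult_mono) auto
        qed
        then have "\<bar>\<beta>\<bar> * (2 * norm (?B (?S \<Lambda> - ?D))) \<le> \<bar>\<beta>\<bar> * (2 * (Bb * e'))"
          by (intro mult_left_mono) auto
        also have "\<dots> \<le> (\<bar>\<beta>\<bar> * (2 * Bb) + 1) * e'" using e' by (simp add: algebra_simps)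
        also have "\<dots> = e" using pos by (simp add: e'_def)
        finally show ?case .
      qed
      then have "\<forall>\<^sub>F \<eta> in G. norm (\<eta> ?A - of_real \<beta> * \<eta> (?B ?D)) \<le> e"
        by (intro filter_leD[OF G(2)]) (simp add: eventually_filtermap)
      moreover have "((\<lambda>\<eta>. norm (\<eta> ?A - of_real \<beta> * \<eta> (?B ?D))) \<longlongrightarrow>
          norm (\<omega> ?A - of_real \<beta> * \<omega> (?B ?D))) G"
        by (rule tendsto_norm, rule tendsto_diff[OF G(3)], rule tendsto_mult[OF tendsto_const G(3)])
      ultimately show ?thesis by (rule tendsto_upperbound[OF _ _ G(1), rotated])
    qed
    then have "norm (\<omega> ?A - of_real \<beta> * \<omega> (?B ?D)) \<le> 0"
      using field_le_epsilon[of "norm (\<omega> ?A - of_real \<beta> * \<omega> (?B ?D))" 0] by simp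
    then show "\<omega> ?A = of_real \<beta> * \<omega> (?B ?D)" by simp
  qed
  then show ?thesis by blast
qed

end

section \<open>The critical inverse temperature\<close>

text \<open>A rotation field replaces u by u \<times> e_i, which is no longer than u. So no iterated
  derivative of a linear function can exceed the norm of u.\<close>

lemma apply_word_lin:
  "\<exists>v. norm v \<le> norm u \<and> apply_word w (\<lambda>\<sigma>::unit config. complex_of_real (lin () u \<sigma>)) =
    (\<lambda>\<sigma>. complex_of_real (lin () v \<sigma>))"
proof (induction w)
  case Nil
  then show ?case by auto
next
  case (Cons xi w)
  then obtain v where v: "norm v \<le> norm u" "apply_word w (\<lambda>\<sigma>::unit config. complex_of_real (lin () u \<sigma>)) =
    (\<lambda>\<sigma>. complex_of_real (lin () v \<sigma>))" by blast
  obtain i where xi: "xi = ((), i)" by (cases xi) auto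
  have "(norm (cross3 v (axis i 1)))\<^sup>2 \<le> (norm v)\<^sup>2"
    unfolding norm_cross by simp
  then have "norm (cross3 v (axis i 1)) \<le> norm v" by (rule power2_le_imp_le) simp
  then have "norm (cross3 v (axis i 1)) \<le> norm u" using v(1) by linarith
  then show ?case
    by (intro exI[of _ "cross3 v (axis i 1)"])
      (simp add: xi v(2) rot_field_eq[OF has_rot_deriv_of_real[OF has_rot_deriv_lin]])
qed

lemma abs_lin_le: "\<bar>lin x v \<sigma>\<bar> \<le> norm v"
  using Cauchy_Schwarz_ineq2[of v "vec_of_s2 (\<sigma> x)"] by (simp add: lin_def)

lemma sup_norm_le: "(\<And>\<sigma>. norm (f \<sigma>) \<le> B) \<Longrightarrow> sup_norm f \<le> ennreal B"
  unfolding sup_norm_def by (intro SUP_least ennreal_leI)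

lemma norm_le_Ck_norm:
  "w \<in> field_words k \<Lambda> \<Longrightarrow> ennreal (norm (apply_word w f \<sigma>)) \<le> Ck_norm k \<Lambda> f"
  unfolding Ck_norm_def sup_norm_def by (rule SUP_upper2[of w]) (auto intro: SUP_upper)

lemma Ck_norm_0: "Ck_norm 0 \<Lambda> f = sup_norm f"
  by (simp add: Ck_norm_def field_words_def cong: conj_cong)

text \<open>The coordinate function \<open>z\<close> has \<open>C\<^sup>2\<close>-norm \<open>1\<close> and satisfies \<open>(1 - \<Delta>) z = 3 z\<close>.\<close>

lemma C_Delta_ge_3: "C_Delta \<ge> 3"
proof -
  let ?F = "{f :: unit config \<Rightarrow> complex. Ck 2 UNIV f \<and> Ck_norm 2 UNIV f \<le> 1}"
  let ?N = "\<lambda>f :: unit config \<Rightarrow> complex. Ck_norm 0 UNIV (\<lambda>\<sigma>. f \<sigma> - laplacian f \<sigma>)"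
  define u :: "real^3" where "u = axis 3 1"
  define f where "f \<sigma> = complex_of_real (lin () u \<sigma>)" for \<sigma> :: "unit config"
  have "Csmooth UNIV f"
    unfolding f_def by (rule poly_fun_Csmooth[OF poly_fun_lin]) (simp add: depends_only_on_def lin_def)
  then have "Ck 2 UNIV f" by (simp add: Csmooth_def)
  moreover have "Ck_norm 2 UNIV f \<le> 1"
    unfolding Ck_norm_def
  proof (rule SUP_least)
    fix w
    obtain v where v: "norm v \<le> norm u" "apply_word w f = (\<lambda>\<sigma>. complex_of_real (lin () v \<sigma>))"
      using apply_word_lin[of u w] unfolding f_def by blast
    have "norm (apply_word w f \<sigma>) \<le> 1" for \<sigma>
      using abs_lin_le[of "()" v \<sigma>] v(1) by (simp add: v(2) u_def)
    from sup_norm_le[OF this] show "sup_norm (apply_word w f) \<le> 1" by simp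
  qed
  ultimately have f: "f \<in> ?F" by simp
  have rf: "rot_field () i (\<lambda>\<sigma>::unit config. complex_of_real (lin () v \<sigma>)) =
      (\<lambda>\<sigma>. complex_of_real (lin () (cross3 v (axis i 1)) \<sigma>))" for i v
    by (rule rot_field_eq[OF has_rot_deriv_of_real[OF has_rot_deriv_lin]])
  \<comment> \<open>The sum over i of (u \<times> e_i) \<times> e_i is -2 u: linear functions are
    eigenfunctions of the Laplacian for the eigenvalue -2.\<close>
  have "f \<sigma> - laplacian f \<sigma> = complex_of_real (3 * lin () u \<sigma>)" for \<sigma>
    unfolding laplacian_def f_def rf sum_3
    by (simp add: u_def lin_def cross3_def axis_def vector_def inner_vec_def sum_3)
  from this[of "\<lambda>_. Abs_s2 u"] have val: "norm (f (\<lambda>_. Abs_s2 u) - laplacian f (\<lambda>_. Abs_s2 u)) = 3"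
    by (simp add: lin_def Abs_s2_inverse u_def inner_axis_axis)
  have "ennreal 3 \<le> ?N f"
    unfolding Ck_norm_0 sup_norm_def by (rule SUP_upper2[of "\<lambda>_. Abs_s2 u"]) (simp_all add: val)
  also have "\<dots> \<le> (SUP f\<in>?F. ?N f)" by (rule SUP_upper[OF f])
  finally have ge: "ennreal 3 \<le> (SUP f\<in>?F. ?N f)" .
  \<comment> \<open>\<open>enn2real\<close> maps infinity to 0, so the lower bound reaches
    \<open>C_Delta\<close> only after the supremum is known to be finite. 4 bounds the function and
    its three second derivatives, each at most 1.\<close>
  have "(SUP f\<in>?F. ?N f) \<le> ennreal 4"
  proof (rule SUP_least)
    fix g :: "unit config \<Rightarrow> complex" assume g: "g \<in> ?F"
    have le: "norm (apply_word w g \<sigma>) \<le> 1" if "length w \<le> 2" for w \<sigma>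
    proof -
      have "ennreal (norm (apply_word w g \<sigma>)) \<le> Ck_norm 2 UNIV g"
        using that by (intro norm_le_Ck_norm) (auto simp: field_words_def)
      also have "\<dots> \<le> ennreal 1" using g by simp
      finally show ?thesis by (simp add: ennreal_le_iff)
    qed
    have "norm (g \<sigma> - laplacian g \<sigma>) \<le> 4" for \<sigma>
    proof -
      have "norm (laplacian g \<sigma>) \<le> 3"
        unfolding laplacian_def
        using norm_triangle_mono[OF norm_triangle_mono[OF le[of "[((), 1), ((), 1)]" \<sigma>] le[of "[((), 2), ((), 2)]" \<sigma>]]
            le[of "[((), 3), ((), 3)]" \<sigma>]]
        by (simp add: sum_3)
      then show ?thesis using le[of "[]" \<sigma>] norm_triangle_ineq4[of "g \<sigma>" "laplacian g \<sigma>"] by simp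
    qed
    then show "?N g \<le> ennreal 4" unfolding Ck_norm_0 by (rule sup_norm_le)
  qed
  then have "(SUP f\<in>?F. ?N f) < top" using order_le_less_trans ennreal_less_top by blast
  then have "enn2real (ennreal 3) \<le> C_Delta"
    unfolding C_Delta_def by (intro enn2real_mono ge)
  then show ?thesis by simp
qed

text \<open>The term l = 0 equals 1 and all terms are nonnegative. This bounds the value of the
  infinite sum only if the series converges; its terms are of order l^(5/2 - 2 s), which is summable
  exactly because s > 7/4.\<close>

lemma K_const_ge_1:
  assumes "s > 7 / 4"
  shows "K_const s \<ge> 1"
proof -
  let ?f = "\<lambda>l::nat. (2 * real l + 1) powr (5/2) / (1 + real l * (real l + 1)) powr s"
  have "summable (\<lambda>l. 4 powr s * (real (Suc l)) powr (5/2 - 2 * s))"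
    using assms summable_real_powr_iff[of "5/2 - 2 * s"]
    by (intro summable_mult summable_Suc_iff[THEN iffD2]) simp
  moreover have "norm (?f l) \<le> 4 powr s * (real (Suc l)) powr (5/2 - 2 * s)" for l
  proof -
    let ?t = "2 * real l + 1"
    have pos: "1 + real l * (real l + 1) > 0" "(?t / 2)\<^sup>2 > 0" by (simp_all add: add_pos_nonneg)
    \<comment> \<open>Completing the square: 1 + l (l + 1) = (l + 1/2)^2 + 3/4.\<close>
    have "(?t / 2)\<^sup>2 \<le> 1 + real l * (real l + 1)"
      by (simp add: power2_eq_square field_simps)
    then have "((?t / 2)\<^sup>2) powr s \<le> (1 + real l * (real l + 1)) powr s"
      using assms by (intro powr_mono2) auto
    then have "?f l \<le> ?t powr (5/2) / ((?t / 2)\<^sup>2) powr s"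
      using pos by (intro divide_left_mono mult_pos_pos) auto
    also have "((?t / 2)\<^sup>2) powr s = ?t powr (2 * s) / 4 powr s"
    proof -
      have "((?t / 2)\<^sup>2) powr s = (?t\<^sup>2 / 4) powr s" by (simp add: power_divide)
      also have "\<dots> = (?t\<^sup>2) powr s / 4 powr s" by (rule powr_divide)
      also have "(?t\<^sup>2) powr s = ?t powr (2 * s)"
        by (simp add: powr_powr[symmetric] powr_numeral)
      finally show ?thesis .
    qed
    also have "?t powr (5/2) / (?t powr (2 * s) / 4 powr s) = 4 powr s * ?t powr (5/2 - 2 * s)"
      by (simp add: powr_diff)
    also have "\<dots> \<le> 4 powr s * (real (Suc l)) powr (5/2 - 2 * s)"
      using assms by (intro mult_left_mono powr_mono2') auto
    finally show ?thesis by simp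
  qed
  ultimately have "summable ?f" by (rule summable_comparison_test'[where N = 0])
  from sum_le_suminf[OF this, of "{0}"] show ?thesis by (simp add: K_const_def)
qed

text \<open>A finite set of sites has finitely many words of bounded length, and each derivative is
  bounded by compactness.\<close>

lemma Ck_norm_finite:
  assumes "finite X" "Ck k X f"
  shows "Ck_norm k X f < \<infinity>"
proof -
  have "field_words k X = {w. set w \<subseteq> X \<times> UNIV \<and> length w \<le> k}" by (simp add: field_words_def)
  then have fin: "finite (field_words k X)"
    using finite_lists_length_le[of "X \<times> (UNIV :: 3 set)" k] assms(1) by simp
  have "\<exists>B>0. \<forall>\<sigma>. norm (apply_word w f \<sigma>) \<le> B" if "w \<in> field_words k X" for w
    using assms(2) that bounded_continuous_config[of "apply_word w f"] unfolding Ck_def by metis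
  then obtain B where B: "\<And>w. w \<in> field_words k X \<Longrightarrow> B w > 0"
    "\<And>w \<sigma>. w \<in> field_words k X \<Longrightarrow> norm (apply_word w f \<sigma>) \<le> B w" by metis
  have "Ck_norm k X f \<le> ennreal (sum B (field_words k X))"
    unfolding Ck_norm_def
  proof (intro SUP_least sup_norm_le)
    fix w \<sigma> assume w: "w \<in> field_words k X"
    have "B w \<le> sum B (field_words k X)"
      using w by (intro member_le_sum fin) (auto simp: less_imp_le B(1))
    with B(2)[OF w, of \<sigma>] show "norm (apply_word w f \<sigma>) \<le> sum B (field_words k X)" by linarith
  qed
  then show ?thesis using order_le_less_trans ennreal_less_top by fastforce
qed

text \<open>The weight A^m of the potential norm dominates the cardinality: m + 1 \<le> 2^m \<le>
  A^m. Partial sums are compared because the infinite weighted sum is not yet known to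
  converge.\<close>

lemma weighted_partial_sum_le:
  fixes t :: "'g set \<Rightarrow> ennreal" and A :: real
  assumes A: "A \<ge> 3" and F: "finite F" "F \<subseteq> {X. finite X \<and> x \<in> X}"
  shows "(\<Sum>X\<in>F. ennreal (real (card X)) * t X) \<le>
    (\<Sum>m. ennreal (A ^ m) * (SUP x. \<Sum>\<^sub>\<infinity>\<Lambda>\<in>{\<Lambda>. finite \<Lambda> \<and> card \<Lambda> = m + 1 \<and> x \<in> \<Lambda>}. t \<Lambda>))"
    (is "_ \<le> (\<Sum>m. ?a m)")
proof -
  obtain M where M: "\<And>X. X \<in> F \<Longrightarrow> card X - 1 < M"
    using F(1) finite_nat_set_iff_bounded[of "(\<lambda>X. card X - 1) ` F"] by auto
  \<comment> \<open>Grouped by m = \<open>card X - 1\<close>; the subtraction loses nothing, since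
    every X in F contains x.\<close>
  have "(\<Sum>X\<in>F. ennreal (real (card X)) * t X) =
      (\<Sum>m<M. \<Sum>X\<in>{X \<in> F. card X - 1 = m}. ennreal (real (card X)) * t X)"
    by (rule sum.group[symmetric]) (use F M in auto)
  also have "\<dots> \<le> (\<Sum>m<M. ?a m)"
  proof (rule sum_mono)
    fix m
    let ?G = "{X \<in> F. card X - 1 = m}"
    let ?S = "{\<Lambda>. finite \<Lambda> \<and> card \<Lambda> = m + 1 \<and> x \<in> \<Lambda>}"
    have card: "card X = m + 1" "finite X" "x \<in> X" if "X \<in> ?G" for X
    proof -
      show "finite X" "x \<in> X" using that F(2) by auto
      then have "card X > 0" by (auto simp: card_gt_0_iff)
      then show "card X = m + 1" using that by auto
    qed
    have "real (m + 1) \<le> A ^ m"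
    proof -
      have "real (m + 1) \<le> 2 ^ m" by (induction m) auto
      also have "\<dots> \<le> A ^ m" using A by (intro power_mono) auto
      finally show ?thesis .
    qed
    then have le: "ennreal (real (m + 1)) \<le> ennreal (A ^ m)" by (rule ennreal_leI)
    have "(\<Sum>X\<in>?G. ennreal (real (card X)) * t X) \<le> (\<Sum>X\<in>?G. ennreal (A ^ m) * t X)"
    proof (rule sum_mono)
      fix X assume "X \<in> ?G"
      then have "card X = m + 1" by (rule card(1))
      with le show "ennreal (real (card X)) * t X \<le> ennreal (A ^ m) * t X"
        by (simp only: mult_right_mono zero_le)
    qed
    also have "\<dots> = ennreal (A ^ m) * sum t ?G" by (simp add: sum_distrib_left)
    also have "sum t ?G \<le> infsum t ?S"
      unfolding nonneg_infsum_complete[of ?S t, OF zero_le]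
    proof (intro SUP_upper CollectI conjI subsetI)
      show "finite ?G" using F(1) by simp
    qed (erule card)+
    also have "infsum t ?S \<le> (SUP x. \<Sum>\<^sub>\<infinity>\<Lambda>\<in>{\<Lambda>. finite \<Lambda> \<and> card \<Lambda> = m + 1 \<and> x \<in> \<Lambda>}. t \<Lambda>)"
      by (rule SUP_upper) simp
    finally show "(\<Sum>X\<in>?G. ennreal (real (card X)) * t X) \<le> ?a m" by (simp add: mult_left_mono)
  qed
  also have "\<dots> \<le> (\<Sum>m. ?a m)" by (rule sum_le_suminf) auto
  finally show ?thesis .
qed

theorem theorem4p1:
  fixes s :: real
    and \<phi> :: "(int ^ 'd::finite) set \<Rightarrow> (int ^ 'd) config \<Rightarrow> real"
  assumes "s > 7 / 4"
    and "\<And>\<Lambda>. finite \<Lambda> \<Longrightarrow> Cr (2 * s) \<Lambda> (\<phi> \<Lambda>)"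
    and "potential_norm s \<phi> < \<infinity>"
  shows "\<forall>\<beta>. 0 \<le> \<beta> \<longrightarrow> ennreal \<beta> < beta_crit s \<phi> \<longrightarrow> (\<exists>!\<omega>. classical_KMS \<beta> \<phi> \<omega>)"
proof (intro allI impI)
  fix \<beta> :: real assume \<beta>: "0 \<le> \<beta>" "ennreal \<beta> < beta_crit s \<phi>"
  define A where "A = C_Delta powr s * K_const s"
  define N where "N = enn2real (potential_norm s \<phi>)"
  have N: "potential_norm s \<phi> = ennreal N" "N \<ge> 0"
    using assms(3) by (simp_all add: N_def)
  have "3 powr 1 \<le> (3::real) powr s" using assms(1) by (intro powr_mono) auto
  also have "\<dots> \<le> C_Delta powr s" using assms(1) C_Delta_ge_3 by (intro powr_mono2) auto
  finally have "3 * 1 \<le> A"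
    unfolding A_def using K_const_ge_1[OF assms(1)] by (intro mult_mono) auto
  then have A: "A \<ge> 3" by simp
  \<comment> \<open>The C^1 norm is what the locale needs: it bounds the interaction and its first
    rotation derivatives, and it is dominated by the C^(2s) norm because 2 s > 1.\<close>
  define n where "n X = enn2real (Ck_norm 1 X (\<phi> X))" for X
  have "nat \<lfloor>2 * s\<rfloor> \<ge> 1" using assms(1) by (simp add: le_nat_iff le_floor_iff)
  then have Ck1: "Ck 1 X (\<phi> X)" if "finite X" for X
    using assms(2)[OF that] Ck_mono by (auto simp: Cr_def)
  have n: "Ck_norm 1 X (\<phi> X) = ennreal (n X)" if "finite X" for X
    using Ck_norm_finite[OF that Ck1[OF that]] by (simp add: n_def)
  have n0: "n X \<ge> 0" for X by (simp add: n_def)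
  have word: "norm (apply_word w (\<phi> X) \<sigma>) \<le> n X" if "finite X" "w \<in> field_words 1 X" for X w \<sigma>
    using norm_le_Ck_norm[OF that(2), of "\<phi> X" \<sigma>] unfolding n[OF that(1)] by (simp add: n0)
  have n_le: "ennreal (n X) \<le> Cr_norm (2 * s) X (\<phi> X)" if "finite X" for X
  proof -
    have "Ck_norm 1 X (\<phi> X) \<le> Ck_norm (nat \<lfloor>2 * s\<rfloor>) X (\<phi> X)"
      unfolding Ck_norm_def using \<open>nat \<lfloor>2 * s\<rfloor> \<ge> 1\<close>
      by (intro SUP_subset_mono) (auto simp: field_words_def)
    also have "\<dots> \<le> Cr_norm (2 * s) X (\<phi> X)" by (simp add: Cr_norm_def)
    finally show ?thesis unfolding n[OF that] .
  qed
  have partial: "(\<Sum>X\<in>F. real (card X) * n X) \<le> N" if F: "finite F" "F \<subseteq> {X. finite X \<and> x \<in> X}" for F x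
  proof -
    have "ennreal (\<Sum>X\<in>F. real (card X) * n X) = (\<Sum>X\<in>F. ennreal (real (card X)) * ennreal (n X))"
      by (simp add: n0 ennreal_mult flip: sum_ennreal)
    also have "\<dots> \<le> (\<Sum>X\<in>F. ennreal (real (card X)) * Cr_norm (2 * s) X (\<phi> X))"
      using F n_le by (intro sum_mono mult_left_mono) auto
    also have "\<dots> \<le> potential_norm s \<phi>"
      unfolding potential_norm_def A_def[symmetric] by (rule weighted_partial_sum_le[OF A F])
    finally show ?thesis using N by (simp add: ennreal_le_iff)
  qed
  interpret interaction \<phi> n
  proof
    fix X :: "(int ^ 'd) set" and x i and \<sigma> :: "(int ^ 'd) config"
    assume X: "finite X"
    show "Ck 1 X (\<phi> X)" by (rule Ck1[OF X])
    show "\<bar>\<phi> X \<sigma>\<bar> \<le> n X" using word[OF X, of "[]" \<sigma>] by (simp add: field_words_def)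
    show "\<bar>rot_field x i (\<phi> X) \<sigma>\<bar> \<le> n X"
    proof (cases "x \<in> X")
      case True
      then show ?thesis using word[OF X, of "[(x, i)]" \<sigma>] by (simp add: field_words_def)
    next
      case False
      have "depends_only_on X (\<phi> X)" using Ck1[OF X] by (simp add: Ck_def)
      then have "rot_field x i (\<phi> X) = (\<lambda>_. 0)"
        by (intro rot_field_indep depends_only_onD[OF _ False])
      then show ?thesis using n0 by simp
    qed
  next
    fix x
    show "(\<lambda>X. real (card X) * n X) summable_on {X. finite X \<and> x \<in> X}"
      by (rule nonneg_bdd_above_summable_on) (auto intro!: bdd_aboveI[of _ N] partial simp: n0)
  qed
  have strength: "strength x \<le> N" for x
    unfolding strength_def star_def
    by (rule infsum_le_finite_sums[OF weighted_summable partial]) auto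
  \<comment> \<open>A \<ge> 3 gives \<beta> N \<cdot> 6 \<le> \<beta> N \<cdot> 2 A < log 2. For N =
    0 the critical value is infinite, but the bound is trivial.\<close>
  have small: "\<beta> * N \<le> ln 2 / 6"
  proof (cases "N = 0")
    case False
    then have Np: "N > 0" using N(2) by simp
    have "beta_crit s \<phi> = ennreal (ln 2 / (2 * A * N))"
      unfolding beta_crit_def A_def[symmetric] N(1) using A Np
      by (simp add: divide_ennreal ennreal_mult[symmetric] flip: ennreal_numeral)
    then have "\<beta> < ln 2 / (2 * A * N)" using \<beta> A Np by (simp add: ennreal_less_iff)
    then have "\<beta> * N * (2 * A) < ln 2" using A Np by (simp add: field_simps)
    moreover have "\<beta> * N * 6 \<le> \<beta> * N * (2 * A)" using A \<beta>(1) Np by (intro mult_left_mono) auto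
    ultimately have "\<beta> * N * 6 < ln 2" by linarith
    then show ?thesis by simp
  qed simp
  \<comment> \<open>8 \<cdot> (log 2) / 6 with log 2 \<le> 25/36 is (4/3) \<cdot> (25/36) = 25/27,
    strictly below 1 as Dobrushin's criterion requires.\<close>
  have c: "8 * (\<beta> * strength x) \<le> 25 / 27" for x
    using mult_left_mono[OF strength[of x] \<beta>(1)] small ln2_le_25_over_36 by linarith
  obtain \<omega> where "classical_KMS \<beta> \<phi> \<omega>" using KMS_exists by blast
  then show "\<exists>!\<omega>. classical_KMS \<beta> \<phi> \<omega>"
    using KMS_unique[OF \<beta>(1) c] by (intro ex1I) auto
qed

end
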